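(* Let $\alpha\in(0,1)$, $r_\star\in(0,1)$ and $\mu\in[1/2,1]$ such that $4\mu+\alpha\notin\mathbb{Z}$. Then the equilibrium $r_\star$ of the axisymmetric surface diffusion problem (ASD) is unstable in the topology of $h^{4\mu+\alpha}(\mathbb{T})$ for initial values in $h^{4\mu+\alpha}(\mathbb{T})$. More precisely, there exist $\varepsilon>0$ and a sequence of (positive) initial values $(r_n)\subset h^{4\mu+\alpha}(\mathbb{T})$ such that (1) $\lim_{n\to\infty}\|r_n-r_\star\|_{h^{4\mu+\alpha}}=0$, and (2) for each $n$ there exists $t_n\in J(r_n)$ so that $\|r(t_n,r_n)-r_\star\|_{h^{4\mu+\alpha}}\ge\varepsilon$.
   Context: Problem (ASD): for a positive function $r=r(t,x)$, $2\pi$-periodic in $x$ (i.e. $x\in\mathbb{T}$), $$r_t=\frac1r\,\partial_x\Big[\frac{r}{\sqrt{1+r_x^2}}\,\partial_x\mathcal{H}(r)\Big]\ (t>0),\qquad r(0,\cdot)=r_0,\qquad \mathcal{H}(r)=\frac{1}{r\sqrt{1+r_x^2}}-\frac{r_{xx}}{(1+r_x^2)^{3/2}}.$$ The constant function $r_\star$ (cylinder of radius $r_\star$) is an equilibrium. For each positive $r_0\in h^{4\mu+\alpha}(\mathbb{T})$ there is a unique maximal solution $r(\cdot,r_0)\in C^1_{1-\mu}(J(r_0),h^{\alpha}(\mathbb{T}))\cap C_{1-\mu}(J(r_0),h^{4+\alpha}(\mathbb{T}))$, continuous on $J(r_0)$ with values in $h^{4\mu+\alpha}(\mathbb{T})$,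 on its maximal interval of existence $J(r_0)=[0,t^+(r_0))$. Function spaces: $\mathbb{T}=[-\pi,\pi]$ with $-\pi,\pi$ identified and metric $d_{\mathbb{T}}(x,y)=\min\{|x-y|,2\pi-|x-y|\}$. For $k\in\mathbb{N}_0$, $\alpha\in(0,1)$, $C^{k+\alpha}(\mathbb{T})$ is the usual Hölder space of real-valued functions, and $h^{k+\alpha}(\mathbb{T})=\{f\in C^{k+\alpha}(\mathbb{T}):\lim_{\delta\to0}\sup_{0<d_{\mathbb{T}}(x,y)<\delta}|f^{(k)}(x)-f^{(k)}(y)|/d_{\mathbb{T}}(x,y)^\alpha=0\}$ with the norm of $C^{k+\alpha}(\mathbb{T})$. For a Banach space $E$, an interval $J\subset\mathbb{R}_+$ containing $0$ and $\dot J:=J\setminus\{0\}$: for $\mu\in(0,1)$, $BUC_{1-\mu}(J,E)$ is the set of $u\in C(\dot J,E)$ such that $t\mapsto t^{1-\mu}u(t)$ is bounded and uniformly continuous on $\dot J$ and $\lim_{t\to0^+}t^{1-\mu}\|u(t)\|_E=0$; for $\mu=1$, $BUC_0(J,E)=BUC(J,E)$. If $J=[0,a)$, $C_{1-\mu}(J,E)=\{u\in C(\dot J,E):u\in BUC_{1-\mu}([0,T],E)\ \text{for all } T<\sup J\}$ and $C^1_{1-\mu}(J,E)=\{u\in C^1(\dot J,E):u,\dot u\in C_{1-\mu}(J,E)\}$. *)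

theory Defs
  imports "HOL-Analysis.Analysis"
begin

text \<open>
  The torus is the interval from \<open>-pi\<close> to \<open>pi\<close> with its end points identified.  A function on the
  torus is represented by its \<open>2 * pi\<close>-periodic extension to the real line, so that derivatives at the
  end points are the ordinary ones.
\<close>

definition torus :: "real set" where
  "torus = {-pi..pi}"

definition torus_dist :: "real \<Rightarrow> real \<Rightarrow> real" where
  "torus_dist x y = min \<bar>x - y\<bar> (2 * pi - \<bar>x - y\<bar>)"

definition torus_fun :: "(real \<Rightarrow> real) \<Rightarrow> bool" where
  "torus_fun f \<longleftrightarrow> (\<forall>x. f (x + 2 * pi) = f x)"


section \<open>Hoelder and little Hoelder spaces on the torus\<close>

definition holder_quotients :: "real \<Rightarrow> real set \<Rightarrow> (real \<Rightarrow> real) \<Rightarrow> real set" where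
  "holder_quotients \<beta> D g =
     {\<bar>g x - g y\<bar> / torus_dist x y powr \<beta> | x y. x \<in> torus \<and> y \<in> torus \<and> torus_dist x y \<in> D}"

definition holder_space :: "nat \<Rightarrow> real \<Rightarrow> (real \<Rightarrow> real) set" where
  "holder_space k \<beta> =
     {f. torus_fun f \<and>
         (\<forall>j<k. \<forall>x. (deriv ^^ j) f differentiable at x) \<and>
         continuous_on UNIV ((deriv ^^ k) f) \<and>
         bdd_above (holder_quotients \<beta> {0<..} ((deriv ^^ k) f))}"

definition holder_norm :: "nat \<Rightarrow> real \<Rightarrow> (real \<Rightarrow> real) \<Rightarrow> real" where
  "holder_norm k \<beta> f =
     (\<Sum>j\<le>k. SUP x\<in>torus. \<bar>(deriv ^^ j) f x\<bar>) + Sup (holder_quotients \<beta> {0<..} ((deriv ^^ k) f))"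

definition little_holder_space :: "nat \<Rightarrow> real \<Rightarrow> (real \<Rightarrow> real) set" where
  "little_holder_space k \<beta> =
     {f \<in> holder_space k \<beta>.
        ((\<lambda>\<delta>. Sup (holder_quotients \<beta> {0<..<\<delta>} ((deriv ^^ k) f))) \<longlongrightarrow> 0) (at_right 0)}"

text \<open>
  The same space and norm indexed by a single noninteger exponent \<open>s > 0\<close>, which is split into its
  integer and fractional parts.
\<close>

definition lh :: "real \<Rightarrow> (real \<Rightarrow> real) set" where
  "lh s = little_holder_space (nat \<lfloor>s\<rfloor>) (frac s)"

definition lh_norm :: "real \<Rightarrow> (real \<Rightarrow> real) \<Rightarrow> real" where
  "lh_norm s = holder_norm (nat \<lfloor>s\<rfloor>) (frac s)"


section \<open>Time-weighted spaces of functions with values in \<open>lh s\<close>\<close>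

definition continuous_lh :: "real \<Rightarrow> real set \<Rightarrow> (real \<Rightarrow> real \<Rightarrow> real) \<Rightarrow> bool" where
  "continuous_lh s S u \<longleftrightarrow>
     (\<forall>t\<in>S. u t \<in> lh s \<and> ((\<lambda>\<tau>. lh_norm s (\<lambda>x. u \<tau> x - u t x)) \<longlongrightarrow> 0) (at t within S))"

definition BUC :: "real \<Rightarrow> real set \<Rightarrow> (real \<Rightarrow> real \<Rightarrow> real) \<Rightarrow> bool" where
  "BUC s S u \<longleftrightarrow>
     (\<forall>t\<in>S. u t \<in> lh s) \<and>
     (\<exists>B. \<forall>t\<in>S. lh_norm s (u t) \<le> B) \<and>
     (\<forall>e>0. \<exists>d>0. \<forall>t\<in>S. \<forall>\<tau>\<in>S. \<bar>t - \<tau>\<bar> < d \<longrightarrow> lh_norm s (\<lambda>x. u t x - u \<tau> x) < e)"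

text \<open>
  \<open>BUC_weighted \<mu> s J\<close> is the space with weight \<open>t powr (1 - \<mu>)\<close>.  For \<open>\<mu> < 1\<close> the value at time \<open>0\<close>
  is irrelevant, whereas for \<open>\<mu> = 1\<close> it belongs to the function.
\<close>

definition BUC_weighted ::
  "real \<Rightarrow> real \<Rightarrow> real set \<Rightarrow> (real \<Rightarrow> real \<Rightarrow> real) \<Rightarrow> bool" where
  "BUC_weighted \<mu> s J u \<longleftrightarrow>
     (if \<mu> = 1 then BUC s J u
      else continuous_lh s (J - {0}) u \<and>
           BUC s (J - {0}) (\<lambda>t x. t powr (1 - \<mu>) * u t x) \<and>
           ((\<lambda>t. t powr (1 - \<mu>) * lh_norm s (u t)) \<longlongrightarrow> 0) (at 0 within (J - {0})))"

text \<open>Below, \<open>a\<close> is the possibly infinite right end point of the time interval \<open>[0, a)\<close>.\<close>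

definition C_weighted ::
  "real \<Rightarrow> real \<Rightarrow> ereal \<Rightarrow> (real \<Rightarrow> real \<Rightarrow> real) \<Rightarrow> bool" where
  "C_weighted \<mu> s a u \<longleftrightarrow>
     continuous_lh s {t. 0 < t \<and> ereal t < a} u \<and>
     (\<forall>T>0. ereal T < a \<longrightarrow> BUC_weighted \<mu> s {0..T} u)"

text \<open>
  The time derivative \<open>v\<close> is taken in the norm of \<open>lh s\<close> and only at positive times; for \<open>\<mu> = 1\<close>,
  \<open>v 0\<close> is the value of its continuous extension to time \<open>0\<close>.
\<close>

definition C1_weighted ::
  "real \<Rightarrow> real \<Rightarrow> ereal \<Rightarrow> (real \<Rightarrow> real \<Rightarrow> real) \<Rightarrow> bool" where
  "C1_weighted \<mu> s a u \<longleftrightarrow>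
     C_weighted \<mu> s a u \<and>
     (\<exists>v. C_weighted \<mu> s a v \<and>
          (\<forall>t>0. ereal t < a \<longrightarrow>
             ((\<lambda>\<tau>. lh_norm s (\<lambda>x. (u \<tau> x - u t x) / (\<tau> - t) - v t x)) \<longlongrightarrow> 0) (at t)))"


section \<open>The axisymmetric surface diffusion problem\<close>

definition mean_curv :: "(real \<Rightarrow> real) \<Rightarrow> real \<Rightarrow> real" where
  "mean_curv r x =
     1 / (r x * sqrt (1 + (deriv r x)\<^sup>2)) - deriv (deriv r) x / (1 + (deriv r x)\<^sup>2) powr (3/2)"

definition asd_rhs :: "(real \<Rightarrow> real) \<Rightarrow> real \<Rightarrow> real" where
  "asd_rhs r x =
     1 / r x * deriv (\<lambda>y. r y / sqrt (1 + (deriv r y)\<^sup>2) * deriv (mean_curv r) y) x"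

definition asd_solution ::
  "real \<Rightarrow> real \<Rightarrow> (real \<Rightarrow> real) \<Rightarrow> ereal \<Rightarrow> (real \<Rightarrow> real \<Rightarrow> real) \<Rightarrow> bool" where
  "asd_solution \<mu> \<alpha> r0 a u \<longleftrightarrow>
     0 < a \<and>
     C1_weighted \<mu> \<alpha> a u \<and>
     C_weighted \<mu> (4 + \<alpha>) a u \<and>
     continuous_lh (4 * \<mu> + \<alpha>) {t. 0 \<le> t \<and> ereal t < a} u \<and>
     (\<forall>t\<ge>0. ereal t < a \<longrightarrow> (\<forall>x. 0 < u t x)) \<and>
     u 0 = r0 \<and>
     (\<forall>t>0. ereal t < a \<longrightarrow>
        (\<forall>x. ((\<lambda>\<tau>. u \<tau> x) has_real_derivative asd_rhs (u t) x) (at t)))"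

text \<open>
  \<open>u\<close> on \<open>[0, a)\<close> is the maximal solution with initial value \<open>r0\<close>: every solution with this initial
  value is a restriction of it.  This determines \<open>a\<close>, and \<open>u\<close> on \<open>[0, a)\<close>, uniquely.
\<close>

definition asd_maximal_solution ::
  "real \<Rightarrow> real \<Rightarrow> (real \<Rightarrow> real) \<Rightarrow> ereal \<Rightarrow> (real \<Rightarrow> real \<Rightarrow> real) \<Rightarrow> bool" where
  "asd_maximal_solution \<mu> \<alpha> r0 a u \<longleftrightarrow>
     asd_solution \<mu> \<alpha> r0 a u \<and>
     (\<forall>b w. asd_solution \<mu> \<alpha> r0 b w \<longrightarrow>
        b \<le> a \<and> (\<forall>t\<ge>0. ereal t < b \<longrightarrow> w t = u t))"

end

theory Submission
  imports Defs
begin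

text \<open>
  The linearization of the equation about the cylinder has the growth rates \<open>k\<^sup>2 / r\<^sup>2 - k ^ 4\<close> for
  the modes \<open>cos (k * x)\<close>, and the mode \<open>k = 1\<close> is unstable for \<open>r < 1\<close>.  Let \<open>\<nu>\<close> be the largest
  growth rate, attained at \<open>k0\<close>.  The strongly unstable manifold is constructed explicitly: the function
  \<open>F(s, x) = r + s * cos (k0 * x) + (\<Sum>n\<ge>2. s ^ n * f n x)\<close> with trigonometric polynomials \<open>f n\<close> is
  such that \<open>F(s * exp (\<nu> * t), x)\<close> solves the equation.  Since \<open>n * \<nu>\<close> exceeds every growth rate for
  \<open>n \<ge> 2\<close>, the \<open>f n\<close> can be determined recursively with a gain of four space derivatives, and the
  series converges by a majorant argument.  Starting from small \<open>s\<close> the orbit reaches a fixed distance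
  from the cylinder.

  The regularity class of the problem admits a uniqueness proof by an \<open>L\<^sup>2\<close> energy estimate for the
  difference of two solutions: although the third and fourth derivatives may blow up as \<open>t\<close> tends to
  \<open>0\<close>, the resulting factor \<open>t powr (-3/4)\<close> is integrable.  By uniqueness all solutions with the same
  initial value fit together to a maximal one, which extends the explicit orbit.
\<close>

section \<open>Hoelder spaces on the torus\<close>

text \<open>A local existence theory for arbitrary initial values is avoided: only the values met by
  the explicit orbits need a solution, and the orbit itself is one. The largest growth rate is taken
  because it excludes resonance: for n \<ge> 2 the number n * \<nu> exceeds the rate of every mode
  by at least \<nu>, so no small divisors occur, and the gap grows like k^4, which pays for the four
  derivatives lost in the nonlinear terms. The exponential weight on the coefficients makes the
  orbits analytic in x, so one estimate serves all Hoelder exponents. Uniqueness is needed beyond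
  the gluing: the claim concerns the maximal solution, and only uniqueness transfers the escape of
  the orbit to it. The restriction \<mu> \<ge> 1/2 enters there, both through the second
  derivatives, which stay bounded at time 0, and through the rate of the fourth. The distance
  \<epsilon> does not depend on n because all orbits run along one curve parametrised by the
  amplitude s: wherever they start, they pass through the same function at s = \<sigma> / 2.\<close>

lemma torus_fun_shift_int:
  assumes "torus_fun f"
  shows "f (x + 2 * pi * of_int n) = f x"
proof -
  have nat: "f (y + 2 * pi * of_nat k) = f y" for k y
  proof (induction k)
    case (Suc k)
    have "f (y + 2 * pi * of_nat (Suc k)) = f ((y + 2 * pi * of_nat k) + 2 * pi)"
      by (simp add: algebra_simps)
    also have "\<dots> = f (y + 2 * pi * of_nat k)" using assms unfolding torus_fun_def by blast
    finally show ?case using Suc by simp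
  qed simp
  show ?thesis
  proof (cases "n \<ge> 0")
    case True then show ?thesis using nat[of x "nat n"] by simp
  next
    case False
    then show ?thesis using nat[of "x + 2 * pi * of_int n" "nat (-n)"] by (simp add: algebra_simps)
  qed
qed

lemma torus_representative:
  obtains y :: real and n :: int where "y \<in> torus" "x = y + 2 * pi * of_int n"
proof -
  define n where "n = \<lfloor>(x + pi) / (2 * pi)\<rfloor>"
  have "of_int n \<le> (x + pi) / (2 * pi)" "(x + pi) / (2 * pi) < of_int n + 1"
    unfolding n_def by linarith+
  hence "of_int n * (2 * pi) \<le> x + pi" "x + pi < (of_int n + 1) * (2 * pi)"
    by (simp_all add: field_simps)
  hence "x - 2 * pi * of_int n \<in> torus" by (simp add: torus_def algebra_simps)
  thus ?thesis by (intro that[of "x - 2 * pi * of_int n" n]) auto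
qed

lemma torus_fun_representative:
  assumes "torus_fun f"
  obtains y where "y \<in> torus" "f x = f y"
  using torus_representative[of x] torus_fun_shift_int[OF assms] by metis

text \<open>No differentiability is assumed: the derivative predicates at \<open>x\<close> and
  \<open>x + 2 * pi\<close> are equivalent, so the choice behind \<open>deriv\<close> returns the
  same number even where no derivative exists.\<close>

lemma torus_fun_deriv: "torus_fun (deriv f)" if "torus_fun f"
proof -
  have *: "(f has_real_derivative D) (at (x + 2 * pi)) \<longleftrightarrow> (f has_real_derivative D) (at x)" for D x
  proof -
    have "(f has_real_derivative D) (at (x + 2 * pi)) \<longleftrightarrow>
        ((\<lambda>y. f (y + 2 * pi)) has_real_derivative D) (at x)"
      by (rule DERIV_shift)
    also have "(\<lambda>y. f (y + 2 * pi)) = f" using that unfolding torus_fun_def by auto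
    finally show ?thesis .
  qed
  show ?thesis unfolding torus_fun_def deriv_def using * by simp
qed

lemma torus_fun_funpow_deriv: "torus_fun f \<Longrightarrow> torus_fun ((deriv ^^ j) f)"
  by (induction j) (auto simp: torus_fun_deriv)

lemma holder_space_torus_fun: "f \<in> holder_space k \<beta> \<Longrightarrow> torus_fun ((deriv ^^ j) f)"
  by (rule torus_fun_funpow_deriv) (simp add: holder_space_def)

lemma holder_space_has_deriv:
  assumes "f \<in> holder_space k \<beta>" "j < k"
  shows "((deriv ^^ j) f has_real_derivative (deriv ^^ Suc j) f x) (at x)"
proof -
  have "(deriv ^^ j) f differentiable at x" using assms by (simp add: holder_space_def)
  thus ?thesis by (simp add: DERIV_deriv_iff_real_differentiable)
qed

lemma holder_space_continuous:
  assumes "f \<in> holder_space k \<beta>" "j \<le> k"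
  shows "continuous_on S ((deriv ^^ j) f)"
proof (cases "j = k")
  case True
  have "continuous_on UNIV ((deriv ^^ j) f)" using assms True by (simp add: holder_space_def)
  then show ?thesis by (rule continuous_on_subset) auto
next
  case False
  hence "j < k" using assms by auto
  thus ?thesis
    by (intro continuous_at_imp_continuous_on ballI DERIV_isCont[OF holder_space_has_deriv[OF assms(1)]])
qed

lemma holder_quotients_nonneg: "q \<in> holder_quotients \<beta> D g \<Longrightarrow> 0 \<le> q"
  by (auto simp: holder_quotients_def)

text \<open>\<open>Sup\<close> of an empty set of reals is unspecified, so bounds on seminorms need
  a witness. The points 0 and \<open>e\<close> have torus distance exactly \<open>e\<close> because
  \<open>e \<le> 1 < pi\<close>.\<close>

lemma holder_quotients_nonempty:
  assumes "\<delta> > 0"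
  obtains q where "q \<in> holder_quotients \<beta> {0<..<\<delta>} g"
proof -
  define e where "e = min (\<delta> / 2) 1"
  have e: "0 < e" "e < \<delta>" "e \<le> 1" using assms by (auto simp: e_def)
  have "torus_dist 0 e = e" using e pi_gt3 by (simp add: torus_dist_def)
  moreover have "0 \<in> torus" "e \<in> torus" using e pi_gt3 by (auto simp: torus_def)
  ultimately have "\<bar>g 0 - g e\<bar> / torus_dist 0 e powr \<beta> \<in> holder_quotients \<beta> {0<..<\<delta>} g"
    using e unfolding holder_quotients_def by force
  thus ?thesis by (rule that)
qed

lemma holder_quotients_mono: "D \<subseteq> D' \<Longrightarrow> holder_quotients \<beta> D g \<subseteq> holder_quotients \<beta> D' g"
  unfolding holder_quotients_def by blast

lemma Sup_holder_quotients_nonneg: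
  assumes "bdd_above (holder_quotients \<beta> {0<..} g)"
  shows "0 \<le> Sup (holder_quotients \<beta> {0<..} g)"
proof -
  obtain q where "q \<in> holder_quotients \<beta> {0<..<1} g" using holder_quotients_nonempty[of 1] by auto
  hence q: "q \<in> holder_quotients \<beta> {0<..} g"
    using holder_quotients_mono[of "{0<..<1}" "{0<..}"] by fastforce
  show ?thesis by (rule cSup_upper2[OF q _ assms]) (rule holder_quotients_nonneg[OF q])
qed

lemma holder_space_bdd_above:
  assumes "f \<in> holder_space k \<beta>" "j \<le> k"
  shows "bdd_above ((\<lambda>x. \<bar>(deriv ^^ j) f x\<bar>) ` torus)"
proof -
  have "compact ((\<lambda>x. \<bar>(deriv ^^ j) f x\<bar>) ` torus)"
    unfolding torus_def
    by (intro compact_continuous_image continuous_intros holder_space_continuous[OF assms]) auto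
  thus ?thesis by (intro bounded_imp_bdd_above compact_imp_bounded)
qed

text \<open>The norm looks only at \<open>torus\<close>; periodicity extends the bound to the line.
  Later lower bounds for \<open>lh_norm\<close>, its nonnegativity included, come from here.\<close>

lemma abs_deriv_le_holder_norm:
  assumes f: "f \<in> holder_space k \<beta>" and j: "j \<le> k"
  shows "\<bar>(deriv ^^ j) f x\<bar> \<le> holder_norm k \<beta> f"
proof -
  obtain y where y: "y \<in> torus" "(deriv ^^ j) f x = (deriv ^^ j) f y"
    using torus_fun_representative[OF holder_space_torus_fun[OF f]] by metis
  have nonneg: "0 \<le> (SUP x\<in>torus. \<bar>(deriv ^^ i) f x\<bar>)" if "i \<le> k" for i
    using cSUP_upper[OF y(1) holder_space_bdd_above[OF f that]] by (meson abs_ge_zero order_trans)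
  have "\<bar>(deriv ^^ j) f y\<bar> \<le> (SUP x\<in>torus. \<bar>(deriv ^^ j) f x\<bar>)"
    by (rule cSUP_upper[OF y(1) holder_space_bdd_above[OF f j]])
  also have "\<dots> \<le> (\<Sum>j\<le>k. SUP x\<in>torus. \<bar>(deriv ^^ j) f x\<bar>)"
    by (rule member_le_sum) (use j nonneg in auto)
  also have "\<dots> \<le> holder_norm k \<beta> f"
    unfolding holder_norm_def using Sup_holder_quotients_nonneg f by (auto simp: holder_space_def)
  finally show ?thesis using y(2) by simp
qed

section \<open>Linear combinations in Hoelder spaces\<close>

lemma funpow_deriv_lincomb:
  fixes f g :: "real \<Rightarrow> real"
  assumes "\<forall>j<k. \<forall>x. (deriv ^^ j) f differentiable at x" "\<forall>j<k. \<forall>x. (deriv ^^ j) g differentiable at x"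
    and "j \<le> k"
  shows "(deriv ^^ j) (\<lambda>x. a * f x + b * g x) = (\<lambda>x. a * (deriv ^^ j) f x + b * (deriv ^^ j) g x)"
  using assms(3)
proof (induction j)
  case (Suc j)
  show ?case
  proof
    fix x
    have "((deriv ^^ j) f has_real_derivative (deriv ^^ Suc j) f x) (at x)"
      "((deriv ^^ j) g has_real_derivative (deriv ^^ Suc j) g x) (at x)"
      using assms(1,2) Suc.prems by (simp_all add: DERIV_deriv_iff_real_differentiable)
    hence "((\<lambda>x. a * (deriv ^^ j) f x + b * (deriv ^^ j) g x) has_real_derivative
        a * (deriv ^^ Suc j) f x + b * (deriv ^^ Suc j) g x) (at x)"
      by (auto intro!: derivative_eq_intros)
    thus "(deriv ^^ Suc j) (\<lambda>x. a * f x + b * g x) x = a * (deriv ^^ Suc j) f x + b * (deriv ^^ Suc j) g x"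
      using Suc by (simp add: DERIV_imp_deriv)
  qed
qed auto

lemma holder_space_lincomb:
  assumes f: "f \<in> holder_space k \<beta>" and g: "g \<in> holder_space k \<beta>"
  shows "(\<lambda>x. a * f x + b * g x) \<in> holder_space k \<beta>"
    and "j \<le> k \<Longrightarrow> (deriv ^^ j) (\<lambda>x. a * f x + b * g x) =
           (\<lambda>x. a * (deriv ^^ j) f x + b * (deriv ^^ j) g x)"
proof -
  have d: "(deriv ^^ j) (\<lambda>x. a * f x + b * g x) = (\<lambda>x. a * (deriv ^^ j) f x + b * (deriv ^^ j) g x)"
    if "j \<le> k" for j
    by (rule funpow_deriv_lincomb[OF _ _ that]) (use f g in \<open>auto simp: holder_space_def\<close>)
  then show "j \<le> k \<Longrightarrow> (deriv ^^ j) (\<lambda>x. a * f x + b * g x) =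
           (\<lambda>x. a * (deriv ^^ j) f x + b * (deriv ^^ j) g x)" .
  have "bdd_above (holder_quotients \<beta> {0<..} (\<lambda>x. a * (deriv ^^ k) f x + b * (deriv ^^ k) g x))"
  proof -
    obtain A where A: "\<And>q. q \<in> holder_quotients \<beta> {0<..} ((deriv ^^ k) f) \<Longrightarrow> q \<le> A"
      using f unfolding holder_space_def bdd_above_def by blast
    obtain B where B: "\<And>q. q \<in> holder_quotients \<beta> {0<..} ((deriv ^^ k) g) \<Longrightarrow> q \<le> B"
      using g unfolding holder_space_def bdd_above_def by blast
    show ?thesis
    proof (rule bdd_aboveI[of _ "\<bar>a\<bar> * A + \<bar>b\<bar> * B"])
      fix q assume "q \<in> holder_quotients \<beta> {0<..} (\<lambda>x. a * (deriv ^^ k) f x + b * (deriv ^^ k) g x)"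
      then obtain x y where xy: "x \<in> torus" "y \<in> torus" "torus_dist x y > 0"
        and q: "q = \<bar>(a * (deriv ^^ k) f x + b * (deriv ^^ k) g x) -
              (a * (deriv ^^ k) f y + b * (deriv ^^ k) g y)\<bar> / torus_dist x y powr \<beta>"
        unfolding holder_quotients_def by auto
      have 1: "\<bar>(deriv ^^ k) f x - (deriv ^^ k) f y\<bar> / torus_dist x y powr \<beta> \<le> A"
        by (rule A) (use xy in \<open>auto simp: holder_quotients_def\<close>)
      have 2: "\<bar>(deriv ^^ k) g x - (deriv ^^ k) g y\<bar> / torus_dist x y powr \<beta> \<le> B"
        by (rule B) (use xy in \<open>auto simp: holder_quotients_def\<close>)
      have "\<bar>(a * (deriv ^^ k) f x + b * (deriv ^^ k) g x) - (a * (deriv ^^ k) f y + b * (deriv ^^ k) g y)\<bar>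
          = \<bar>a * ((deriv ^^ k) f x - (deriv ^^ k) f y) + b * ((deriv ^^ k) g x - (deriv ^^ k) g y)\<bar>"
        by (simp add: algebra_simps)
      also have "\<dots> \<le> \<bar>a\<bar> * \<bar>(deriv ^^ k) f x - (deriv ^^ k) f y\<bar> + \<bar>b\<bar> * \<bar>(deriv ^^ k) g x - (deriv ^^ k) g y\<bar>"
        by (metis abs_mult abs_triangle_ineq)
      finally have "q \<le> (\<bar>a\<bar> * \<bar>(deriv ^^ k) f x - (deriv ^^ k) f y\<bar> + \<bar>b\<bar> * \<bar>(deriv ^^ k) g x - (deriv ^^ k) g y\<bar>)
          / torus_dist x y powr \<beta>"
        unfolding q by (rule divide_right_mono) simp
      also have "\<dots> = \<bar>a\<bar> * (\<bar>(deriv ^^ k) f x - (deriv ^^ k) f y\<bar> / torus_dist x y powr \<beta>)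
          + \<bar>b\<bar> * (\<bar>(deriv ^^ k) g x - (deriv ^^ k) g y\<bar> / torus_dist x y powr \<beta>)"
        by (simp add: add_divide_distrib)
      also have "\<dots> \<le> \<bar>a\<bar> * A + \<bar>b\<bar> * B"
        by (intro add_mono mult_left_mono 1 2) auto
      finally show "q \<le> \<bar>a\<bar> * A + \<bar>b\<bar> * B" .
    qed
  qed
  moreover have "(deriv ^^ j) (\<lambda>x. a * f x + b * g x) differentiable at x" if "j < k" for j x
    using f g that unfolding d[OF less_imp_le[OF that]]
    by (intro derivative_intros) (auto simp: holder_space_def)
  moreover have "continuous_on UNIV (\<lambda>x. a * (deriv ^^ k) f x + b * (deriv ^^ k) g x)"
    using f g by (intro continuous_intros) (auto simp: holder_space_def)
  moreover have "torus_fun (\<lambda>x. a * f x + b * g x)"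
    using f g by (auto simp: holder_space_def torus_fun_def)
  ultimately show "(\<lambda>x. a * f x + b * g x) \<in> holder_space k \<beta>"
    unfolding holder_space_def using d[of k] by auto
qed

lemma holder_space_diff:
  assumes f: "f \<in> holder_space k \<beta>" and g: "g \<in> holder_space k \<beta>"
  shows "(\<lambda>x. f x - g x) \<in> holder_space k \<beta>"
    and "j \<le> k \<Longrightarrow> (deriv ^^ j) (\<lambda>x. f x - g x) = (\<lambda>x. (deriv ^^ j) f x - (deriv ^^ j) g x)"
  using holder_space_lincomb(1)[OF assms, of 1 "-1"] holder_space_lincomb(2)[OF assms, of j 1 "-1"]
  by auto

section \<open>Smooth periodic functions in the little Hoelder spaces\<close>

lemma little_holder_subset: "little_holder_space k \<beta> \<subseteq> holder_space k \<beta>"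
  by (auto simp: little_holder_space_def)

lemma lh_holder_space: "f \<in> lh s \<Longrightarrow> f \<in> holder_space (nat \<lfloor>s\<rfloor>) (frac s)"
  unfolding lh_def using little_holder_subset by blast

text \<open>For the direct distance this is the mean value theorem. Across the seam the smaller
  point is first moved by one period, which leaves it at distance
  \<open>2 * pi - \<bar>x - y\<bar>\<close> from the other on the line.\<close>

lemma torus_dist_lipschitz:
  assumes g: "\<And>x. (g has_real_derivative g' x) (at x)" and g': "\<And>x. \<bar>g' x\<bar> \<le> B"
    and per: "torus_fun g" and x: "x \<in> torus" and y: "y \<in> torus"
  shows "\<bar>g x - g y\<bar> \<le> B * torus_dist x y"
proof -
  have lip: "\<bar>g x - g y\<bar> \<le> B * \<bar>x - y\<bar>" for x y
    using field_differentiable_bound[of UNIV g g' B x y] g g' by (auto simp: DERIV_subset)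
  have B: "B \<ge> 0" using g'[of 0] by linarith
  have *: "\<bar>g x - g y\<bar> \<le> B * (2 * pi - \<bar>x - y\<bar>)"
  proof (cases "x \<le> y")
    case True
    have "g x = g (x + 2 * pi)" using per by (simp add: torus_fun_def)
    hence "\<bar>g x - g y\<bar> \<le> B * \<bar>x + 2 * pi - y\<bar>" using lip by metis
    also have "\<bar>x + 2 * pi - y\<bar> = 2 * pi - \<bar>x - y\<bar>" using True x y by (auto simp: torus_def)
    finally show ?thesis .
  next
    case False
    have "g y = g (y + 2 * pi)" using per by (simp add: torus_fun_def)
    hence "\<bar>g x - g y\<bar> \<le> B * \<bar>x - (y + 2 * pi)\<bar>" using lip by metis
    also have "\<bar>x - (y + 2 * pi)\<bar> = 2 * pi - \<bar>x - y\<bar>" using False x y by (auto simp: torus_def)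
    finally show ?thesis .
  qed
  show ?thesis unfolding torus_dist_def min_def using * lip by auto
qed

lemma torus_dist_le_pi: "torus_dist x y \<le> pi"
  unfolding torus_dist_def min_def by auto

text \<open>A derivative beyond order \<open>k\<close> controls the Hoelder quotients, since \<open>\<beta> < 1\<close>.\<close>

lemma smooth_in_little_holder:
  fixes F :: "nat \<Rightarrow> real \<Rightarrow> real"
  assumes d: "\<And>j x. j \<le> k \<Longrightarrow> (F j has_real_derivative F (Suc j) x) (at x)"
    and B: "\<And>j x. j \<le> Suc k \<Longrightarrow> \<bar>F j x\<bar> \<le> B"
    and per: "torus_fun (F 0)" and \<beta>: "0 < \<beta>" "\<beta> < 1"
  shows "F 0 \<in> little_holder_space k \<beta>" and "holder_norm k \<beta> (F 0) \<le> (real k + 5) * B"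
proof -
  have eq: "(deriv ^^ j) (F 0) = F j" if "j \<le> Suc k" for j
    using that
  proof (induction j)
    case (Suc j)
    then show ?case using d[of j] by (auto simp: DERIV_imp_deriv)
  qed auto
  have B0: "B \<ge> 0" using B[of 0 0] by simp
  have perk: "torus_fun (F k)" using torus_fun_funpow_deriv[OF per, of k] eq by auto
  \<comment> \<open>Stated for an arbitrary set of distances so that it yields both the full
    seminorm (with \<open>\<delta>\<close> equal to \<open>pi\<close>) and the little Hoelder
    limit.\<close>
  have quot: "q \<le> B * \<delta> powr (1 - \<beta>)" if q: "q \<in> holder_quotients \<beta> D (F k)"
    and D: "D \<subseteq> {0<..}" "\<And>d. d \<in> D \<Longrightarrow> d \<le> pi \<Longrightarrow> d \<le> \<delta>" for q D \<delta>
  proof -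
    obtain x y where xy: "x \<in> torus" "y \<in> torus" "torus_dist x y \<in> D"
      "q = \<bar>F k x - F k y\<bar> / torus_dist x y powr \<beta>" using q unfolding holder_quotients_def by auto
    have t: "torus_dist x y > 0" "torus_dist x y \<le> \<delta>" using xy D torus_dist_le_pi by auto
    have "\<bar>F k x - F k y\<bar> \<le> B * torus_dist x y"
      by (rule torus_dist_lipschitz[where g' = "F (Suc k)"]) (use d B perk xy in auto)
    hence "q \<le> B * torus_dist x y / torus_dist x y powr \<beta>"
      unfolding xy(4) by (rule divide_right_mono) simp
    also have "\<dots> = B * torus_dist x y powr (1 - \<beta>)"
      using t by (simp add: powr_diff)
    also have "\<dots> \<le> B * \<delta> powr (1 - \<beta>)"
      using t \<beta> B0 by (intro mult_left_mono powr_mono2) auto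
    finally show ?thesis .
  qed
  \<comment> \<open>A crude bound for the seminorm; added to the \<open>k + 1\<close> supremum norms
    it produces the constant \<open>k + 5\<close>.\<close>
  have pi4: "pi powr (1 - \<beta>) \<le> 4"
  proof -
    have "pi powr (1 - \<beta>) \<le> pi powr 1" using \<beta> pi_gt3 by (intro powr_mono) auto
    thus ?thesis using pi_less_4 by simp
  qed
  have quot4: "q \<le> 4 * B" if "q \<in> holder_quotients \<beta> {0<..} (F k)" for q
  proof -
    have "q \<le> B * pi powr (1 - \<beta>)" by (rule quot[OF that]) auto
    also have "\<dots> \<le> B * 4" using pi4 B0 by (rule mult_left_mono)
    finally show ?thesis by simp
  qed
  have bdd: "bdd_above (holder_quotients \<beta> {0<..} (F k))"
    by (rule bdd_aboveI) (rule quot4)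
  have hs: "F 0 \<in> holder_space k \<beta>"
    unfolding holder_space_def mem_Collect_eq
  proof (intro conjI allI impI)
    fix j x assume "j < k"
    thus "(deriv ^^ j) (F 0) differentiable at x"
      using d[of j x] eq[of j] real_differentiable_def by force
  next
    have "continuous_on UNIV (F k)"
      by (intro continuous_at_imp_continuous_on ballI DERIV_isCont[OF d]) auto
    thus "continuous_on UNIV ((deriv ^^ k) (F 0))" using eq by simp
  qed (use per bdd eq in auto)
  have lim: "((\<lambda>\<delta>. Sup (holder_quotients \<beta> {0<..<\<delta>} (F k))) \<longlongrightarrow> 0) (at_right 0)"
  proof (rule tendsto_sandwich)
    have nn: "0 \<le> Sup (holder_quotients \<beta> {0<..<\<delta>} (F k))" and
      le: "Sup (holder_quotients \<beta> {0<..<\<delta>} (F k)) \<le> B * \<delta> powr (1 - \<beta>)" if "\<delta> > 0" for \<delta>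
    proof -
      obtain q where q: "q \<in> holder_quotients \<beta> {0<..<\<delta>} (F k)" using holder_quotients_nonempty[OF \<open>\<delta> > 0\<close>] .
      have u: "q' \<le> B * \<delta> powr (1 - \<beta>)" if "q' \<in> holder_quotients \<beta> {0<..<\<delta>} (F k)" for q'
        by (rule quot[OF that]) auto
      show "Sup (holder_quotients \<beta> {0<..<\<delta>} (F k)) \<le> B * \<delta> powr (1 - \<beta>)"
        using q by (intro cSup_least u) auto
      show "0 \<le> Sup (holder_quotients \<beta> {0<..<\<delta>} (F k))"
        by (rule cSup_upper2[OF q holder_quotients_nonneg[OF q]]) (rule bdd_aboveI, rule u)
    qed
    show "\<forall>\<^sub>F \<delta> in at_right 0. 0 \<le> Sup (holder_quotients \<beta> {0<..<\<delta>} (F k))"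
      using nn by (auto simp: eventually_at_right_field intro!: exI[of _ 1])
    show "\<forall>\<^sub>F \<delta> in at_right 0. Sup (holder_quotients \<beta> {0<..<\<delta>} (F k)) \<le> B * \<delta> powr (1 - \<beta>)"
      using le by (auto simp: eventually_at_right_field intro!: exI[of _ 1])
    have "((\<lambda>\<delta>. \<delta> powr (1 - \<beta>)) \<longlongrightarrow> 0 powr (1 - \<beta>)) (at_right (0::real))"
      using \<beta> by (intro tendsto_powr2) (auto intro!: tendsto_eq_intros simp: eventually_at_right_field intro: exI[of _ 1])
    thus "((\<lambda>\<delta>. B * \<delta> powr (1 - \<beta>)) \<longlongrightarrow> 0) (at_right 0)"
      by (intro tendsto_mult_right_zero) simp
  qed auto
  show "F 0 \<in> little_holder_space k \<beta>"
    unfolding little_holder_space_def using hs lim eq[of k] by simp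
  have "(SUP x\<in>torus. \<bar>(deriv ^^ j) (F 0) x\<bar>) \<le> B" if "j \<le> k" for j
    using eq[of j] that B[of j] by (intro cSUP_least) (auto simp: torus_def)
  hence "(\<Sum>j\<le>k. SUP x\<in>torus. \<bar>(deriv ^^ j) (F 0) x\<bar>) \<le> (\<Sum>j\<le>k. B)"
    by (intro sum_mono) auto
  moreover have "Sup (holder_quotients \<beta> {0<..} (F k)) \<le> 4 * B"
  proof (rule cSup_least)
    obtain q where "q \<in> holder_quotients \<beta> {0<..<1} (F k)" using holder_quotients_nonempty[of 1] by auto
    thus "holder_quotients \<beta> {0<..} (F k) \<noteq> {}"
      using holder_quotients_mono[of "{0<..<1}" "{0<..}"] by fastforce
  qed (rule quot4)
  ultimately show "holder_norm k \<beta> (F 0) \<le> (real k + 5) * B"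
    unfolding holder_norm_def using eq[of k] by (simp add: algebra_simps)
qed

text \<open>The norm controls the \<open>j\<close>-th derivative uniformly in \<open>x\<close>;
  together with continuity in \<open>x\<close> at the fixed time \<open>t\<close> this gives joint
  continuity, which makes compactness in time and space available.\<close>

lemma continuous_lh_imp_continuous_on:
  assumes u: "continuous_lh s S u" and j: "j \<le> nat \<lfloor>s\<rfloor>"
  shows "continuous_on (S \<times> UNIV) (\<lambda>(t, x). (deriv ^^ j) (u t) x)"
  unfolding continuous_on_def
proof (intro ballI)
  fix p assume p: "p \<in> S \<times> (UNIV :: real set)"
  obtain t x where [simp]: "p = (t, x)" by (cases p)
  have t: "t \<in> S" using p by simp
  have hs: "u t \<in> holder_space (nat \<lfloor>s\<rfloor>) (frac s)" if "t \<in> S" for t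
    using u that lh_holder_space unfolding continuous_lh_def by blast
  let ?D = "\<lambda>t. (deriv ^^ j) (u t)"
  have bound: "\<bar>?D t' y - ?D t y\<bar> \<le> lh_norm s (\<lambda>x. u t' x - u t x)" if "t' \<in> S" for t' y
    using abs_deriv_le_holder_norm[OF holder_space_diff(1)[OF hs[OF that] hs[OF t]] j, of y]
      holder_space_diff(2)[OF hs[OF that] hs[OF t] j] unfolding lh_norm_def by simp
  have lim1: "((\<lambda>\<tau>. lh_norm s (\<lambda>x. u \<tau> x - u t x)) \<longlongrightarrow> 0) (at t within S)"
    using u t unfolding continuous_lh_def by blast
  have z: "lh_norm s (\<lambda>x. u t x - u t x) = 0"
    unfolding lh_norm_def holder_norm_def
  \<comment> \<open>Pairs near \<open>(t, x)\<close> may have first component exactly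
    \<open>t\<close>, so the limit is needed on an unpunctured neighbourhood; for this the norm of
    the zero function has to be 0.\<close>
  proof -
    have zero: "(deriv ^^ i) (\<lambda>x::real. 0::real) = (\<lambda>x. 0)" for i
      by (induction i) auto
    obtain q where "q \<in> holder_quotients (frac s) {0<..<1} (\<lambda>x. 0)"
      using holder_quotients_nonempty[of 1] by auto
    hence "holder_quotients (frac s) {0<..} (\<lambda>x. 0) = {0}"
      by (auto simp: holder_quotients_def)
    moreover have "torus \<noteq> {}" by (auto simp: torus_def)
    ultimately show "(\<Sum>j\<le>nat \<lfloor>s\<rfloor>. SUP x\<in>torus. \<bar>(deriv ^^ j) (\<lambda>x. u t x - u t x) x\<bar>) +
      Sup (holder_quotients (frac s) {0<..} ((deriv ^^ nat \<lfloor>s\<rfloor>) (\<lambda>x. u t x - u t x))) = 0"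
      by (simp add: zero)
  qed
  have lim2: "((\<lambda>\<tau>. lh_norm s (\<lambda>x. u \<tau> x - u t x)) \<longlongrightarrow> 0) (inf (nhds t) (principal S))"
  proof (rule topological_tendstoI)
    fix U :: "real set" assume U: "open U" "0 \<in> U"
    from topological_tendstoD[OF lim1 this]
    show "\<forall>\<^sub>F \<tau> in inf (nhds t) (principal S). lh_norm s (\<lambda>x. u \<tau> x - u t x) \<in> U"
      unfolding eventually_at_filter eventually_inf_principal
      by (rule eventually_mono) (use z U in auto)
  qed
  have "((\<lambda>q. lh_norm s (\<lambda>x. u (fst q) x - u t x)) \<longlongrightarrow> 0) (at p within S \<times> UNIV)"
  proof (rule filterlim_compose[OF lim2])
    show "filterlim fst (inf (nhds t) (principal S)) (at p within S \<times> UNIV)"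
      unfolding filterlim_inf filterlim_principal
      by (auto intro!: tendsto_eq_intros simp: eventually_at_filter intro: always_eventually)
  qed
  moreover have "((\<lambda>q. \<bar>?D t (snd q) - ?D t x\<bar>) \<longlongrightarrow> 0) (at p within S \<times> UNIV)"
  proof -
    have "continuous_on UNIV (?D t)" by (rule holder_space_continuous[OF hs[OF t] j])
    hence "isCont (?D t) x" by (simp add: continuous_on_eq_continuous_at)
    hence "((\<lambda>q. ?D t (snd q)) \<longlongrightarrow> ?D t x) (at p within S \<times> UNIV)"
      by (rule isCont_tendsto_compose) (auto intro!: tendsto_eq_intros)
    thus ?thesis by (intro tendsto_rabs_zero) (simp add: LIM_zero_iff)
  qed
  ultimately have lim: "((\<lambda>q. lh_norm s (\<lambda>x. u (fst q) x - u t x) + \<bar>?D t (snd q) - ?D t x\<bar>) \<longlongrightarrow> 0)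
      (at p within S \<times> UNIV)"
    using tendsto_add by fastforce
  have "((\<lambda>q. ?D (fst q) (snd q) - ?D t x) \<longlongrightarrow> 0) (at p within S \<times> UNIV)"
  proof (rule Lim_null_comparison[OF _ lim])
    show "\<forall>\<^sub>F q in at p within S \<times> UNIV. norm (?D (fst q) (snd q) - ?D t x)
        \<le> lh_norm s (\<lambda>x. u (fst q) x - u t x) + \<bar>?D t (snd q) - ?D t x\<bar>"
      unfolding eventually_at_filter
    proof (rule always_eventually, intro allI impI)
      fix q assume "q \<in> S \<times> (UNIV :: real set)"
      hence "fst q \<in> S" by auto
      from bound[OF this, of "snd q"]
      show "norm (?D (fst q) (snd q) - ?D t x) \<le> lh_norm s (\<lambda>x. u (fst q) x - u t x) + \<bar>?D t (snd q) - ?D t x\<bar>"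
        by auto
    qed
  qed
  thus "((\<lambda>(t, x). ?D t x) \<longlongrightarrow> (case p of (t, x) \<Rightarrow> ?D t x)) (at p within S \<times> UNIV)"
    by (simp add: LIM_zero_iff case_prod_unfold)
qed

section \<open>The surface diffusion operator as a quasilinear operator\<close>

text \<open>The three coefficients result from carrying out the outer differentiation in
  \<open>asd_rhs\<close>. In the leading term the factor \<open>r\<close> of the flux cancels
  \<open>1 / r\<close>, so \<open>asd_a\<close> depends on the slope only.\<close>

definition asd_a :: "real \<Rightarrow> real" where
  "asd_a p = 1 / (1 + p\<^sup>2)^2"

definition asd_b :: "real \<Rightarrow> real \<Rightarrow> real \<Rightarrow> real" where
  "asd_b r p q = 10 * p * q / (1 + p\<^sup>2)^3 - 2 * p / (r * (1 + p\<^sup>2)^2)"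

definition asd_c :: "real \<Rightarrow> real \<Rightarrow> real \<Rightarrow> real" where
  "asd_c r p q = p\<^sup>2 / (r^3 * (1 + p\<^sup>2)) - q / (r\<^sup>2 * (1 + p\<^sup>2))
     + 2 * p\<^sup>2 * q / (r\<^sup>2 * (1 + p\<^sup>2)^2) - q\<^sup>2 / (r * (1 + p\<^sup>2)^2)
     + 7 * p\<^sup>2 * q\<^sup>2 / (r * (1 + p\<^sup>2)^3)
     + 3 * q^3 / (1 + p\<^sup>2)^3 - 18 * p\<^sup>2 * q^3 / (1 + p\<^sup>2)^4"

text \<open>The left-hand sides of this and the next identity have the exact shape delivered by the
  quotient rule, with \<open>p * q / S\<close> as the derivative of
  \<open>S = sqrt (1 + p\<^sup>2)\<close>.\<close>

lemma inverse_product_deriv_identity: assumes "r \<noteq> 0" "S \<noteq> (0::real)" shows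
 "(0 * (r * S) - 1 * (p * S + r * (p * q / S))) / (r * S)\<^sup>2 = - p / (r\<^sup>2 * S) - p * q / (r * S ^ 3)"
  using assms by (simp add: divide_simps) algebra
lemma quotient_cube_deriv_identity: assumes "S \<noteq> (0::real)" shows
 "(t * S ^ 3 - q * (3 * S\<^sup>2 * (p * q / S))) / (S ^ 3)\<^sup>2 = t / S ^ 3 - 3 * p * q\<^sup>2 / S ^ 5"
  using assms by (simp add: divide_simps) algebra
lemma flux_identity: assumes "r \<noteq> 0" "S \<noteq> (0::real)" shows
 "r / S * (- p / (r\<^sup>2 * S) - p * q / (r * S ^ 3) - (t / S ^ 3 - 3 * p * q\<^sup>2 / S ^ 5)) = - p / (r * S\<^sup>2)
      - p * q / (S\<^sup>2)^2
      - r * t / (S\<^sup>2)^2 + 3 * r * p * q\<^sup>2 / (S\<^sup>2)^3"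
proof -
  \<comment> \<open>With inverses as independent variables, related to the original ones by
    equations such as \<open>r * i = 1\<close>, the claim becomes a polynomial identity. The same
    device recurs below.\<close>
  define i j where ij: "i = inverse r" "j = inverse S"
  have "r * i = 1" using assms by (simp add: ij)
  thus ?thesis unfolding divide_inverse inverse_mult_distrib power_inverse[symmetric] ij[symmetric]
    by algebra
qed
lemma flux_deriv_identity: fixes r Q p q t z ::real assumes "r \<noteq> 0" "Q \<noteq> (0::real)" shows
 "- ((q * (r * Q) - p * (p * Q + r * (2 * p * q))) / (r * Q)\<^sup>2)
   - ((q * q + p * t) * Q^2 - p * q * (2 * Q * (2 * p * q))) / (Q^2)^2
   - ((p * t + r * z) * Q^2 - r * t * (2 * Q * (2 * p * q))) / (Q^2)^2
   + (((3 * p * p + 3 * r * q) * q\<^sup>2 + 3 * r * p * (2 * q * t)) * Q^3 - 3 * r * p * q\<^sup>2 * (3 * Q\<^sup>2 * (2 * p * q))) / (Q^3)^2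
  = r * (- (1 / Q^2) * z + (10 * p * q / Q^3 - 2 * p / (r * Q^2)) * t +
   (p\<^sup>2 / (r^3 * Q) - q / (r\<^sup>2 * Q)
     + 2 * p\<^sup>2 * q / (r\<^sup>2 * Q^2) - q\<^sup>2 / (r * Q^2)
     + 7 * p\<^sup>2 * q\<^sup>2 / (r * Q^3)
     + 3 * q^3 / Q^3 - 18 * p\<^sup>2 * q^3 / Q^4))"
proof -
  define i j where ij: "i = inverse r" "j = inverse Q"
  have "r * i = 1" "Q * j = 1" using assms by (simp_all add: ij)
  thus ?thesis unfolding divide_inverse inverse_mult_distrib power_inverse[symmetric] power_mult_distrib ij[symmetric]
    by algebra
qed
text \<open>The derivative of \<open>mean_curv\<close> contains only odd powers of the square root
  \<open>S\<close>; multiplied by \<open>r / S\<close> only even ones remain, so the flux is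
  rational in \<open>r\<close> and its derivatives. The derivatives enter as separate functions so
  that the lemma also applies to termwise differentiated series.\<close>

lemma asd_rhs_quasilinear:
  assumes d0: "\<And>x. (f has_real_derivative f1 x) (at x)"
    and d1: "\<And>x. (f1 has_real_derivative f2 x) (at x)"
    and d2: "\<And>x. (f2 has_real_derivative f3 x) (at x)"
    and d3: "\<And>x. (f3 has_real_derivative f4 x) (at x)"
    and pos: "\<And>x. 0 < f x"
  shows "asd_rhs f x =
    - asd_a (f1 x) * f4 x + asd_b (f x) (f1 x) (f2 x) * f3 x + asd_c (f x) (f1 x) (f2 x)"
proof -
  have e1: "deriv f = f1" and e2: "deriv f1 = f2"
    by (rule ext, rule DERIV_imp_deriv, rule d0 d1)+
  define S where S_def': "S = (\<lambda>x. sqrt (1 + (f1 x)\<^sup>2))"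
  have S_def: "S x = sqrt (1 + (f1 x)\<^sup>2)" for x by (simp add: S_def')
  have Spos: "S x > 0" for x unfolding S_def by (simp add: add_pos_nonneg)
  have S2: "(S x)\<^sup>2 = 1 + (f1 x)\<^sup>2" for x unfolding S_def by (simp add: add_nonneg_nonneg)
  have dQ0: "((\<lambda>x. 1 + (f1 x)\<^sup>2) has_real_derivative 2 * f1 x * f2 x) (at x)" for x
    by (rule derivative_eq_intros d1 refl | simp)+
  have dS: "(S has_real_derivative f1 x * f2 x / S x) (at x)" for x
  proof -
    have "0 < 1 + (f1 x)\<^sup>2" by (simp add: add_pos_nonneg)
    hence "((\<lambda>x. sqrt (1 + (f1 x)\<^sup>2)) has_real_derivative
        inverse (sqrt (1 + (f1 x)\<^sup>2)) / 2 * (2 * f1 x * f2 x)) (at x)"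
      by (intro DERIV_chain2[where f = sqrt, OF DERIV_real_sqrt dQ0])
    thus ?thesis unfolding S_def' by (simp add: field_simps)
  qed
  have powr: "(1 + (f1 x)\<^sup>2) powr (3/2) = S x ^ 3" for x
  proof -
    have "1 + (f1 x)\<^sup>2 = S x powr 2" using S2[of x] Spos[of x] by (simp add: powr_numeral)
    hence "(1 + (f1 x)\<^sup>2) powr (3/2) = S x powr 3" by (simp add: powr_powr)
    thus ?thesis using Spos[of x] by (simp add: powr_numeral)
  qed
  have H: "mean_curv f = (\<lambda>x. 1 / (f x * S x) - f2 x / S x ^ 3)"
    unfolding mean_curv_def e1 e2 powr by (simp add: S_def)
  define H1 where "H1 x = - f1 x / ((f x)\<^sup>2 * S x) - f1 x * f2 x / (f x * S x ^ 3)
      - (f3 x / S x ^ 3 - 3 * f1 x * (f2 x)\<^sup>2 / S x ^ 5)" for x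
  have dH: "(mean_curv f has_real_derivative H1 x) (at x)" for x
  proof -
    have nz: "f x \<noteq> 0" "S x \<noteq> 0" using pos[of x] Spos[of x] by auto
    have D1: "((\<lambda>x. f x * S x) has_real_derivative f1 x * S x + f x * (f1 x * f2 x / S x)) (at x)"
      by (rule derivative_eq_intros d0 dS refl | simp)+
    have "((\<lambda>x. 1 / (f x * S x)) has_real_derivative
        (0 * (f x * S x) - 1 * (f1 x * S x + f x * (f1 x * f2 x / S x))) / (f x * S x)\<^sup>2) (at x)"
      unfolding power2_eq_square by (rule DERIV_divide[OF DERIV_const D1]) (use nz in simp)
    moreover have D2: "((\<lambda>x. S x ^ 3) has_real_derivative 3 * (S x)\<^sup>2 * (f1 x * f2 x / S x)) (at x)"
      by (rule derivative_eq_intros dS refl | simp)+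
    have "((\<lambda>x. f2 x / S x ^ 3) has_real_derivative
        (f3 x * S x ^ 3 - f2 x * (3 * (S x)\<^sup>2 * (f1 x * f2 x / S x))) / (S x ^ 3)\<^sup>2) (at x)"
      unfolding power2_eq_square[of "S x ^ 3"] by (rule DERIV_divide[OF d2 D2]) (use nz in simp)
    ultimately show ?thesis unfolding H H1_def
        inverse_product_deriv_identity[OF nz] quotient_cube_deriv_identity[OF nz(2)]
      by (rule DERIV_diff)
  qed
  have eH: "deriv (mean_curv f) = H1" by (rule ext, rule DERIV_imp_deriv, rule dH)
  have flux: "f y / sqrt (1 + (f1 y)\<^sup>2) * H1 y = - f1 y / (f y * (1 + (f1 y)\<^sup>2))
      - f1 y * f2 y / (1 + (f1 y)\<^sup>2)^2
      - f y * f3 y / (1 + (f1 y)\<^sup>2)^2 + 3 * f y * f1 y * (f2 y)\<^sup>2 / (1 + (f1 y)\<^sup>2)^3" for y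
  proof -
    have nz: "f y \<noteq> 0" "S y \<noteq> 0" using pos[of y] Spos[of y] by auto
    show ?thesis unfolding S_def[symmetric] H1_def S2[symmetric]       using flux_identity[OF nz] Spos[of y] by simp
  qed
  have f0: "f x \<noteq> 0" using pos[of x] by simp
  define Q where Q_def': "Q = (\<lambda>x. 1 + (f1 x)\<^sup>2)"
  have Q_def: "Q x = 1 + (f1 x)\<^sup>2" for x by (simp add: Q_def')
  have Q: "Q x \<noteq> 0" unfolding Q_def by (smt (verit) zero_le_power2)
  have dQ: "(Q has_real_derivative 2 * f1 x * f2 x) (at x)"
    unfolding Q_def' by (rule dQ0)
  have dQ2: "((\<lambda>x. Q x ^ 2) has_real_derivative 2 * Q x * (2 * f1 x * f2 x)) (at x)"
    and dQ3: "((\<lambda>x. Q x ^ 3) has_real_derivative 3 * (Q x)\<^sup>2 * (2 * f1 x * f2 x)) (at x)"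
    and dfQ: "((\<lambda>x. f x * Q x) has_real_derivative f1 x * Q x + f x * (2 * f1 x * f2 x)) (at x)"
    and df12: "((\<lambda>x. f1 x * f2 x) has_real_derivative f2 x * f2 x + f1 x * f3 x) (at x)"
    and df03: "((\<lambda>x. f x * f3 x) has_real_derivative f1 x * f3 x + f x * f4 x) (at x)"
    and df4: "((\<lambda>x. 3 * f x * f1 x * (f2 x)\<^sup>2) has_real_derivative
      (3 * f1 x * f1 x + 3 * f x * f2 x) * (f2 x)\<^sup>2 + 3 * f x * f1 x * (2 * f2 x * f3 x)) (at x)"
    by (rule derivative_eq_intros dQ d0 d1 d2 d3 refl | simp)+
  have "((\<lambda>y. - (f1 y / (f y * Q y)) - f1 y * f2 y / Q y ^ 2 - f y * f3 y / Q y ^ 2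
        + 3 * f y * f1 y * (f2 y)\<^sup>2 / Q y ^ 3)
     has_real_derivative
      - ((f2 x * (f x * Q x) - f1 x * (f1 x * Q x + f x * (2 * f1 x * f2 x))) / (f x * Q x)\<^sup>2)
   - ((f2 x * f2 x + f1 x * f3 x) * Q x ^ 2 - f1 x * f2 x * (2 * Q x * (2 * f1 x * f2 x))) / (Q x ^ 2)^2
   - ((f1 x * f3 x + f x * f4 x) * Q x ^ 2 - f x * f3 x * (2 * Q x * (2 * f1 x * f2 x))) / (Q x ^ 2)^2
   + (((3 * f1 x * f1 x + 3 * f x * f2 x) * (f2 x)\<^sup>2 + 3 * f x * f1 x * (2 * f2 x * f3 x)) * Q x ^ 3
       - 3 * f x * f1 x * (f2 x)\<^sup>2 * (3 * (Q x)\<^sup>2 * (2 * f1 x * f2 x))) / (Q x ^ 3)^2) (at x)"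
    unfolding power2_eq_square[of "f x * Q x"] power2_eq_square[of "Q x ^ 2"] power2_eq_square[of "Q x ^ 3"]
    by (intro DERIV_add DERIV_diff DERIV_minus DERIV_divide d1 df12 df03 df4 dfQ dQ2 dQ3)
       (use Q f0 in simp_all)
  hence dflux: "((\<lambda>y. - f1 y / (f y * (1 + (f1 y)\<^sup>2))
      - f1 y * f2 y / (1 + (f1 y)\<^sup>2)^2
      - f y * f3 y / (1 + (f1 y)\<^sup>2)^2 + 3 * f y * f1 y * (f2 y)\<^sup>2 / (1 + (f1 y)\<^sup>2)^3)
     has_real_derivative f x * (- asd_a (f1 x) * f4 x + asd_b (f x) (f1 x) (f2 x) * f3 x
        + asd_c (f x) (f1 x) (f2 x))) (at x)"
    unfolding asd_a_def asd_b_def asd_c_def flux_deriv_identity[OF f0 Q] unfolding Q_def by simp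
  have "asd_rhs f x = 1 / f x * (f x * (- asd_a (f1 x) * f4 x + asd_b (f x) (f1 x) (f2 x) * f3 x
        + asd_c (f x) (f1 x) (f2 x)))"
    unfolding asd_rhs_def e1 eH flux using DERIV_imp_deriv[OF dflux] by simp
  thus ?thesis using f0 by simp
qed

section \<open>The energy inequality\<close>

lemma periodic_integral_by_parts:
  fixes f g :: "real \<Rightarrow> real"
  assumes "\<And>x. (f has_real_derivative f' x) (at x)" "\<And>x. (g has_real_derivative g' x) (at x)"
    and "continuous_on UNIV f'" "continuous_on UNIV g'"
    and "torus_fun f" "torus_fun g"
  shows "integral {-pi..pi} (\<lambda>x. f x * g' x) = - integral {-pi..pi} (\<lambda>x. f' x * g x)"
proof -
  have "continuous_on {-pi..pi} f" "continuous_on {-pi..pi} g"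
    by (intro continuous_at_imp_continuous_on ballI DERIV_isCont, rule assms)+
  moreover have "continuous_on {-pi..pi} f'" "continuous_on {-pi..pi} g'"
    by (rule continuous_on_subset, rule assms, simp)+
  ultimately have cont: "continuous_on {-pi..pi} f" "continuous_on {-pi..pi} g"
    "continuous_on {-pi..pi} f'" "continuous_on {-pi..pi} g'" .
  have "((\<lambda>x. f' x * g x + f x * g' x) has_integral f pi * g pi - f (-pi) * g (-pi)) {-pi..pi}"
    by (intro fundamental_theorem_of_calculus)
       (auto intro!: derivative_eq_intros has_field_derivative_at_within[OF assms(1)]
          has_field_derivative_at_within[OF assms(2)] simp flip: has_real_derivative_iff_has_vector_derivative)
  moreover have "f pi = f (-pi)" "g pi = g (-pi)"
    using assms(5,6)[unfolded torus_fun_def, THEN spec, of "-pi"] by auto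
  ultimately have "integral {-pi..pi} (\<lambda>x. f' x * g x + f x * g' x) = 0"
    by (simp add: integral_unique)
  moreover have "integral {-pi..pi} (\<lambda>x. f' x * g x + f x * g' x) =
      integral {-pi..pi} (\<lambda>x. f' x * g x) + integral {-pi..pi} (\<lambda>x. f x * g' x)"
    by (intro integral_add integrable_continuous_real continuous_intros cont)
  ultimately show ?thesis by linarith
qed

text \<open>Each application costs a quarter of the coercive coefficient. Two of them in
  \<open>energy_pointwise\<close> use up one half, and a third in \<open>energy_inequality\<close>
  uses part of the other half.\<close>

lemma weighted_am_gm:
  fixes x y a :: real
  assumes "a > 0"
  shows "x * y \<le> a / 4 * x\<^sup>2 + y\<^sup>2 / a"
proof -
  have "0 \<le> (a / 2 * x - y)\<^sup>2 / a" using assms by simp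
  also have "\<dots> = a / 4 * x\<^sup>2 + y\<^sup>2 / a - x * y"
    using assms by (simp add: power2_eq_square field_simps)
  finally show ?thesis by simp
qed

text \<open>This is the integrand that remains after the integrations by parts. The powers of
  \<open>L\<close> are tracked separately for \<open>v1\<close> and \<open>v\<close>, because
  \<open>v1\<close> is interpolated once more before everything is bounded by
  \<open>L ^ 3\<close>.\<close>

lemma energy_pointwise:
  fixes a0 K L A A1 A2 B B1 v v1 v2 g :: real
  assumes pos: "a0 > 0" "K \<ge> 0" "L \<ge> 1"
    and A: "A \<ge> a0" "\<bar>A1\<bar> \<le> K" "\<bar>A2\<bar> \<le> K * L" and B: "\<bar>B\<bar> \<le> K" "\<bar>B1\<bar> \<le> K * L"
    and g: "\<bar>g\<bar> \<le> K * L\<^sup>2 * \<bar>v1\<bar> + K * L * (\<bar>v\<bar> + \<bar>v1\<bar> + \<bar>v2\<bar>)"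
  shows "- (A2 * v + 2 * A1 * v1 + A * v2) * v2 - (B1 * v + B * v1) * v2 + v * g
    \<le> - (a0 / 2) * v2\<^sup>2 + (9 * K\<^sup>2 / a0 + K) * L * v1\<^sup>2 + (9 * K\<^sup>2 / a0 + 2 * K) * L ^ 3 * v\<^sup>2"
proof -
  define w w1 w2 where w: "w = \<bar>v\<bar>" "w1 = \<bar>v1\<bar>" "w2 = \<bar>v2\<bar>"
  have w0: "w \<ge> 0" "w1 \<ge> 0" "w2 \<ge> 0" by (auto simp: w)
  have L2: "L \<le> L\<^sup>2" "L\<^sup>2 \<le> L ^ 3" "L \<le> L ^ 3" "1 \<le> L\<^sup>2"
    using power_increasing[of 1 2 L] power_increasing[of 2 3 L] power_increasing[of 1 3 L]
      power_increasing[of 0 2 L] pos by auto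
  have bnd: "x * y * z \<le> c * \<bar>y\<bar> * \<bar>z\<bar>" if "\<bar>x\<bar> \<le> c" for x y z c :: real
  proof -
    have "x * y * z \<le> \<bar>x\<bar> * \<bar>y\<bar> * \<bar>z\<bar>" by (metis abs_ge_self abs_mult)
    also have "\<dots> \<le> c * \<bar>y\<bar> * \<bar>z\<bar>" using that by (intro mult_right_mono) auto
    finally show ?thesis .
  qed
  have t1: "- (A2 * v * v2) \<le> K * L * w * w2" using bnd[of "-A2" "K * L" v v2] A by (simp add: w)
  have t2: "- (2 * A1 * v1 * v2) \<le> 2 * K * w1 * w2" using bnd[of "-A1" K v1 v2] A by (simp add: w)
  have t3: "- (A * v2 * v2) \<le> - a0 * w2\<^sup>2"
    using A mult_right_mono[of a0 A "v2 * v2"] by (simp add: w power2_eq_square)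
  have t4: "- (B1 * v * v2) \<le> K * L * w * w2" using bnd[of "-B1" "K * L" v v2] B by (simp add: w)
  have t5: "- (B * v1 * v2) \<le> K * w1 * w2" using bnd[of "-B" K v1 v2] B by (simp add: w)
  have t6: "v * g \<le> K * L\<^sup>2 * w * w1 + K * L * (w\<^sup>2 + w * w1 + w * w2)"
  proof -
    have "v * g \<le> w * \<bar>g\<bar>" unfolding w by (metis abs_ge_self abs_mult)
    also have "\<dots> \<le> w * (K * L\<^sup>2 * w1 + K * L * (w + w1 + w2))"
      using g w0 by (intro mult_left_mono) (auto simp: w)
    finally show ?thesis by (simp add: algebra_simps power2_eq_square)
  qed
  have t7: "K * L * (w * w1) \<le> K * L\<^sup>2 * (w * w1)"
    using L2 w0 pos by (intro mult_right_mono mult_left_mono) auto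
  have y1: "w2 * (3 * K * w1) \<le> a0 / 4 * w2\<^sup>2 + (3 * K * w1)\<^sup>2 / a0" by (rule weighted_am_gm[OF pos(1)])
  have y2: "w2 * (3 * K * L * w) \<le> a0 / 4 * w2\<^sup>2 + (3 * K * L * w)\<^sup>2 / a0" by (rule weighted_am_gm[OF pos(1)])
  \<comment> \<open>The factor \<open>L\<close> inside the square distributes
    \<open>L\<^sup>2\<close> as one power on \<open>w1\<close> and three on \<open>w\<close>. One
    power on \<open>w1\<close> is affordable: its later interpolation against \<open>v2\<close>
    squares it to \<open>L\<^sup>2\<close>.\<close>
  have y3: "2 * K * L\<^sup>2 * (w * w1) \<le> K * (L * w1\<^sup>2 + L ^ 3 * w\<^sup>2)"
  proof -
    have "0 \<le> K * L * (w1 - L * w)\<^sup>2" using pos by simp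
    thus ?thesis by (simp add: power2_eq_square power3_eq_cube algebra_simps)
  qed
  have e1: "(3 * K * w1)\<^sup>2 / a0 \<le> 9 * K\<^sup>2 / a0 * L * w1\<^sup>2"
  proof -
    have "(3 * K * w1)\<^sup>2 / a0 = 9 * K\<^sup>2 / a0 * 1 * w1\<^sup>2" by (simp add: power_mult_distrib)
    also have "\<dots> \<le> 9 * K\<^sup>2 / a0 * L * w1\<^sup>2"
      using pos by (intro mult_right_mono mult_left_mono) auto
    finally show ?thesis .
  qed
  have e2: "(3 * K * L * w)\<^sup>2 / a0 \<le> 9 * K\<^sup>2 / a0 * L ^ 3 * w\<^sup>2"
  proof -
    have "(3 * K * L * w)\<^sup>2 / a0 = 9 * K\<^sup>2 / a0 * L\<^sup>2 * w\<^sup>2" by (simp add: power_mult_distrib)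
    also have "\<dots> \<le> 9 * K\<^sup>2 / a0 * L ^ 3 * w\<^sup>2"
      using pos L2 by (intro mult_right_mono mult_left_mono) auto
    finally show ?thesis .
  qed
  have e3: "K * L * w\<^sup>2 \<le> K * L ^ 3 * w\<^sup>2"
    using pos L2 by (intro mult_right_mono mult_left_mono) auto
  have "- (A2 * v + 2 * A1 * v1 + A * v2) * v2 - (B1 * v + B * v1) * v2 + v * g
    = - (A2 * v * v2) + - (2 * A1 * v1 * v2) + - (A * v2 * v2) + - (B1 * v * v2) + - (B * v1 * v2) + v * g"
    by (simp add: algebra_simps)
  also have "\<dots> \<le> K * L * w * w2 + 2 * K * w1 * w2 - a0 * w2\<^sup>2 + K * L * w * w2 + K * w1 * w2
      + (K * L\<^sup>2 * w * w1 + K * L * (w\<^sup>2 + w * w1 + w * w2))"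
    using t1 t2 t3 t4 t5 t6 by linarith
  also have "\<dots> = - a0 * w2\<^sup>2 + w2 * (3 * K * w1) + w2 * (3 * K * L * w)
      + K * L\<^sup>2 * (w * w1) + K * L * (w * w1) + K * L * w\<^sup>2"
    by (simp add: algebra_simps)
  also have "\<dots> \<le> - (a0 / 2) * w2\<^sup>2 + (9 * K\<^sup>2 / a0 * L * w1\<^sup>2 + K * (L * w1\<^sup>2))
      + (9 * K\<^sup>2 / a0 * L ^ 3 * w\<^sup>2 + K * (L ^ 3 * w\<^sup>2) + K * L ^ 3 * w\<^sup>2)"
    using t7 y1 y2 y3 e1 e2 e3 by (simp add: distrib_left)
  also have "\<dots> = - (a0 / 2) * v2\<^sup>2 + (9 * K\<^sup>2 / a0 + K) * L * v1\<^sup>2 + (9 * K\<^sup>2 / a0 + 2 * K) * L ^ 3 * v\<^sup>2"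
    by (simp add: w algebra_simps)
  finally show ?thesis .
qed

text \<open>
  Integrating by parts twice in the leading term and once in the third order term leaves \<open>v2\<^sup>2\<close>
  with a negative coefficient, which absorbs everything except a multiple of \<open>v\<^sup>2\<close>.
\<close>

lemma energy_inequality:
  fixes v v1 v2 v3 v4 A A1 A2 B B1 g :: "real \<Rightarrow> real" and a0 K L :: real
  assumes pos: "a0 > 0" "K \<ge> 0" "L \<ge> 1"
    and dv: "\<And>x. (v has_real_derivative v1 x) (at x)" "\<And>x. (v1 has_real_derivative v2 x) (at x)"
      "\<And>x. (v2 has_real_derivative v3 x) (at x)" "\<And>x. (v3 has_real_derivative v4 x) (at x)"
    and cv: "continuous_on UNIV v4"
    and dA: "\<And>x. (A has_real_derivative A1 x) (at x)" "\<And>x. (A1 has_real_derivative A2 x) (at x)"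
    and dB: "\<And>x. (B has_real_derivative B1 x) (at x)"
    and cont: "continuous_on UNIV A2" "continuous_on UNIV B1" "continuous_on UNIV g"
    and per: "torus_fun v" "torus_fun v1" "torus_fun v2" "torus_fun v3" "torus_fun A" "torus_fun A1" "torus_fun B"
    and A: "\<And>x. A x \<ge> a0" "\<And>x. \<bar>A1 x\<bar> \<le> K" "\<And>x. \<bar>A2 x\<bar> \<le> K * L"
    and B: "\<And>x. \<bar>B x\<bar> \<le> K" "\<And>x. \<bar>B1 x\<bar> \<le> K * L"
    and g: "\<And>x. \<bar>g x\<bar> \<le> K * L\<^sup>2 * \<bar>v1 x\<bar> + K * L * (\<bar>v x\<bar> + \<bar>v1 x\<bar> + \<bar>v2 x\<bar>)"
  shows "integral {-pi..pi} (\<lambda>x. v x * (- A x * v4 x + B x * v3 x + g x))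
    \<le> ((9 * K\<^sup>2 / a0 + 2 * K) + (9 * K\<^sup>2 / a0 + K)\<^sup>2 / a0) * L ^ 3 * integral {-pi..pi} (\<lambda>x. (v x)\<^sup>2)"
proof -
  let ?I = "integral {-pi..pi}"
  have c: "continuous_on UNIV v" "continuous_on UNIV v1" "continuous_on UNIV v2" "continuous_on UNIV v3"
     "continuous_on UNIV A" "continuous_on UNIV A1" "continuous_on UNIV B"
    by (intro continuous_at_imp_continuous_on ballI DERIV_isCont, rule dv dA dB)+
  have c': "continuous_on {-pi..pi} v" "continuous_on {-pi..pi} v1" "continuous_on {-pi..pi} v2"
     "continuous_on {-pi..pi} v3" "continuous_on {-pi..pi} v4"
     "continuous_on {-pi..pi} A" "continuous_on {-pi..pi} A1" "continuous_on {-pi..pi} A2"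
     "continuous_on {-pi..pi} B" "continuous_on {-pi..pi} B1" "continuous_on {-pi..pi} g"
    by (rule continuous_on_subset, rule c cont cv, simp)+
  note int = integrable_continuous_real continuous_intros c'
  have pt: "torus_fun (\<lambda>x. F x * G x)" "torus_fun (\<lambda>x. F x + G x)" if "torus_fun F" "torus_fun G" for F G
    using that by (auto simp: torus_fun_def)
  have 1: "?I (\<lambda>x. A x * v x * v4 x) = - ?I (\<lambda>x. (A1 x * v x + A x * v1 x) * v3 x)"
    by (rule periodic_integral_by_parts)
       ((rule dv cont cv c continuous_intros pt per | (auto intro!: derivative_eq_intros dA dv simp: algebra_simps; fail))+)
  have 2: "?I (\<lambda>x. (A1 x * v x + A x * v1 x) * v3 x) = - ?I (\<lambda>x. (A2 x * v x + 2 * A1 x * v1 x + A x * v2 x) * v2 x)"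
    by (rule periodic_integral_by_parts)
       ((rule dv cont cv c continuous_intros pt per | (auto intro!: derivative_eq_intros dA dv simp: algebra_simps; fail))+)
  have 3: "?I (\<lambda>x. (B x * v x) * v3 x) = - ?I (\<lambda>x. (B1 x * v x + B x * v1 x) * v2 x)"
    by (rule periodic_integral_by_parts)
       ((rule dv cont cv c continuous_intros pt per | (auto intro!: derivative_eq_intros dB dv simp: algebra_simps; fail))+)
  have 4: "?I (\<lambda>x. v x * v2 x) = - ?I (\<lambda>x. v1 x * v1 x)"
    by (rule periodic_integral_by_parts)
       ((rule dv cont cv c continuous_intros pt per | (auto intro!: derivative_eq_intros dB dv simp: algebra_simps; fail))+)
  define P where "P = 9 * K\<^sup>2 / a0 + K"
  define R where "R = 9 * K\<^sup>2 / a0 + 2 * K"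
  have j1: "(\<lambda>x. A x * v x * v4 x) integrable_on {-pi..pi}"
    and j2: "(\<lambda>x. (B x * v x) * v3 x) integrable_on {-pi..pi}"
    and j3: "(\<lambda>x. v x * g x) integrable_on {-pi..pi}"
    and j4: "(\<lambda>x. (A2 x * v x + 2 * A1 x * v1 x + A x * v2 x) * v2 x) integrable_on {-pi..pi}"
    and j5: "(\<lambda>x. (B1 x * v x + B x * v1 x) * v2 x) integrable_on {-pi..pi}"
    and j6: "(\<lambda>x. - (a0 / 2) * (v2 x)\<^sup>2 + R * L ^ 3 * (v x)\<^sup>2) integrable_on {-pi..pi}"
    and j7: "(\<lambda>x. P * L * (v1 x * v1 x)) integrable_on {-pi..pi}"
    and j8: "(\<lambda>x. (- P * L) * (v x * v2 x)) integrable_on {-pi..pi}"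
    by (intro int)+
  have "?I (\<lambda>x. v x * (- A x * v4 x + B x * v3 x + g x))
    = ?I (\<lambda>x. (B x * v x) * v3 x + v x * g x - A x * v x * v4 x)"
    by (simp add: algebra_simps)
  also have "\<dots> = ?I (\<lambda>x. (B x * v x) * v3 x) + ?I (\<lambda>x. v x * g x) - ?I (\<lambda>x. A x * v x * v4 x)"
    by (simp only: integral_add[OF j2 j3] integral_diff[OF integrable_add[OF j2 j3] j1])
  also have "\<dots> = ?I (\<lambda>x. v x * g x) - ?I (\<lambda>x. (A2 x * v x + 2 * A1 x * v1 x + A x * v2 x) * v2 x)
      - ?I (\<lambda>x. (B1 x * v x + B x * v1 x) * v2 x)"
    unfolding 1 2 3 by simp
  also have "\<dots> = ?I (\<lambda>x. v x * g x - (A2 x * v x + 2 * A1 x * v1 x + A x * v2 x) * v2 x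
      - (B1 x * v x + B x * v1 x) * v2 x)"
    by (simp only: integral_diff[OF j3 j4] integral_diff[OF integrable_diff[OF j3 j4] j5])
  also have "\<dots> \<le> ?I (\<lambda>x. - (a0 / 2) * (v2 x)\<^sup>2 + R * L ^ 3 * (v x)\<^sup>2 + P * L * (v1 x * v1 x))"
  proof (intro integral_le int)
    fix x
    show "v x * g x - (A2 x * v x + 2 * A1 x * v1 x + A x * v2 x) * v2 x - (B1 x * v x + B x * v1 x) * v2 x
      \<le> - (a0 / 2) * (v2 x)\<^sup>2 + R * L ^ 3 * (v x)\<^sup>2 + P * L * (v1 x * v1 x)"
      using energy_pointwise[OF pos A B g, of x] by (simp add: P_def R_def power2_eq_square algebra_simps)
  qed
  also have "\<dots> = ?I (\<lambda>x. - (a0 / 2) * (v2 x)\<^sup>2 + R * L ^ 3 * (v x)\<^sup>2) + P * L * ?I (\<lambda>x. v1 x * v1 x)"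
    by (simp only: integral_add[OF j6 j7] integral_mult_right)
  \<comment> \<open>One more integration by parts turns the square of \<open>v1\<close> into
    \<open>- v * v2\<close>, which the remaining half of the coercive term can absorb.\<close>
  also have "\<dots> = ?I (\<lambda>x. - (a0 / 2) * (v2 x)\<^sup>2 + R * L ^ 3 * (v x)\<^sup>2) + (- P * L) * ?I (\<lambda>x. v x * v2 x)"
    unfolding 4 by simp
  also have "\<dots> = ?I (\<lambda>x. - (a0 / 2) * (v2 x)\<^sup>2 + R * L ^ 3 * (v x)\<^sup>2 + (- P * L) * (v x * v2 x))"
    by (simp only: integral_add[OF j6 j8] integral_mult_right)
  also have "\<dots> \<le> ?I (\<lambda>x. (R + P\<^sup>2 / a0) * L ^ 3 * (v x)\<^sup>2)"
  proof (intro integral_le int)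
    fix x
    have "v2 x * (- P * L * v x) \<le> a0 / 4 * (v2 x)\<^sup>2 + (- P * L * v x)\<^sup>2 / a0"
      by (rule weighted_am_gm[OF pos(1)])
    moreover have "(- P * L * v x)\<^sup>2 / a0 \<le> P\<^sup>2 / a0 * L ^ 3 * (v x)\<^sup>2"
    proof -
      have "(- P * L * v x)\<^sup>2 / a0 = P\<^sup>2 / a0 * L\<^sup>2 * (v x)\<^sup>2" by (simp add: power_mult_distrib)
      also have "\<dots> \<le> P\<^sup>2 / a0 * L ^ 3 * (v x)\<^sup>2"
        using pos power_increasing[of 2 3 L] by (intro mult_right_mono mult_left_mono) auto
      finally show ?thesis .
    qed
    moreover have "0 \<le> a0 / 4 * (v2 x)\<^sup>2" using pos by simp
    ultimately show "- (a0 / 2) * (v2 x)\<^sup>2 + R * L ^ 3 * (v x)\<^sup>2 + (- P * L) * (v x * v2 x)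
        \<le> (R + P\<^sup>2 / a0) * L ^ 3 * (v x)\<^sup>2"
      by (simp add: algebra_simps)
  qed
  also have "\<dots> = (R + P\<^sup>2 / a0) * L ^ 3 * ?I (\<lambda>x. (v x)\<^sup>2)" by simp
  finally show ?thesis by (simp add: P_def R_def)
qed

subsection \<open>Lipschitz bounds for the coefficients\<close>

text \<open>Bounded Lipschitz functions on a box form an algebra (boundedness is what products
  require), so membership of the rational coefficients follows from their syntax. One constant
  serves both properties.\<close>

definition blip :: "real \<Rightarrow> real \<Rightarrow> (real \<Rightarrow> real \<Rightarrow> real \<Rightarrow> real) \<Rightarrow> bool" where
  "blip m M F \<longleftrightarrow> (\<exists>C. \<forall>r p q r' p' q'.
     r \<in> {m..M} \<and> \<bar>p\<bar> \<le> M \<and> \<bar>q\<bar> \<le> M \<and> r' \<in> {m..M} \<and> \<bar>p'\<bar> \<le> M \<and> \<bar>q'\<bar> \<le> M \<longrightarrow>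
     \<bar>F r p q\<bar> \<le> C \<and> \<bar>F r p q - F r' p' q'\<bar> \<le> C * (\<bar>r - r'\<bar> + \<bar>p - p'\<bar> + \<bar>q - q'\<bar>))"

lemma blipE:
  assumes "blip m M F"
  obtains C where "C \<ge> 0"
    "\<And>r p q. r \<in> {m..M} \<Longrightarrow> \<bar>p\<bar> \<le> M \<Longrightarrow> \<bar>q\<bar> \<le> M \<Longrightarrow> \<bar>F r p q\<bar> \<le> C"
    "\<And>r p q r' p' q'. r \<in> {m..M} \<Longrightarrow> \<bar>p\<bar> \<le> M \<Longrightarrow> \<bar>q\<bar> \<le> M \<Longrightarrow> r' \<in> {m..M} \<Longrightarrow> \<bar>p'\<bar> \<le> M \<Longrightarrow> \<bar>q'\<bar> \<le> M \<Longrightarrow>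
      \<bar>F r p q - F r' p' q'\<bar> \<le> C * (\<bar>r - r'\<bar> + \<bar>p - p'\<bar> + \<bar>q - q'\<bar>)"
proof -
  obtain C where C: "\<forall>r p q r' p' q'.
     r \<in> {m..M} \<and> \<bar>p\<bar> \<le> M \<and> \<bar>q\<bar> \<le> M \<and> r' \<in> {m..M} \<and> \<bar>p'\<bar> \<le> M \<and> \<bar>q'\<bar> \<le> M \<longrightarrow>
     \<bar>F r p q\<bar> \<le> C \<and> \<bar>F r p q - F r' p' q'\<bar> \<le> C * (\<bar>r - r'\<bar> + \<bar>p - p'\<bar> + \<bar>q - q'\<bar>)"
    using assms unfolding blip_def by blast
  show ?thesis
  proof (rule that[of "\<bar>C\<bar>"])
    fix r p q r' p' q' assume "r \<in> {m..M}" "\<bar>p\<bar> \<le> M" "\<bar>q\<bar> \<le> M" "r' \<in> {m..M}" "\<bar>p'\<bar> \<le> M" "\<bar>q'\<bar> \<le> M"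
    hence "\<bar>F r p q - F r' p' q'\<bar> \<le> C * (\<bar>r - r'\<bar> + \<bar>p - p'\<bar> + \<bar>q - q'\<bar>)" using C by blast
    also have "\<dots> \<le> \<bar>C\<bar> * (\<bar>r - r'\<bar> + \<bar>p - p'\<bar> + \<bar>q - q'\<bar>)" by (intro mult_right_mono) auto
    finally show "\<bar>F r p q - F r' p' q'\<bar> \<le> \<bar>C\<bar> * (\<bar>r - r'\<bar> + \<bar>p - p'\<bar> + \<bar>q - q'\<bar>)" .
  qed (use C in force)+
qed

lemma blipI:
  assumes "\<And>r p q. r \<in> {m..M} \<Longrightarrow> \<bar>p\<bar> \<le> M \<Longrightarrow> \<bar>q\<bar> \<le> M \<Longrightarrow> \<bar>F r p q\<bar> \<le> C1"
    "\<And>r p q r' p' q'. r \<in> {m..M} \<Longrightarrow> \<bar>p\<bar> \<le> M \<Longrightarrow> \<bar>q\<bar> \<le> M \<Longrightarrow> r' \<in> {m..M} \<Longrightarrow> \<bar>p'\<bar> \<le> M \<Longrightarrow> \<bar>q'\<bar> \<le> M \<Longrightarrow>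
      \<bar>F r p q - F r' p' q'\<bar> \<le> C2 * (\<bar>r - r'\<bar> + \<bar>p - p'\<bar> + \<bar>q - q'\<bar>)"
  shows "blip m M F"
  unfolding blip_def
proof (intro exI[of _ "max C1 C2"] allI impI conjI)
  fix r p q r' p' q' assume *: "r \<in> {m..M} \<and> \<bar>p\<bar> \<le> M \<and> \<bar>q\<bar> \<le> M \<and> r' \<in> {m..M} \<and> \<bar>p'\<bar> \<le> M \<and> \<bar>q'\<bar> \<le> M"
  show "\<bar>F r p q\<bar> \<le> max C1 C2" using assms(1)[of r p q] * by auto
  have "\<bar>F r p q - F r' p' q'\<bar> \<le> C2 * (\<bar>r - r'\<bar> + \<bar>p - p'\<bar> + \<bar>q - q'\<bar>)" using assms(2) * by blast
  also have "\<dots> \<le> max C1 C2 * (\<bar>r - r'\<bar> + \<bar>p - p'\<bar> + \<bar>q - q'\<bar>)" by (intro mult_right_mono) auto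
  finally show "\<bar>F r p q - F r' p' q'\<bar> \<le> max C1 C2 * (\<bar>r - r'\<bar> + \<bar>p - p'\<bar> + \<bar>q - q'\<bar>)" .
qed

named_theorems blip_intros

lemma blip_const [blip_intros]: "blip m M (\<lambda>r p q. c)"
  by (rule blipI[of _ _ _ "\<bar>c\<bar>" 0]) auto

lemma blip_proj [blip_intros]:
  "blip m M (\<lambda>r p q. r)" "blip m M (\<lambda>r p q. p)" "blip m M (\<lambda>r p q. q)"
  by (rule blipI[of _ _ _ "\<bar>m\<bar> + \<bar>M\<bar>" 1]; force)+

lemma blip_add [blip_intros]:
  assumes "blip m M F" "blip m M G"
  shows "blip m M (\<lambda>r p q. F r p q + G r p q)"
proof -
  obtain C where C: "C \<ge> 0"
    "\<And>r p q. r \<in> {m..M} \<Longrightarrow> \<bar>p\<bar> \<le> M \<Longrightarrow> \<bar>q\<bar> \<le> M \<Longrightarrow> \<bar>F r p q\<bar> \<le> C"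
    "\<And>r p q r' p' q'. r \<in> {m..M} \<Longrightarrow> \<bar>p\<bar> \<le> M \<Longrightarrow> \<bar>q\<bar> \<le> M \<Longrightarrow> r' \<in> {m..M} \<Longrightarrow> \<bar>p'\<bar> \<le> M \<Longrightarrow> \<bar>q'\<bar> \<le> M \<Longrightarrow>
      \<bar>F r p q - F r' p' q'\<bar> \<le> C * (\<bar>r - r'\<bar> + \<bar>p - p'\<bar> + \<bar>q - q'\<bar>)"
    by (rule blipE[OF assms(1)]) (rule that; blast)
  obtain D where D: "D \<ge> 0"
    "\<And>r p q. r \<in> {m..M} \<Longrightarrow> \<bar>p\<bar> \<le> M \<Longrightarrow> \<bar>q\<bar> \<le> M \<Longrightarrow> \<bar>G r p q\<bar> \<le> D"
    "\<And>r p q r' p' q'. r \<in> {m..M} \<Longrightarrow> \<bar>p\<bar> \<le> M \<Longrightarrow> \<bar>q\<bar> \<le> M \<Longrightarrow> r' \<in> {m..M} \<Longrightarrow> \<bar>p'\<bar> \<le> M \<Longrightarrow> \<bar>q'\<bar> \<le> M \<Longrightarrow>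
      \<bar>G r p q - G r' p' q'\<bar> \<le> D * (\<bar>r - r'\<bar> + \<bar>p - p'\<bar> + \<bar>q - q'\<bar>)"
    by (rule blipE[OF assms(2)]) (rule that; blast)
  show ?thesis
  proof (rule blipI[of _ _ _ "C + D" "C + D"])
    fix r p q r' p' q' assume *: "r \<in> {m..M}" "\<bar>p\<bar> \<le> M" "\<bar>q\<bar> \<le> M" "r' \<in> {m..M}" "\<bar>p'\<bar> \<le> M" "\<bar>q'\<bar> \<le> M"
    show "\<bar>F r p q + G r p q - (F r' p' q' + G r' p' q')\<bar> \<le> (C + D) * (\<bar>r - r'\<bar> + \<bar>p - p'\<bar> + \<bar>q - q'\<bar>)"
      using C(3)[OF *] D(3)[OF *] unfolding distrib_right[of C D] by linarith
  next
    fix r p q assume *: "r \<in> {m..M}" "\<bar>p\<bar> \<le> M" "\<bar>q\<bar> \<le> M"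
    show "\<bar>F r p q + G r p q\<bar> \<le> C + D" using C(2)[OF *] D(2)[OF *] by simp
  qed
qed

lemma blip_mult [blip_intros]:
  assumes "blip m M F" "blip m M G"
  shows "blip m M (\<lambda>r p q. F r p q * G r p q)"
proof -
  obtain C where C: "C \<ge> 0"
    "\<And>r p q. r \<in> {m..M} \<Longrightarrow> \<bar>p\<bar> \<le> M \<Longrightarrow> \<bar>q\<bar> \<le> M \<Longrightarrow> \<bar>F r p q\<bar> \<le> C"
    "\<And>r p q r' p' q'. r \<in> {m..M} \<Longrightarrow> \<bar>p\<bar> \<le> M \<Longrightarrow> \<bar>q\<bar> \<le> M \<Longrightarrow> r' \<in> {m..M} \<Longrightarrow> \<bar>p'\<bar> \<le> M \<Longrightarrow> \<bar>q'\<bar> \<le> M \<Longrightarrow>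
      \<bar>F r p q - F r' p' q'\<bar> \<le> C * (\<bar>r - r'\<bar> + \<bar>p - p'\<bar> + \<bar>q - q'\<bar>)"
    by (rule blipE[OF assms(1)]) (rule that; blast)
  obtain D where D: "D \<ge> 0"
    "\<And>r p q. r \<in> {m..M} \<Longrightarrow> \<bar>p\<bar> \<le> M \<Longrightarrow> \<bar>q\<bar> \<le> M \<Longrightarrow> \<bar>G r p q\<bar> \<le> D"
    "\<And>r p q r' p' q'. r \<in> {m..M} \<Longrightarrow> \<bar>p\<bar> \<le> M \<Longrightarrow> \<bar>q\<bar> \<le> M \<Longrightarrow> r' \<in> {m..M} \<Longrightarrow> \<bar>p'\<bar> \<le> M \<Longrightarrow> \<bar>q'\<bar> \<le> M \<Longrightarrow>
      \<bar>G r p q - G r' p' q'\<bar> \<le> D * (\<bar>r - r'\<bar> + \<bar>p - p'\<bar> + \<bar>q - q'\<bar>)"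
    by (rule blipE[OF assms(2)]) (rule that; blast)
  show ?thesis
  proof (rule blipI[of _ _ _ "C * D" "2 * C * D"])
    fix r p q r' p' q' assume *: "r \<in> {m..M}" "\<bar>p\<bar> \<le> M" "\<bar>q\<bar> \<le> M" "r' \<in> {m..M}" "\<bar>p'\<bar> \<le> M" "\<bar>q'\<bar> \<le> M"
    let ?d = "\<bar>r - r'\<bar> + \<bar>p - p'\<bar> + \<bar>q - q'\<bar>"
    have "\<bar>F r p q * G r p q - F r' p' q' * G r' p' q'\<bar>
        = \<bar>(F r p q - F r' p' q') * G r p q + F r' p' q' * (G r p q - G r' p' q')\<bar>"
      by (simp add: algebra_simps)
    also have "\<dots> \<le> \<bar>F r p q - F r' p' q'\<bar> * \<bar>G r p q\<bar> + \<bar>F r' p' q'\<bar> * \<bar>G r p q - G r' p' q'\<bar>"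
      by (metis abs_mult abs_triangle_ineq)
    also have "\<dots> \<le> (C * ?d) * D + C * (D * ?d)"
      using C(1) D(1) C(3)[OF *] D(3)[OF *] C(2)[OF *(4-6)] D(2)[OF *(1-3)]
      by (intro add_mono mult_mono) auto
    finally show "\<bar>F r p q * G r p q - F r' p' q' * G r' p' q'\<bar> \<le> 2 * C * D * ?d"
      by (simp add: algebra_simps)
  next
    fix r p q assume *: "r \<in> {m..M}" "\<bar>p\<bar> \<le> M" "\<bar>q\<bar> \<le> M"
    show "\<bar>F r p q * G r p q\<bar> \<le> C * D" using C(2)[OF *] D(2)[OF *] C(1) by (simp add: abs_mult mult_mono)
  qed
qed

lemma blip_uminus [blip_intros]: "blip m M F \<Longrightarrow> blip m M (\<lambda>r p q. - F r p q)"
  using blip_mult[OF blip_const[of m M "-1"], of F] by simp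

lemma blip_diff [blip_intros]:
  "blip m M F \<Longrightarrow> blip m M G \<Longrightarrow> blip m M (\<lambda>r p q. F r p q - G r p q)"
  using blip_add[OF _ blip_uminus, of m M F G] by simp

lemma blip_power [blip_intros]: "blip m M F \<Longrightarrow> blip m M (\<lambda>r p q. F r p q ^ n)"
  by (induction n) (auto intro!: blip_intros)

lemma blip_inverse:
  assumes F: "blip m M F" and c: "c > 0" "\<And>r p q. r \<in> {m..M} \<Longrightarrow> F r p q \<ge> c"
  shows "blip m M (\<lambda>r p q. inverse (F r p q))"
proof -
  obtain C where C: "C \<ge> 0"
    "\<And>r p q. r \<in> {m..M} \<Longrightarrow> \<bar>p\<bar> \<le> M \<Longrightarrow> \<bar>q\<bar> \<le> M \<Longrightarrow> \<bar>F r p q\<bar> \<le> C"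
    "\<And>r p q r' p' q'. r \<in> {m..M} \<Longrightarrow> \<bar>p\<bar> \<le> M \<Longrightarrow> \<bar>q\<bar> \<le> M \<Longrightarrow> r' \<in> {m..M} \<Longrightarrow> \<bar>p'\<bar> \<le> M \<Longrightarrow> \<bar>q'\<bar> \<le> M \<Longrightarrow>
      \<bar>F r p q - F r' p' q'\<bar> \<le> C * (\<bar>r - r'\<bar> + \<bar>p - p'\<bar> + \<bar>q - q'\<bar>)"
    by (rule blipE[OF F]) (rule that; blast)
  show ?thesis
  proof (rule blipI[of _ _ _ "inverse c" "C / c\<^sup>2"])
    fix r p q r' p' q' assume *: "r \<in> {m..M}" "\<bar>p\<bar> \<le> M" "\<bar>q\<bar> \<le> M" "r' \<in> {m..M}" "\<bar>p'\<bar> \<le> M" "\<bar>q'\<bar> \<le> M"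
    have g: "F r p q \<ge> c" "F r' p' q' \<ge> c" using c(2) * by auto
    have "inverse (F r p q) - inverse (F r' p' q') = (F r' p' q' - F r p q) / (F r p q * F r' p' q')"
      using g c(1) by (simp add: field_simps)
    hence "\<bar>inverse (F r p q) - inverse (F r' p' q')\<bar> = \<bar>F r p q - F r' p' q'\<bar> / (F r p q * F r' p' q')"
      using g c(1) by (simp add: abs_mult)
    also have "\<dots> \<le> (C * (\<bar>r - r'\<bar> + \<bar>p - p'\<bar> + \<bar>q - q'\<bar>)) / (c * c)"
      using g c(1) C(1) C(3)[OF *] by (intro frac_le mult_mono) auto
    finally show "\<bar>inverse (F r p q) - inverse (F r' p' q')\<bar> \<le> C / c\<^sup>2 * (\<bar>r - r'\<bar> + \<bar>p - p'\<bar> + \<bar>q - q'\<bar>)"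
      by (simp add: power2_eq_square)
  next
    fix r p q assume "r \<in> {m..M}"
    hence "F r p q \<ge> c" by (rule c(2))
    thus "\<bar>inverse (F r p q)\<bar> \<le> inverse c" using c(1) by (simp add: le_imp_inverse_le)
  qed
qed

lemma blip_inverse_r: "m > 0 \<Longrightarrow> blip m M (\<lambda>r p q. inverse r)"
  by (rule blip_inverse[of _ _ _ m]) (auto intro: blip_intros)

lemma blip_inverse_Q [blip_intros]: "blip m M (\<lambda>r p q. inverse (1 + p\<^sup>2))"
  by (rule blip_inverse[of _ _ _ 1]) (auto intro!: blip_intros)

lemmas blip_unfold = divide_inverse inverse_mult_distrib power_inverse[symmetric]

lemma blip_asd:
  assumes "m > 0"
  shows "blip m M (\<lambda>r p q. asd_a p)" "blip m M asd_b" "blip m M asd_c"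
  unfolding asd_a_def asd_b_def[abs_def] asd_c_def[abs_def] blip_unfold
  by (intro blip_intros blip_inverse_r[OF assms])+

section \<open>Derivatives of the coefficients along a function\<close>

lemma asd_coefficient_derivative_identities:
  fixes r p q t Q :: real
  assumes "r \<noteq> 0" "Q \<noteq> 0"
  shows "(0 * Q\<^sup>2 - 1 * (2 * Q * (2 * p * q))) / (Q\<^sup>2)\<^sup>2 = - 4 * (p * q) / Q ^ 3"
    and "(- 4 * (q * q + p * t) * Q ^ 3 - - 4 * (p * q) * (3 * Q\<^sup>2 * (2 * p * q))) / (Q ^ 3)\<^sup>2
      = 24 * p\<^sup>2 * q\<^sup>2 / Q ^ 4 - 4 * q\<^sup>2 / Q ^ 3 + (- 4 * p / Q ^ 3) * t"
    and "((10 * q * q + 10 * p * t) * Q ^ 3 - 10 * p * q * (3 * Q\<^sup>2 * (2 * p * q))) / (Q ^ 3)\<^sup>2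
       - (2 * q * (r * Q\<^sup>2) - 2 * p * (p * Q\<^sup>2 + r * (2 * Q * (2 * p * q)))) / (r * Q\<^sup>2)\<^sup>2
      = 10 * q\<^sup>2 / Q ^ 3 - 60 * p\<^sup>2 * q\<^sup>2 / Q ^ 4 - 2 * q / (r * Q\<^sup>2)
        + 2 * p\<^sup>2 / (r\<^sup>2 * Q\<^sup>2) + 8 * p\<^sup>2 * q / (r * Q ^ 3) + (10 * p / Q ^ 3) * t"
proof -
  define i j where ij: "i = inverse r" "j = inverse Q"
  have *: "r * i = 1" "Q * j = 1" using assms by (simp_all add: ij)
  show "(0 * Q\<^sup>2 - 1 * (2 * Q * (2 * p * q))) / (Q\<^sup>2)\<^sup>2 = - 4 * (p * q) / Q ^ 3"
    "(- 4 * (q * q + p * t) * Q ^ 3 - - 4 * (p * q) * (3 * Q\<^sup>2 * (2 * p * q))) / (Q ^ 3)\<^sup>2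
      = 24 * p\<^sup>2 * q\<^sup>2 / Q ^ 4 - 4 * q\<^sup>2 / Q ^ 3 + (- 4 * p / Q ^ 3) * t"
    "((10 * q * q + 10 * p * t) * Q ^ 3 - 10 * p * q * (3 * Q\<^sup>2 * (2 * p * q))) / (Q ^ 3)\<^sup>2
       - (2 * q * (r * Q\<^sup>2) - 2 * p * (p * Q\<^sup>2 + r * (2 * Q * (2 * p * q)))) / (r * Q\<^sup>2)\<^sup>2
      = 10 * q\<^sup>2 / Q ^ 3 - 60 * p\<^sup>2 * q\<^sup>2 / Q ^ 4 - 2 * q / (r * Q\<^sup>2)
        + 2 * p\<^sup>2 / (r\<^sup>2 * Q\<^sup>2) + 8 * p\<^sup>2 * q / (r * Q ^ 3) + (10 * p / Q ^ 3) * t"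
    unfolding divide_inverse inverse_mult_distrib power_inverse[symmetric] power_mult_distrib ij[symmetric]
    using * by algebra+
qed

text \<open>The derivatives are kept as a function of \<open>r, p, q\<close> plus another such
  function times the third derivative, because only the third derivative may blow up at time 0: the
  first parts are bounded, the second ones grow like \<open>L\<close>.\<close>

lemma asd_coefficient_derivatives:
  fixes f f1 f2 f3 :: "real \<Rightarrow> real"
  assumes d: "(f has_real_derivative f1 x) (at x)"
    "(f1 has_real_derivative f2 x) (at x)" "(f2 has_real_derivative f3 x) (at x)"
    and f0: "f x \<noteq> 0"
  shows "((\<lambda>x. asd_a (f1 x)) has_real_derivative - 4 * (f1 x * f2 x) / (1 + (f1 x)\<^sup>2) ^ 3) (at x)"
    and "((\<lambda>x. - 4 * (f1 x * f2 x) / (1 + (f1 x)\<^sup>2) ^ 3) has_real_derivative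
      24 * (f1 x)\<^sup>2 * (f2 x)\<^sup>2 / (1 + (f1 x)\<^sup>2) ^ 4 - 4 * (f2 x)\<^sup>2 / (1 + (f1 x)\<^sup>2) ^ 3
        + (- 4 * f1 x / (1 + (f1 x)\<^sup>2) ^ 3) * f3 x) (at x)"
    and "((\<lambda>x. asd_b (f x) (f1 x) (f2 x)) has_real_derivative
      10 * (f2 x)\<^sup>2 / (1 + (f1 x)\<^sup>2) ^ 3 - 60 * (f1 x)\<^sup>2 * (f2 x)\<^sup>2 / (1 + (f1 x)\<^sup>2) ^ 4
        - 2 * f2 x / (f x * (1 + (f1 x)\<^sup>2)\<^sup>2) + 2 * (f1 x)\<^sup>2 / ((f x)\<^sup>2 * (1 + (f1 x)\<^sup>2)\<^sup>2)
        + 8 * (f1 x)\<^sup>2 * f2 x / (f x * (1 + (f1 x)\<^sup>2) ^ 3) + (10 * f1 x / (1 + (f1 x)\<^sup>2) ^ 3) * f3 x) (at x)"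
proof -
  define Q where Q_def': "Q = (\<lambda>x. 1 + (f1 x)\<^sup>2)"
  have Q: "Q x \<noteq> 0" unfolding Q_def' by (smt (verit) zero_le_power2)
  have dQ: "(Q has_real_derivative 2 * f1 x * f2 x) (at x)"
    unfolding Q_def' by (rule derivative_eq_intros d refl | simp)+
  have dQ2: "((\<lambda>x. (Q x)\<^sup>2) has_real_derivative 2 * Q x * (2 * f1 x * f2 x)) (at x)"
    and dQ3: "((\<lambda>x. Q x ^ 3) has_real_derivative 3 * (Q x)\<^sup>2 * (2 * f1 x * f2 x)) (at x)"
    and df12: "((\<lambda>x. -4 * (f1 x * f2 x)) has_real_derivative -4 * (f2 x * f2 x + f1 x * f3 x)) (at x)"
    and df12': "((\<lambda>x. 10 * f1 x * f2 x) has_real_derivative 10 * f2 x * f2 x + 10 * f1 x * f3 x) (at x)"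
    and df1: "((\<lambda>x. 2 * f1 x) has_real_derivative 2 * f2 x) (at x)"
    by (rule derivative_eq_intros dQ d refl | simp)+
  have dfQ: "((\<lambda>x. f x * (Q x)\<^sup>2) has_real_derivative f1 x * (Q x)\<^sup>2 + f x * (2 * Q x * (2 * f1 x * f2 x))) (at x)"
    using DERIV_mult[OF d(1) dQ2] by (simp add: mult_ac)
  have 1: "((\<lambda>x. 1 / (Q x)\<^sup>2) has_real_derivative - 4 * (f1 x * f2 x) / Q x ^ 3) (at x)"
    unfolding asd_coefficient_derivative_identities(1)[OF f0 Q, symmetric] power2_eq_square[of "(Q x)\<^sup>2"]
    by (rule DERIV_divide[OF DERIV_const dQ2]) (use Q in simp)
  show "((\<lambda>x. asd_a (f1 x)) has_real_derivative - 4 * (f1 x * f2 x) / (1 + (f1 x)\<^sup>2) ^ 3) (at x)"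
    using 1 unfolding Q_def' asd_a_def .
  have 2: "((\<lambda>x. - 4 * (f1 x * f2 x) / Q x ^ 3) has_real_derivative
      24 * (f1 x)\<^sup>2 * (f2 x)\<^sup>2 / Q x ^ 4 - 4 * (f2 x)\<^sup>2 / Q x ^ 3 + (- 4 * f1 x / Q x ^ 3) * f3 x) (at x)"
    unfolding asd_coefficient_derivative_identities(2)[OF f0 Q, symmetric] power2_eq_square[of "Q x ^ 3"]
    by (rule DERIV_divide[OF df12 dQ3]) (use Q in simp)
  show "((\<lambda>x. - 4 * (f1 x * f2 x) / (1 + (f1 x)\<^sup>2) ^ 3) has_real_derivative
      24 * (f1 x)\<^sup>2 * (f2 x)\<^sup>2 / (1 + (f1 x)\<^sup>2) ^ 4 - 4 * (f2 x)\<^sup>2 / (1 + (f1 x)\<^sup>2) ^ 3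
        + (- 4 * f1 x / (1 + (f1 x)\<^sup>2) ^ 3) * f3 x) (at x)"
    using 2 unfolding Q_def' .
  have 3: "((\<lambda>x. 10 * f1 x * f2 x / Q x ^ 3 - 2 * f1 x / (f x * (Q x)\<^sup>2)) has_real_derivative
      10 * (f2 x)\<^sup>2 / Q x ^ 3 - 60 * (f1 x)\<^sup>2 * (f2 x)\<^sup>2 / Q x ^ 4
        - 2 * f2 x / (f x * (Q x)\<^sup>2) + 2 * (f1 x)\<^sup>2 / ((f x)\<^sup>2 * (Q x)\<^sup>2)
        + 8 * (f1 x)\<^sup>2 * f2 x / (f x * Q x ^ 3) + (10 * f1 x / Q x ^ 3) * f3 x) (at x)"
    unfolding asd_coefficient_derivative_identities(3)[OF f0 Q, symmetric]
      power2_eq_square[of "Q x ^ 3"] power2_eq_square[of "f x * (Q x)\<^sup>2"]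
    by (intro DERIV_diff DERIV_divide df12' dQ3 df1 dfQ) (use Q f0 in simp_all)
  show "((\<lambda>x. asd_b (f x) (f1 x) (f2 x)) has_real_derivative
      10 * (f2 x)\<^sup>2 / (1 + (f1 x)\<^sup>2) ^ 3 - 60 * (f1 x)\<^sup>2 * (f2 x)\<^sup>2 / (1 + (f1 x)\<^sup>2) ^ 4
        - 2 * f2 x / (f x * (1 + (f1 x)\<^sup>2)\<^sup>2) + 2 * (f1 x)\<^sup>2 / ((f x)\<^sup>2 * (1 + (f1 x)\<^sup>2)\<^sup>2)
        + 8 * (f1 x)\<^sup>2 * f2 x / (f x * (1 + (f1 x)\<^sup>2) ^ 3) + (10 * f1 x / (1 + (f1 x)\<^sup>2) ^ 3) * f3 x) (at x)"
    using 3 unfolding Q_def' asd_b_def .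
qed

lemma blip_asd_derivatives:
  assumes "m > 0"
  shows "blip m M (\<lambda>r p q. - 4 * (p * q) / (1 + p\<^sup>2) ^ 3)"
    "blip m M (\<lambda>r p q. 24 * p\<^sup>2 * q\<^sup>2 / (1 + p\<^sup>2) ^ 4 - 4 * q\<^sup>2 / (1 + p\<^sup>2) ^ 3)"
    "blip m M (\<lambda>r p q. - 4 * p / (1 + p\<^sup>2) ^ 3)"
    "blip m M (\<lambda>r p q. 10 * q\<^sup>2 / (1 + p\<^sup>2) ^ 3 - 60 * p\<^sup>2 * q\<^sup>2 / (1 + p\<^sup>2) ^ 4 - 2 * q / (r * (1 + p\<^sup>2)\<^sup>2)
        + 2 * p\<^sup>2 / (r\<^sup>2 * (1 + p\<^sup>2)\<^sup>2) + 8 * p\<^sup>2 * q / (r * (1 + p\<^sup>2) ^ 3))"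
    "blip m M (\<lambda>r p q. 10 * p / (1 + p\<^sup>2) ^ 3)"
  unfolding blip_unfold
  by (intro blip_intros blip_inverse_r[OF assms])+

lemma one_plus_square_pos: "0 < 1 + (x :: real)\<^sup>2"
  by (simp add: add_pos_nonneg)

lemma abs_add_mult_le: "\<bar>x + y * z\<bar> \<le> \<bar>x\<bar> + \<bar>y\<bar> * \<bar>z :: real\<bar>"
  by (metis abs_mult abs_triangle_ineq)

text \<open>The lower bound is the coercivity constant \<open>a0\<close> of the energy estimate: the
  equation is uniformly parabolic as long as the slope stays bounded.\<close>

lemma asd_a_lower:
  assumes "\<bar>p\<bar> \<le> M"
  shows "1 / (1 + M\<^sup>2)\<^sup>2 \<le> asd_a p"
proof -
  have "p\<^sup>2 \<le> M\<^sup>2" using assms by (simp add: abs_le_square_iff[symmetric])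
  hence "(1 + p\<^sup>2)\<^sup>2 \<le> (1 + M\<^sup>2)\<^sup>2" by (intro power_mono) auto
  thus ?thesis unfolding asd_a_def
    by (intro divide_left_mono mult_pos_pos zero_less_power one_plus_square_pos) auto
qed

text \<open>
  The bounds on the third and fourth derivatives may blow up in time, so their powers are made
  explicit.
\<close>

lemma asd_energy:
  fixes m M :: real
  assumes m: "m > 0"
  obtains C where "C \<ge> 0"
    "\<And>f h L \<beta> \<beta>'. f \<in> holder_space 4 \<beta> \<Longrightarrow> h \<in> holder_space 4 \<beta>' \<Longrightarrow> L \<ge> 1 \<Longrightarrow>
       (\<And>x. f x \<in> {m..M} \<and> h x \<in> {m..M}) \<Longrightarrow>
       (\<And>j x. j \<in> {1, 2} \<Longrightarrow> \<bar>(deriv ^^ j) f x\<bar> \<le> M \<and> \<bar>(deriv ^^ j) h x\<bar> \<le> M) \<Longrightarrow>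
       (\<And>x. \<bar>(deriv ^^ 3) f x\<bar> \<le> M * L \<and> \<bar>(deriv ^^ 3) h x\<bar> \<le> M * L \<and> \<bar>(deriv ^^ 4) h x\<bar> \<le> M * L\<^sup>2) \<Longrightarrow>
       integral {-pi..pi} (\<lambda>x. (f x - h x) * (asd_rhs f x - asd_rhs h x))
         \<le> C * L ^ 3 * integral {-pi..pi} (\<lambda>x. (f x - h x)\<^sup>2)"
proof -
  obtain C1 where C1: "C1 \<ge> 0" "\<And>r p q. r \<in> {m..M} \<Longrightarrow> \<bar>p\<bar> \<le> M \<Longrightarrow> \<bar>q\<bar> \<le> M \<Longrightarrow>
      \<bar>- 4 * (p * q) / (1 + p\<^sup>2) ^ 3\<bar> \<le> C1"
    by (rule blipE[OF blip_asd_derivatives(1)[OF m, of M]]) (rule that; blast)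
  obtain C2 where C2: "C2 \<ge> 0" "\<And>r p q. r \<in> {m..M} \<Longrightarrow> \<bar>p\<bar> \<le> M \<Longrightarrow> \<bar>q\<bar> \<le> M \<Longrightarrow>
      \<bar>24 * p\<^sup>2 * q\<^sup>2 / (1 + p\<^sup>2) ^ 4 - 4 * q\<^sup>2 / (1 + p\<^sup>2) ^ 3\<bar> \<le> C2"
    by (rule blipE[OF blip_asd_derivatives(2)[OF m, of M]]) (rule that; blast)
  obtain C3 where C3: "C3 \<ge> 0" "\<And>r p q. r \<in> {m..M} \<Longrightarrow> \<bar>p\<bar> \<le> M \<Longrightarrow> \<bar>q\<bar> \<le> M \<Longrightarrow>
      \<bar>- 4 * p / (1 + p\<^sup>2) ^ 3\<bar> \<le> C3"
    by (rule blipE[OF blip_asd_derivatives(3)[OF m, of M]]) (rule that; blast)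
  obtain C4 where C4: "C4 \<ge> 0" "\<And>r p q. r \<in> {m..M} \<Longrightarrow> \<bar>p\<bar> \<le> M \<Longrightarrow> \<bar>q\<bar> \<le> M \<Longrightarrow>
      \<bar>10 * q\<^sup>2 / (1 + p\<^sup>2) ^ 3 - 60 * p\<^sup>2 * q\<^sup>2 / (1 + p\<^sup>2) ^ 4 - 2 * q / (r * (1 + p\<^sup>2)\<^sup>2)
        + 2 * p\<^sup>2 / (r\<^sup>2 * (1 + p\<^sup>2)\<^sup>2) + 8 * p\<^sup>2 * q / (r * (1 + p\<^sup>2) ^ 3)\<bar> \<le> C4"
    by (rule blipE[OF blip_asd_derivatives(4)[OF m, of M]]) (rule that; blast)
  obtain C5 where C5: "C5 \<ge> 0" "\<And>r p q. r \<in> {m..M} \<Longrightarrow> \<bar>p\<bar> \<le> M \<Longrightarrow> \<bar>q\<bar> \<le> M \<Longrightarrow>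
      \<bar>10 * p / (1 + p\<^sup>2) ^ 3\<bar> \<le> C5"
    by (rule blipE[OF blip_asd_derivatives(5)[OF m, of M]]) (rule that; blast)
  obtain Ca where Ca: "Ca \<ge> 0" "\<And>r p q r' p' q'. r \<in> {m..M} \<Longrightarrow> \<bar>p\<bar> \<le> M \<Longrightarrow> \<bar>q\<bar> \<le> M \<Longrightarrow>
      r' \<in> {m..M} \<Longrightarrow> \<bar>p'\<bar> \<le> M \<Longrightarrow> \<bar>q'\<bar> \<le> M \<Longrightarrow>
      \<bar>asd_a p - asd_a p'\<bar> \<le> Ca * (\<bar>r - r'\<bar> + \<bar>p - p'\<bar> + \<bar>q - q'\<bar>)"
    by (rule blipE[OF blip_asd(1)[OF m, of M]]) (rule that; blast)
  obtain Cb where Cb: "Cb \<ge> 0"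
      "\<And>r p q. r \<in> {m..M} \<Longrightarrow> \<bar>p\<bar> \<le> M \<Longrightarrow> \<bar>q\<bar> \<le> M \<Longrightarrow> \<bar>asd_b r p q\<bar> \<le> Cb"
      "\<And>r p q r' p' q'. r \<in> {m..M} \<Longrightarrow> \<bar>p\<bar> \<le> M \<Longrightarrow> \<bar>q\<bar> \<le> M \<Longrightarrow>
      r' \<in> {m..M} \<Longrightarrow> \<bar>p'\<bar> \<le> M \<Longrightarrow> \<bar>q'\<bar> \<le> M \<Longrightarrow>
      \<bar>asd_b r p q - asd_b r' p' q'\<bar> \<le> Cb * (\<bar>r - r'\<bar> + \<bar>p - p'\<bar> + \<bar>q - q'\<bar>)"
    by (rule blipE[OF blip_asd(2)[OF m, of M]]) (rule that; blast)
  obtain Cc where Cc: "Cc \<ge> 0" "\<And>r p q r' p' q'. r \<in> {m..M} \<Longrightarrow> \<bar>p\<bar> \<le> M \<Longrightarrow> \<bar>q\<bar> \<le> M \<Longrightarrow>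
      r' \<in> {m..M} \<Longrightarrow> \<bar>p'\<bar> \<le> M \<Longrightarrow> \<bar>q'\<bar> \<le> M \<Longrightarrow>
      \<bar>asd_c r p q - asd_c r' p' q'\<bar> \<le> Cc * (\<bar>r - r'\<bar> + \<bar>p - p'\<bar> + \<bar>q - q'\<bar>)"
    by (rule blipE[OF blip_asd(3)[OF m, of M]]) (rule that; blast)
  define N where "N = \<bar>M\<bar>"
  have N0: "N \<ge> 0" by (simp add: N_def)
  define K where "K = C1 + C2 + C3 * N + C4 + C5 * N + Ca * N + Cb * N + Cb + Cc"
  have nn: "0 \<le> C3 * N" "0 \<le> C5 * N" "0 \<le> Ca * N" "0 \<le> Cb * N"
    using C3(1) C5(1) Ca(1) Cb(1) N0 by auto
  have K: "K \<ge> 0" "C1 \<le> K" "C2 + C3 * N \<le> K" "C4 + C5 * N \<le> K" "Ca * N \<le> K" "Cb * N + Cc \<le> K" "Cb \<le> K"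
    using nn C1(1) C2(1) C4(1) Cb(1) Cc(1) by (auto simp: K_def)
  define a0 where "a0 = 1 / (1 + M\<^sup>2)\<^sup>2"
  have a0: "a0 > 0" unfolding a0_def by (intro divide_pos_pos zero_less_power one_plus_square_pos) simp
  define C where "C = (9 * K\<^sup>2 / a0 + 2 * K) + (9 * K\<^sup>2 / a0 + K)\<^sup>2 / a0"
  have "C \<ge> 0" using a0 K(1) by (simp add: C_def)
  thus ?thesis
  proof (rule that)
    fix f h :: "real \<Rightarrow> real" and L \<beta> \<beta>' :: real
    assume f: "f \<in> holder_space 4 \<beta>" and h: "h \<in> holder_space 4 \<beta>'" and L: "L \<ge> 1"
      and rng: "\<And>x. f x \<in> {m..M} \<and> h x \<in> {m..M}"
      and b12: "\<And>j x. j \<in> {1, 2} \<Longrightarrow> \<bar>(deriv ^^ j) f x\<bar> \<le> M \<and> \<bar>(deriv ^^ j) h x\<bar> \<le> M"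
      and b34: "\<And>x. \<bar>(deriv ^^ 3) f x\<bar> \<le> M * L \<and> \<bar>(deriv ^^ 3) h x\<bar> \<le> M * L \<and> \<bar>(deriv ^^ 4) h x\<bar> \<le> M * L\<^sup>2"
    define f1 f2 f3 f4 where F: "f1 = (deriv ^^ 1) f" "f2 = (deriv ^^ 2) f" "f3 = (deriv ^^ 3) f" "f4 = (deriv ^^ 4) f"
    define h1 h2 h3 h4 where H: "h1 = (deriv ^^ 1) h" "h2 = (deriv ^^ 2) h" "h3 = (deriv ^^ 3) h" "h4 = (deriv ^^ 4) h"
    have df: "(f has_real_derivative f1 x) (at x)" "(f1 has_real_derivative f2 x) (at x)"
      "(f2 has_real_derivative f3 x) (at x)" "(f3 has_real_derivative f4 x) (at x)" for x
      using holder_space_has_deriv[OF f, of 0] holder_space_has_deriv[OF f, of 1]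
        holder_space_has_deriv[OF f, of 2] holder_space_has_deriv[OF f, of 3]
      by (simp_all add: F numeral_eq_Suc)
    have dh: "(h has_real_derivative h1 x) (at x)" "(h1 has_real_derivative h2 x) (at x)"
      "(h2 has_real_derivative h3 x) (at x)" "(h3 has_real_derivative h4 x) (at x)" for x
      using holder_space_has_deriv[OF h, of 0] holder_space_has_deriv[OF h, of 1]
        holder_space_has_deriv[OF h, of 2] holder_space_has_deriv[OF h, of 3]
      by (simp_all add: H numeral_eq_Suc)
    have cf: "continuous_on S f" "continuous_on S f1" "continuous_on S f2" "continuous_on S f3" "continuous_on S f4" for S
      using holder_space_continuous[OF f, of 0] holder_space_continuous[OF f, of 1] holder_space_continuous[OF f, of 2]
        holder_space_continuous[OF f, of 3] holder_space_continuous[OF f, of 4] by (simp_all add: F)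
    have ch: "continuous_on S h" "continuous_on S h1" "continuous_on S h2" "continuous_on S h3" "continuous_on S h4" for S
      using holder_space_continuous[OF h, of 0] holder_space_continuous[OF h, of 1] holder_space_continuous[OF h, of 2]
        holder_space_continuous[OF h, of 3] holder_space_continuous[OF h, of 4] by (simp_all add: H)
    have tf: "torus_fun f" "torus_fun f1" "torus_fun f2" "torus_fun f3"
      unfolding F using f by (auto intro: torus_fun_deriv torus_fun_funpow_deriv simp: holder_space_def)
    have th: "torus_fun h" "torus_fun h1" "torus_fun h2" "torus_fun h3"
      unfolding H using h by (auto intro: torus_fun_deriv torus_fun_funpow_deriv simp: holder_space_def)
    have fpos: "f x > 0" "f x \<noteq> 0" and hpos: "h x > 0" "h x \<noteq> 0" for x using rng[of x] m by auto
    have Q: "1 + (f1 x)\<^sup>2 \<noteq> 0" "1 + (h1 x)\<^sup>2 \<noteq> 0" for x by (smt (verit) zero_le_power2)+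
    have bf: "f x \<in> {m..M}" "\<bar>f1 x\<bar> \<le> M" "\<bar>f2 x\<bar> \<le> M" and bh: "h x \<in> {m..M}" "\<bar>h1 x\<bar> \<le> M" "\<bar>h2 x\<bar> \<le> M" for x
      using rng[of x] b12[of 1 x] b12[of 2 x] by (auto simp: F H numeral_2_eq_2)
    have b3: "\<bar>f3 x\<bar> \<le> N * L" "\<bar>h3 x\<bar> \<le> N * L" "\<bar>h4 x\<bar> \<le> N * L\<^sup>2" for x
    proof -
      have "M * L \<le> N * L" "M * L\<^sup>2 \<le> N * L\<^sup>2" using L by (auto intro!: mult_right_mono simp: N_def)
      thus "\<bar>f3 x\<bar> \<le> N * L" "\<bar>h3 x\<bar> \<le> N * L" "\<bar>h4 x\<bar> \<le> N * L\<^sup>2"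
        using b34[of x] by (auto simp: F H)
    qed
    \<comment> \<open>The difference of the right-hand sides is the operator with the coefficients
      of \<open>f\<close> applied to \<open>f - h\<close>, plus coefficient differences times
      derivatives of \<open>h\<close>. Hence only \<open>h\<close> needs a bound on its fourth
      derivative.\<close>
    define g where "g x = - (asd_a (f1 x) - asd_a (h1 x)) * h4 x
        + (asd_b (f x) (f1 x) (f2 x) - asd_b (h x) (h1 x) (h2 x)) * h3 x
        + (asd_c (f x) (f1 x) (f2 x) - asd_c (h x) (h1 x) (h2 x))" for x
    let ?a = "\<lambda>x. asd_a (f1 x)"
    let ?b = "\<lambda>x. asd_b (f x) (f1 x) (f2 x)"
    have split: "asd_rhs f x - asd_rhs h x = - ?a x * (f4 x - h4 x) + ?b x * (f3 x - h3 x) + g x" for x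
      unfolding asd_rhs_quasilinear[OF df fpos(1)] asd_rhs_quasilinear[OF dh hpos(1)] g_def
      by (simp add: algebra_simps)
    have cg: "continuous_on UNIV g"
      unfolding g_def[abs_def] asd_a_def asd_b_def asd_c_def
      by (intro continuous_intros cf ch) (use Q fpos hpos in auto)
    have small: "x \<le> K * L" if "x \<le> C1 + C2 * y" "0 \<le> y" "y \<le> N * L" "0 \<le> C1" "0 \<le> C2" "C1 + C2 * N \<le> K" for x y C1 C2
    proof -
      have "x \<le> C1 * L + C2 * (N * L)"
        using that L mult_left_mono[of y "N * L" C2] mult_left_mono[of 1 L C1] by linarith
      also have "\<dots> = (C1 + C2 * N) * L" by (simp add: algebra_simps)
      also have "\<dots> \<le> K * L" using that L by (intro mult_right_mono) auto
      finally show ?thesis .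
    qed
    have A2: "\<bar>24 * (f1 x)\<^sup>2 * (f2 x)\<^sup>2 / (1 + (f1 x)\<^sup>2) ^ 4 - 4 * (f2 x)\<^sup>2 / (1 + (f1 x)\<^sup>2) ^ 3
        + (- 4 * f1 x / (1 + (f1 x)\<^sup>2) ^ 3) * f3 x\<bar> \<le> K * L" (is "\<bar>?y + ?z * f3 x\<bar> \<le> _") for x
    proof (rule small[of _ C2 C3 "\<bar>f3 x\<bar>"])
      have "\<bar>?y + ?z * f3 x\<bar> \<le> \<bar>?y\<bar> + \<bar>?z\<bar> * \<bar>f3 x\<bar>" by (rule abs_add_mult_le)
      also have "\<dots> \<le> C2 + C3 * \<bar>f3 x\<bar>" by (intro add_mono mult_right_mono C2(2)[OF bf] C3(2)[OF bf]) auto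
      finally show "\<bar>?y + ?z * f3 x\<bar> \<le> C2 + C3 * \<bar>f3 x\<bar>" .
    qed (use b3 C2(1) C3(1) K in auto)
    have B1: "\<bar>10 * (f2 x)\<^sup>2 / (1 + (f1 x)\<^sup>2) ^ 3 - 60 * (f1 x)\<^sup>2 * (f2 x)\<^sup>2 / (1 + (f1 x)\<^sup>2) ^ 4
        - 2 * f2 x / (f x * (1 + (f1 x)\<^sup>2)\<^sup>2) + 2 * (f1 x)\<^sup>2 / ((f x)\<^sup>2 * (1 + (f1 x)\<^sup>2)\<^sup>2)
        + 8 * (f1 x)\<^sup>2 * f2 x / (f x * (1 + (f1 x)\<^sup>2) ^ 3) + (10 * f1 x / (1 + (f1 x)\<^sup>2) ^ 3) * f3 x\<bar> \<le> K * L"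
      (is "\<bar>?y + ?z * f3 x\<bar> \<le> _") for x
    proof (rule small[of _ C4 C5 "\<bar>f3 x\<bar>"])
      have "\<bar>?y + ?z * f3 x\<bar> \<le> \<bar>?y\<bar> + \<bar>?z\<bar> * \<bar>f3 x\<bar>" by (rule abs_add_mult_le)
      also have "\<dots> \<le> C4 + C5 * \<bar>f3 x\<bar>" by (intro add_mono mult_right_mono C4(2)[OF bf] C5(2)[OF bf]) auto
      finally show "\<bar>?y + ?z * f3 x\<bar> \<le> C4 + C5 * \<bar>f3 x\<bar>" .
    qed (use b3 C4(1) C5(1) K in auto)
    have gb: "\<bar>g x\<bar> \<le> K * L\<^sup>2 * \<bar>f1 x - h1 x\<bar> + K * L * (\<bar>f x - h x\<bar> + \<bar>f1 x - h1 x\<bar> + \<bar>f2 x - h2 x\<bar>)" for x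
    proof -
      let ?d = "\<bar>f x - h x\<bar> + \<bar>f1 x - h1 x\<bar> + \<bar>f2 x - h2 x\<bar>"
      \<comment> \<open>Equal dummy values for \<open>r\<close> and \<open>q\<close> leave only the
        slope difference in the Lipschitz bound of \<open>asd_a\<close>: the factor
        \<open>L\<^sup>2\<close> of \<open>h4\<close> may multiply nothing but
        \<open>v1\<close>.\<close>
      have mr: "m \<in> {m..M}" "\<bar>0::real\<bar> \<le> M" using bf(1)[of x] bf(2)[of x] by auto
      have 1: "\<bar>(asd_a (f1 x) - asd_a (h1 x)) * h4 x\<bar> \<le> K * L\<^sup>2 * \<bar>f1 x - h1 x\<bar>"
      proof -
        have "\<bar>(asd_a (f1 x) - asd_a (h1 x)) * h4 x\<bar> \<le> (Ca * \<bar>f1 x - h1 x\<bar>) * (N * L\<^sup>2)"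
          unfolding abs_mult
          using Ca(2)[OF mr(1) bf(2) mr(2) mr(1) bh(2) mr(2), of x x] b3(3)[of x] Ca(1)
          by (intro mult_mono) auto
        also have "\<dots> = (Ca * N) * (L\<^sup>2 * \<bar>f1 x - h1 x\<bar>)" by simp
        also have "\<dots> \<le> K * (L\<^sup>2 * \<bar>f1 x - h1 x\<bar>)" using K by (intro mult_right_mono) auto
        finally show ?thesis by simp
      qed
      have 2: "\<bar>(asd_b (f x) (f1 x) (f2 x) - asd_b (h x) (h1 x) (h2 x)) * h3 x\<bar> \<le> (Cb * N) * L * ?d"
      proof -
        have "\<bar>(asd_b (f x) (f1 x) (f2 x) - asd_b (h x) (h1 x) (h2 x)) * h3 x\<bar> \<le> (Cb * ?d) * (N * L)"
          unfolding abs_mult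
          using Cb(3)[OF bf bh, of x x] b3(2)[of x] Cb(1) by (intro mult_mono) auto
        thus ?thesis by (simp add: algebra_simps)
      qed
      have 3: "\<bar>asd_c (f x) (f1 x) (f2 x) - asd_c (h x) (h1 x) (h2 x)\<bar> \<le> Cc * L * ?d"
      proof -
        have "\<bar>asd_c (f x) (f1 x) (f2 x) - asd_c (h x) (h1 x) (h2 x)\<bar> \<le> Cc * 1 * ?d"
          using Cc(2)[OF bf bh, of x x] by simp
        also have "\<dots> \<le> Cc * L * ?d" using L Cc(1) by (intro mult_right_mono mult_left_mono) auto
        finally show ?thesis .
      qed
      have "(Cb * N) * L * ?d + Cc * L * ?d = (Cb * N + Cc) * L * ?d" by (simp add: algebra_simps)
      also have "\<dots> \<le> K * L * ?d" using K L by (intro mult_right_mono) auto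
      finally have 4: "(Cb * N) * L * ?d + Cc * L * ?d \<le> K * L * ?d" .
      show ?thesis unfolding g_def using 1 2 3 4 by (smt (verit) mult_minus_left)
    qed
    let ?A1 = "\<lambda>x. - 4 * (f1 x * f2 x) / (1 + (f1 x)\<^sup>2) ^ 3"
    let ?A2 = "\<lambda>x. 24 * (f1 x)\<^sup>2 * (f2 x)\<^sup>2 / (1 + (f1 x)\<^sup>2) ^ 4 - 4 * (f2 x)\<^sup>2 / (1 + (f1 x)\<^sup>2) ^ 3
            + (- 4 * f1 x / (1 + (f1 x)\<^sup>2) ^ 3) * f3 x"
    let ?B1 = "\<lambda>x. 10 * (f2 x)\<^sup>2 / (1 + (f1 x)\<^sup>2) ^ 3 - 60 * (f1 x)\<^sup>2 * (f2 x)\<^sup>2 / (1 + (f1 x)\<^sup>2) ^ 4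
            - 2 * f2 x / (f x * (1 + (f1 x)\<^sup>2)\<^sup>2) + 2 * (f1 x)\<^sup>2 / ((f x)\<^sup>2 * (1 + (f1 x)\<^sup>2)\<^sup>2)
            + 8 * (f1 x)\<^sup>2 * f2 x / (f x * (1 + (f1 x)\<^sup>2) ^ 3) + (10 * f1 x / (1 + (f1 x)\<^sup>2) ^ 3) * f3 x"
    have tt: "torus_fun (\<lambda>x. f x - h x)" "torus_fun (\<lambda>x. f1 x - h1 x)" "torus_fun (\<lambda>x. f2 x - h2 x)"
        "torus_fun (\<lambda>x. f3 x - h3 x)" "torus_fun ?a" "torus_fun ?A1"
        "torus_fun ?b"
      using tf th by (simp_all add: torus_fun_def)
    have "integral {-pi..pi} (\<lambda>x. (f x - h x) * (- ?a x * (f4 x - h4 x) + ?b x * (f3 x - h3 x) + g x))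
      \<le> C * L ^ 3 * integral {-pi..pi} (\<lambda>x. (f x - h x)\<^sup>2)"
      unfolding C_def
    proof (rule energy_inequality[OF a0 K(1) L, where v = "\<lambda>x. f x - h x" and ?v1.0 = "\<lambda>x. f1 x - h1 x"
          and ?v2.0 = "\<lambda>x. f2 x - h2 x" and ?v3.0 = "\<lambda>x. f3 x - h3 x" and ?v4.0 = "\<lambda>x. f4 x - h4 x"
          and A = ?a and B = ?b and g = g
          and ?A1.0 = ?A1 and ?A2.0 = ?A2 and ?B1.0 = ?B1])
      show "((\<lambda>x. f x - h x) has_real_derivative f1 x - h1 x) (at x)"
        "((\<lambda>x. f1 x - h1 x) has_real_derivative f2 x - h2 x) (at x)"
        "((\<lambda>x. f2 x - h2 x) has_real_derivative f3 x - h3 x) (at x)"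
        "((\<lambda>x. f3 x - h3 x) has_real_derivative f4 x - h4 x) (at x)" for x
        by (intro DERIV_diff df dh)+
      show "continuous_on UNIV (\<lambda>x. f4 x - h4 x)" by (intro continuous_intros cf ch)
      show "continuous_on UNIV g" by (rule cg)
      show "(?a has_real_derivative ?A1 x) (at x)" for x
        by (rule asd_coefficient_derivatives(1)[OF df(1-3) fpos(2)])
      show "(?A1 has_real_derivative
          ?A2 x) (at x)" for x
        by (rule asd_coefficient_derivatives(2)[OF df(1-3) fpos(2)])
      show "(?b has_real_derivative
          ?B1 x) (at x)" for x
        by (rule asd_coefficient_derivatives(3)[OF df(1-3) fpos(2)])
      show "continuous_on UNIV ?A2"
        by (intro continuous_intros cf ch) (use Q fpos in auto)
      show "continuous_on UNIV ?B1"
        by (intro continuous_intros cf ch) (use Q fpos in auto)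
      show "a0 \<le> ?a x" for x unfolding a0_def by (rule asd_a_lower[OF bf(2)])
      show "\<bar>?A1 x\<bar> \<le> K" for x
        using C1(2)[OF bf, of x x] K(2) by linarith
      show "\<bar>?b x\<bar> \<le> K" for x using Cb(2)[OF bf[of x]] K by linarith
    qed (rule A2 B1 gb tt)+
    thus "integral {-pi..pi} (\<lambda>x. (f x - h x) * (asd_rhs f x - asd_rhs h x))
         \<le> C * L ^ 3 * integral {-pi..pi} (\<lambda>x. (f x - h x)\<^sup>2)"
      unfolding split .
  qed
qed

section \<open>Uniqueness\<close>

lemma nat_floor_4_plus:
  assumes "0 < \<alpha>" "\<alpha> < (1::real)"
  shows "nat \<lfloor>4 + \<alpha>\<rfloor> = 4" "frac (4 + \<alpha>) = \<alpha>" "nat \<lfloor>\<alpha>\<rfloor> = 0" "frac \<alpha> = \<alpha>"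
proof -
  have f0: "\<lfloor>\<alpha>\<rfloor> = 0" using assms by linarith
  have f4: "\<lfloor>4 + \<alpha>\<rfloor> = 4" using assms by linarith
  show "nat \<lfloor>4 + \<alpha>\<rfloor> = 4" "frac (4 + \<alpha>) = \<alpha>" "nat \<lfloor>\<alpha>\<rfloor> = 0" "frac \<alpha> = \<alpha>"
    using f0 f4 by (simp_all add: frac_def)
qed

text \<open>An inequality of Landau type: somewhere in an interval of length \<open>h\<close> the
  value of \<open>f1\<close> is a difference quotient of \<open>f\<close>, and from there
  \<open>f1\<close> changes by at most \<open>h * N\<close>. In its use \<open>f\<close> is a second
  derivative.\<close>

lemma third_derivative_interpolation:
  fixes f :: "real \<Rightarrow> real"
  assumes d: "\<And>x. (f has_real_derivative f1 x) (at x)" "\<And>x. (f1 has_real_derivative f2 x) (at x)"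
    and b: "\<And>x. \<bar>f x\<bar> \<le> M" "\<And>x. \<bar>f2 x\<bar> \<le> N" and h: "h > 0"
  shows "\<bar>f1 x\<bar> \<le> 2 * M / h + h * N"
proof -
  obtain z where z: "x < z" "z < x + h" "f (x + h) - f x = h * f1 z"
    using MVT2[of x "x + h" f f1] d h by auto
  have "f1 z = (f (x + h) - f x) / h" using z h by simp
  hence "\<bar>f1 z\<bar> = \<bar>f (x + h) - f x\<bar> / h" using h by simp
  also have "\<dots> \<le> (2 * M) / h" using b(1)[of x] b(1)[of "x + h"] h by (intro divide_right_mono) auto
  finally have 1: "\<bar>f1 z\<bar> \<le> 2 * M / h" .
  obtain y where y: "f1 z - f1 x = (z - x) * f2 y"
    using MVT2[of x z f1 f2] d z by auto
  have "\<bar>f1 z - f1 x\<bar> = \<bar>z - x\<bar> * \<bar>f2 y\<bar>" using y by (simp add: abs_mult)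
  also have "\<dots> \<le> h * N" using z b(2)[of y] h by (intro mult_mono) auto
  finally show ?thesis using 1 by linarith
qed

lemma continuous_lh_subset: "continuous_lh s S u \<Longrightarrow> T \<subseteq> S \<Longrightarrow> continuous_lh s T u"
  unfolding continuous_lh_def by (meson subsetD tendsto_within_subset)

lemma continuous_lh_bounded:
  assumes u: "continuous_lh s {0..T} u" and j: "j \<le> nat \<lfloor>s\<rfloor>"
  obtains B where "B \<ge> 0" "\<And>t x. t \<in> {0..T} \<Longrightarrow> \<bar>(deriv ^^ j) (u t) x\<bar> \<le> B"
proof -
  have "continuous_on ({0..T} \<times> torus) (\<lambda>(t, x). (deriv ^^ j) (u t) x)"
    by (rule continuous_on_subset[OF continuous_lh_imp_continuous_on[OF u j]]) auto
  hence "compact ((\<lambda>(t, x). (deriv ^^ j) (u t) x) ` ({0..T} \<times> torus))"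
    by (rule compact_continuous_image) (auto simp: torus_def intro!: compact_Times)
  hence "bounded ((\<lambda>(t, x). (deriv ^^ j) (u t) x) ` ({0..T} \<times> torus))" by (rule compact_imp_bounded)
  then obtain B where B: "\<And>t x. t \<in> {0..T} \<Longrightarrow> x \<in> torus \<Longrightarrow> \<bar>(deriv ^^ j) (u t) x\<bar> \<le> B"
    by (force simp: bounded_iff)
  show ?thesis
  proof (rule that[of "\<bar>B\<bar>"])
    fix t x assume t: "t \<in> {0..T}"
    hence "u t \<in> holder_space (nat \<lfloor>s\<rfloor>) (frac s)" using u lh_holder_space unfolding continuous_lh_def by blast
    then obtain y where "y \<in> torus" "(deriv ^^ j) (u t) x = (deriv ^^ j) (u t) y"
      using torus_fun_representative[OF holder_space_torus_fun] by metis
    thus "\<bar>(deriv ^^ j) (u t) x\<bar> \<le> \<bar>B\<bar>" using B[OF t] by fastforce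
  qed simp
qed

lemma continuous_lh_positive_bound:
  assumes u: "continuous_lh s {0..T} u" and T: "0 \<le> T" and pos: "\<And>t x. t \<in> {0..T} \<Longrightarrow> 0 < u t x"
  obtains m where "m > 0" "\<And>t x. t \<in> {0..T} \<Longrightarrow> m \<le> u t x"
proof -
  have "continuous_on ({0..T} \<times> torus) (\<lambda>(t, x). u t x)"
    using continuous_on_subset[OF continuous_lh_imp_continuous_on[OF u, of 0], of "{0..T} \<times> torus"] by auto
  moreover have "compact ({0..T} \<times> torus)" "{0..T} \<times> torus \<noteq> {}"
    using T by (auto simp: torus_def intro!: compact_Times)
  ultimately obtain p where p: "p \<in> {0..T} \<times> torus"
    "\<And>q. q \<in> {0..T} \<times> torus \<Longrightarrow> (\<lambda>(t, x). u t x) p \<le> (\<lambda>(t, x). u t x) q"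
    using continuous_attains_inf by metis
  show ?thesis
  proof (rule that[of "u (fst p) (snd p)"])
    show "0 < u (fst p) (snd p)" using p(1) by (auto intro: pos)
  next
    fix t x assume t: "t \<in> {0..T}"
    hence "u t \<in> holder_space (nat \<lfloor>s\<rfloor>) (frac s)" using u lh_holder_space unfolding continuous_lh_def by blast
    hence "torus_fun (u t)" using holder_space_torus_fun[of "u t" _ _ 0] by auto
    then obtain y where "y \<in> torus" "u t x = u t y" using torus_fun_representative by metis
    thus "u (fst p) (snd p) \<le> u t x" using p(2)[of "(t, y)"] t by (auto simp: case_prod_beta)
  qed
qed

lemma asd_solution_holder_space:
  assumes "asd_solution \<mu> \<alpha> r0 a u" "0 < \<alpha>" "\<alpha> < 1" "0 < t" "ereal t < a"
  shows "u t \<in> holder_space 4 \<alpha>"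
proof -
  have "u t \<in> lh (4 + \<alpha>)"
    using assms unfolding asd_solution_def C_weighted_def continuous_lh_def by blast
  thus ?thesis using lh_holder_space[of "u t" "4 + \<alpha>"] nat_floor_4_plus assms by metis
qed

text \<open>
  The weight \<open>1 - \<mu> \<le> 1/2\<close> gives the rate \<open>t powr (-1/2)\<close> for the fourth derivative, and interpolation
  with the bounded second derivative gives \<open>t powr (-1/4)\<close> for the third one.
\<close>

lemma asd_solution_bounds:
  assumes u: "asd_solution \<mu> \<alpha> r0 a u" and \<alpha>: "0 < \<alpha>" "\<alpha> < 1" and \<mu>: "1/2 \<le> \<mu>" "\<mu> \<le> 1"
    and T: "0 < T" "ereal T < a"
  obtains m M where "m > 0" "M \<ge> 0"
    "\<And>t x. t \<in> {0..T} \<Longrightarrow> u t x \<in> {m..M}"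
    "\<And>t x j. t \<in> {0..T} \<Longrightarrow> j \<in> {1, 2} \<Longrightarrow> \<bar>(deriv ^^ j) (u t) x\<bar> \<le> M"
    "\<And>t x. t \<in> {0<..T} \<Longrightarrow> \<bar>(deriv ^^ 3) (u t) x\<bar> \<le> M * (t / (T + 1)) powr (- 1 / 4)"
    "\<And>t x. t \<in> {0<..T} \<Longrightarrow> \<bar>(deriv ^^ 4) (u t) x\<bar> \<le> M * ((t / (T + 1)) powr (- 1 / 4))\<^sup>2"
proof -
  have sub: "{0..T} \<subseteq> {t. 0 \<le> t \<and> ereal t < a}"
    using T by (auto intro: le_less_trans[of _ "ereal T"])
  have c: "continuous_lh (4 * \<mu> + \<alpha>) {0..T} u"
    using u unfolding asd_solution_def by (auto intro: continuous_lh_subset[OF _ sub])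
  \<comment> \<open>Here \<open>\<mu> \<ge> 1/2\<close> makes two space derivatives continuous,
    hence bounded, up to time 0.\<close>
  have fl: "2 \<le> nat \<lfloor>4 * \<mu> + \<alpha>\<rfloor>" using \<mu> \<alpha> by linarith
  obtain B0 where B0: "B0 \<ge> 0" "\<And>t x. t \<in> {0..T} \<Longrightarrow> \<bar>u t x\<bar> \<le> B0"
    using continuous_lh_bounded[OF c, of 0] by auto
  obtain B1 where B1: "B1 \<ge> 0" "\<And>t x. t \<in> {0..T} \<Longrightarrow> \<bar>(deriv ^^ 1) (u t) x\<bar> \<le> B1"
    by (rule continuous_lh_bounded[OF c, of 1]) (use fl in auto)
  obtain B2 where B2: "B2 \<ge> 0" "\<And>t x. t \<in> {0..T} \<Longrightarrow> \<bar>(deriv ^^ 2) (u t) x\<bar> \<le> B2"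
    by (rule continuous_lh_bounded[OF c, of 2]) (use fl in auto)
  have pos: "0 < u t x" if "t \<in> {0..T}" for t x
    using u that sub unfolding asd_solution_def by auto
  obtain m where m: "m > 0" "\<And>t x. t \<in> {0..T} \<Longrightarrow> m \<le> u t x"
    using continuous_lh_positive_bound[OF c _ pos] T by auto
  have hs: "u t \<in> holder_space 4 \<alpha>" if "t \<in> {0<..T}" for t
    using asd_solution_holder_space[OF u \<alpha>, of t] that subsetD[OF sub, of t] by auto
  have buc: "BUC_weighted \<mu> (4 + \<alpha>) {0..T} u"
    using u T unfolding asd_solution_def C_weighted_def by auto
  \<comment> \<open>Division by \<open>T + 1\<close> keeps the base below 1, so that
    \<open>L \<ge> 1\<close> as the energy estimate demands.\<close>
  define L where "L t = (t / (T + 1)) powr (- 1 / 4)" for t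
  have L2: "(L t)\<^sup>2 = (t / (T + 1)) powr (- 1 / 2)" for t
    unfolding L_def by (cases "t / (T + 1) = 0") (auto simp: powr_power)
  have L1: "L t \<ge> 1" if "t \<in> {0<..T}" for t
  proof -
    have "(t / (T + 1)) powr 0 \<le> (t / (T + 1)) powr (- 1 / 4)"
      using that T by (intro powr_mono') auto
    thus ?thesis using that T by (simp add: L_def)
  qed
  obtain B where B: "B \<ge> 0" "\<And>t x. t \<in> {0<..T} \<Longrightarrow> \<bar>(deriv ^^ 4) (u t) x\<bar> \<le> B * (L t)\<^sup>2"
  proof (cases "\<mu> = 1")
    case True
    hence "\<exists>B. \<forall>t\<in>{0..T}. lh_norm (4 + \<alpha>) (u t) \<le> B"
      using buc unfolding BUC_weighted_def BUC_def by simp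
    then obtain B where B: "\<And>t. t \<in> {0..T} \<Longrightarrow> lh_norm (4 + \<alpha>) (u t) \<le> B" by blast
    show ?thesis
    proof (rule that[of "\<bar>B\<bar>"])
      fix t x assume t: "t \<in> {0<..T}"
      have "\<bar>(deriv ^^ 4) (u t) x\<bar> \<le> holder_norm 4 \<alpha> (u t)"
        by (rule abs_deriv_le_holder_norm[OF hs[OF t]]) simp
      also have "\<dots> \<le> \<bar>B\<bar> * 1" using B[of t] t nat_floor_4_plus[OF \<alpha>] by (auto simp: lh_norm_def)
      also have "\<dots> \<le> \<bar>B\<bar> * (L t)\<^sup>2" using L1[OF t] by (intro mult_left_mono) auto
      finally show "\<bar>(deriv ^^ 4) (u t) x\<bar> \<le> \<bar>B\<bar> * (L t)\<^sup>2" .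
    qed simp
  next
    case False
    hence "\<exists>B. \<forall>t\<in>{0..T} - {0}. lh_norm (4 + \<alpha>) (\<lambda>x. t powr (1 - \<mu>) * u t x) \<le> B"
      using buc unfolding BUC_weighted_def BUC_def by (simp split: if_splits)
    then obtain B where B: "\<And>t. t \<in> {0..T} - {0} \<Longrightarrow> lh_norm (4 + \<alpha>) (\<lambda>x. t powr (1 - \<mu>) * u t x) \<le> B"
      by blast
    show ?thesis
    proof (rule that[of "\<bar>B\<bar>"])
      fix t x assume t: "t \<in> {0<..T}"
      let ?c = "t powr (1 - \<mu>)"
      have c0: "?c > 0" using t by simp
      have "\<bar>(deriv ^^ 4) (\<lambda>x. ?c * u t x + 0 * u t x) x\<bar> \<le> holder_norm 4 \<alpha> (\<lambda>x. ?c * u t x + 0 * u t x)"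
        by (rule abs_deriv_le_holder_norm[OF holder_space_lincomb(1)[OF hs[OF t] hs[OF t]]]) simp
      also have "\<dots> \<le> \<bar>B\<bar>" using B[of t] t nat_floor_4_plus[OF \<alpha>] by (auto simp: lh_norm_def)
      finally have "\<bar>?c * (deriv ^^ 4) (u t) x\<bar> \<le> \<bar>B\<bar>"
        using holder_space_lincomb(2)[OF hs[OF t] hs[OF t], of 4 ?c 0] by simp
      hence "\<bar>(deriv ^^ 4) (u t) x\<bar> \<le> \<bar>B\<bar> / ?c" using c0 by (simp add: abs_mult field_simps)
      also have "\<dots> = \<bar>B\<bar> * t powr (- (1 - \<mu>))" by (simp add: powr_minus divide_inverse del: minus_diff_eq)
      also have "t powr (- (1 - \<mu>)) \<le> (t / (T + 1)) powr (- (1 - \<mu>))"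
        using t T \<mu> by (intro powr_mono2') (auto simp: field_simps)
      also have "\<dots> \<le> (t / (T + 1)) powr (- 1 / 2)"
        using t T \<mu> by (intro powr_mono') auto
      finally show "\<bar>(deriv ^^ 4) (u t) x\<bar> \<le> \<bar>B\<bar> * (L t)\<^sup>2"
        by (simp add: L2 mult_left_mono)
    qed simp
  qed
  define M where "M = B0 + B1 + 2 * B2 + B"
  have d3: "\<bar>(deriv ^^ 3) (u t) x\<bar> \<le> M * L t" if t: "t \<in> {0<..T}" for t x
  proof -
    have L0: "L t > 0" using L1[OF t] by simp
    \<comment> \<open>The step length \<open>h = 1 / L t\<close> balances the two terms; both become
      multiples of \<open>L t\<close>.\<close>
    have "\<bar>(deriv ^^ 3) (u t) x\<bar> \<le> 2 * B2 / (1 / L t) + 1 / L t * (B * (L t)\<^sup>2)"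
    proof (rule third_derivative_interpolation[where f = "(deriv ^^ 2) (u t)" and ?f1.0 = "(deriv ^^ 3) (u t)"
          and ?f2.0 = "(deriv ^^ 4) (u t)"])
      show "((deriv ^^ 2) (u t) has_real_derivative (deriv ^^ 3) (u t) x) (at x)" for x
        using holder_space_has_deriv[OF hs[OF t], of 2] by (simp add: numeral_eq_Suc)
      show "((deriv ^^ 3) (u t) has_real_derivative (deriv ^^ 4) (u t) x) (at x)" for x
        using holder_space_has_deriv[OF hs[OF t], of 3] by (simp add: numeral_eq_Suc)
    qed (use B2 B t L0 in auto)
    also have "\<dots> = (2 * B2 + B) * L t" using L0 by (simp add: field_simps power2_eq_square)
    also have "\<dots> \<le> M * L t" using L0 B0 B1 by (intro mult_right_mono) (auto simp: M_def)
    finally show ?thesis .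
  qed
  show ?thesis
  proof (rule that[of m M])
    show "u t x \<in> {m..M}" if "t \<in> {0..T}" for t x
      using m(2)[OF that, of x] B0(2)[OF that, of x] B0(1) B1(1) B2(1) B(1) by (auto simp: M_def)
    show "\<bar>(deriv ^^ j) (u t) x\<bar> \<le> M" if "t \<in> {0..T}" "j \<in> {1, 2}" for t x j
      using that B1(2)[of t x] B2(2)[of t x] B0(1) B1(1) B2(1) B(1) by (auto simp: M_def)
    show "\<bar>(deriv ^^ 3) (u t) x\<bar> \<le> M * (t / (T + 1)) powr (- 1 / 4)" if "t \<in> {0<..T}" for t x
      using d3[OF that] by (simp add: L_def)
    show "\<bar>(deriv ^^ 4) (u t) x\<bar> \<le> M * ((t / (T + 1)) powr (- 1 / 4))\<^sup>2" if "t \<in> {0<..T}" for t x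
    proof -
      have "\<bar>(deriv ^^ 4) (u t) x\<bar> \<le> B * (L t)\<^sup>2" by (rule B(2)[OF that])
      also have "\<dots> \<le> M * (L t)\<^sup>2" using B0(1) B1(1) B2(1) by (intro mult_right_mono) (auto simp: M_def)
      finally show ?thesis by (simp add: L_def)
    qed
  qed (use m(1) B0(1) B1(1) B2(1) B(1) in \<open>auto simp: M_def\<close>)
qed

subsection \<open>Time derivative of the energy\<close>

text \<open>The derivative \<open>v\<close> is only asserted to exist in the norm of
  \<open>lh \<alpha>\<close>. Identifying it with the pointwise right-hand side makes the difference
  quotients converge uniformly in \<open>x\<close>, which differentiation under the integral
  requires.\<close>

lemma asd_solution_time_derivative:
  assumes u: "asd_solution \<mu> \<alpha> r0 a u" and \<alpha>: "0 < \<alpha>" "\<alpha> < 1" and t: "0 < t" "ereal t < a"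
    and v: "C_weighted \<mu> \<alpha> a v"
      "((\<lambda>\<tau>. lh_norm \<alpha> (\<lambda>x. (u \<tau> x - u t x) / (\<tau> - t) - v t x)) \<longlongrightarrow> 0) (at t)"
  shows "v t = asd_rhs (u t)"
    and "uniform_limit UNIV (\<lambda>\<tau> x. (u \<tau> x - u t x) / (\<tau> - t)) (asd_rhs (u t)) (at t)"
    and "continuous_on S (asd_rhs (u t))"
    and "\<forall>\<^sub>F \<tau> in at t. continuous_on S (u \<tau>)"
proof -
  have hsv: "v t \<in> holder_space 0 \<alpha>"
    using v(1) t lh_holder_space[of "v t" \<alpha>] nat_floor_4_plus[OF \<alpha>]
    unfolding C_weighted_def continuous_lh_def by auto
  have hsu: "u \<tau> \<in> holder_space 0 \<alpha>" if "0 < \<tau>" "ereal \<tau> < a" for \<tau>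
  proof -
    have "u \<tau> \<in> lh \<alpha>"
      using u that unfolding asd_solution_def C1_weighted_def C_weighted_def continuous_lh_def by blast
    thus ?thesis using lh_holder_space[of "u \<tau>" \<alpha>] nat_floor_4_plus[OF \<alpha>] by auto
  qed
  have ev: "\<forall>\<^sub>F \<tau> in at t. 0 < \<tau> \<and> ereal \<tau> < a"
  proof -
    obtain b where b: "t < b" "ereal b \<le> a"
      using t ereal_dense2[of "ereal t" a] by (metis ereal_less_eq(3) less_ereal.simps(1) less_imp_le)
    have "\<forall>\<^sub>F \<tau> in at t. \<tau> \<in> {0<..<b}"
      by (rule eventually_at_in_open') (use t b in auto)
    thus ?thesis by eventually_elim (use b in \<open>auto intro: less_le_trans[of _ "ereal b"]\<close>)
  qed
  have ul: "uniform_limit UNIV (\<lambda>\<tau> x. (u \<tau> x - u t x) / (\<tau> - t)) (v t) (at t)"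
  proof (rule uniform_limitI)
    fix e :: real assume "e > 0"
    have "\<forall>\<^sub>F \<tau> in at t. lh_norm \<alpha> (\<lambda>x. (u \<tau> x - u t x) / (\<tau> - t) - v t x) < e"
      using order_tendstoD(2)[OF v(2) \<open>e > 0\<close>] .
    thus "\<forall>\<^sub>F \<tau> in at t. \<forall>x\<in>UNIV. dist ((u \<tau> x - u t x) / (\<tau> - t)) (v t x) < e"
      using ev
    proof eventually_elim
      case (elim \<tau>)
      let ?q = "\<lambda>x. (1 / (\<tau> - t)) * (1 * u \<tau> x + (- 1) * u t x) + (- 1) * v t x"
      have q: "?q = (\<lambda>x. (u \<tau> x - u t x) / (\<tau> - t) - v t x)" by (simp add: fun_eq_iff)
      have "?q \<in> holder_space 0 \<alpha>"
        by (intro holder_space_lincomb(1) hsu hsv) (use elim t in auto)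
      hence hs: "(\<lambda>x. (u \<tau> x - u t x) / (\<tau> - t) - v t x) \<in> holder_space 0 \<alpha>" unfolding q .
      show ?case
      proof
        fix x
        have "\<bar>(u \<tau> x - u t x) / (\<tau> - t) - v t x\<bar> \<le> lh_norm \<alpha> (\<lambda>x. (u \<tau> x - u t x) / (\<tau> - t) - v t x)"
          using abs_deriv_le_holder_norm[OF hs, of 0 x] nat_floor_4_plus[OF \<alpha>] by (simp add: lh_norm_def)
        thus "dist ((u \<tau> x - u t x) / (\<tau> - t)) (v t x) < e"
          using elim(1) by (simp add: dist_real_def)
      qed
    qed
  qed
  show eq: "v t = asd_rhs (u t)"
  proof
    fix x
    have "((\<lambda>\<tau>. (u \<tau> x - u t x) / (\<tau> - t)) \<longlongrightarrow> v t x) (at t)"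
      by (rule tendsto_uniform_limitI[OF ul]) simp
    moreover have "((\<lambda>\<tau>. (u \<tau> x - u t x) / (\<tau> - t)) \<longlongrightarrow> asd_rhs (u t) x) (at t)"
      using u t unfolding asd_solution_def has_field_derivative_iff by blast
    ultimately show "v t x = asd_rhs (u t) x" by (rule tendsto_unique[rotated]) simp
  qed
  show "uniform_limit UNIV (\<lambda>\<tau> x. (u \<tau> x - u t x) / (\<tau> - t)) (asd_rhs (u t)) (at t)"
    using ul eq by simp
  show "continuous_on S (asd_rhs (u t))"
    using holder_space_continuous[OF hsv, of 0] eq by simp
  show "\<forall>\<^sub>F \<tau> in at t. continuous_on S (u \<tau>)"
    using ev by eventually_elim (use holder_space_continuous[OF hsu, of _ 0] in auto)
qed

lemma asd_solution_uniform_derivative: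
  assumes u: "asd_solution \<mu> \<alpha> r0 a u" and \<alpha>: "0 < \<alpha>" "\<alpha> < 1" and t: "0 < t" "ereal t < a"
  shows "uniform_limit UNIV (\<lambda>\<tau> x. (u \<tau> x - u t x) / (\<tau> - t)) (asd_rhs (u t)) (at t)"
    and "continuous_on S (asd_rhs (u t))"
    and "\<forall>\<^sub>F \<tau> in at t. continuous_on S (u \<tau>)"
proof -
  obtain v where v: "C_weighted \<mu> \<alpha> a v"
    "((\<lambda>\<tau>. lh_norm \<alpha> (\<lambda>x. (u \<tau> x - u t x) / (\<tau> - t) - v t x)) \<longlongrightarrow> 0) (at t)"
    using u t unfolding asd_solution_def C1_weighted_def by blast
  note * = asd_solution_time_derivative[OF u \<alpha> t v]
  show "uniform_limit UNIV (\<lambda>\<tau> x. (u \<tau> x - u t x) / (\<tau> - t)) (asd_rhs (u t)) (at t)"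
    "continuous_on S (asd_rhs (u t))" "\<forall>\<^sub>F \<tau> in at t. continuous_on S (u \<tau>)"
    by (rule *)+
qed

lemma tendsto_integral_uniform:
  fixes f :: "'a \<Rightarrow> real \<Rightarrow> real"
  assumes u: "uniform_limit {a..b} f g F" and c: "\<forall>\<^sub>F n in F. continuous_on {a..b} (f n)"
    and g: "continuous_on {a..b} g" and ab: "a \<le> b"
  shows "((\<lambda>n. integral {a..b} (f n)) \<longlongrightarrow> integral {a..b} g) F"
proof (rule tendstoI)
  fix e :: real assume "e > 0"
  define d where "d = e / (b - a + 1)"
  have d: "d > 0" "d * (b - a) < e" using \<open>e > 0\<close> ab by (auto simp: d_def field_simps)
  have "\<forall>\<^sub>F n in F. \<forall>x\<in>{a..b}. dist (f n x) (g x) < d" by (rule uniform_limitD[OF u d(1)])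
  thus "\<forall>\<^sub>F n in F. dist (integral {a..b} (f n)) (integral {a..b} g) < e"
    using c
  proof eventually_elim
    case (elim n)
    have i: "f n integrable_on {a..b}" "g integrable_on {a..b}"
      using elim g by (auto intro: integrable_continuous_real)
    have "norm (integral {a..b} (\<lambda>x. f n x - g x)) \<le> d * (b - a)"
      by (rule integral_bound[OF ab]) (use elim g in \<open>auto intro!: continuous_intros simp: dist_real_def less_imp_le\<close>)
    thus ?case using d i by (simp add: dist_real_def integral_diff)
  qed
qed

lemma energy_has_derivative:
  assumes u: "asd_solution \<mu> \<alpha> r0 a u" and w: "asd_solution \<mu> \<alpha> r0' b w"
    and \<alpha>: "0 < \<alpha>" "\<alpha> < 1" and t: "0 < t" "ereal t < a" "ereal t < b"
  shows "((\<lambda>\<tau>. integral {-pi..pi} (\<lambda>x. (u \<tau> x - w \<tau> x)\<^sup>2)) has_real_derivative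
     2 * integral {-pi..pi} (\<lambda>x. (u t x - w t x) * (asd_rhs (u t) x - asd_rhs (w t) x))) (at t)"
proof -
  let ?I = "{-pi..pi}"
  define D where "D x = asd_rhs (u t) x - asd_rhs (w t) x" for x
  define V where "V \<tau> x = u \<tau> x - w \<tau> x" for \<tau> x
  define q where "q \<tau> x = (V \<tau> x - V t x) / (\<tau> - t)" for \<tau> x
  note U = asd_solution_uniform_derivative[OF u \<alpha> t(1,2)]
  note W = asd_solution_uniform_derivative[OF w \<alpha> t(1,3)]
  have cD: "continuous_on ?I D" unfolding D_def by (intro continuous_intros U(2) W(2))
  have ct: "continuous_on ?I (u t)" "continuous_on ?I (w t)"
    using holder_space_continuous[OF asd_solution_holder_space[OF u \<alpha> t(1,2)], of 0]
      holder_space_continuous[OF asd_solution_holder_space[OF w \<alpha> t(1,3)], of 0] by auto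
  have cV: "continuous_on ?I (V t)" unfolding V_def by (intro continuous_intros ct)
  have ev: "\<forall>\<^sub>F \<tau> in at t. continuous_on ?I (V \<tau>)"
    using U(3)[of ?I] W(3)[of ?I] by eventually_elim (auto simp: V_def intro!: continuous_intros)
  have bdd: "bounded (f ` ?I)" if "continuous_on ?I f" for f :: "real \<Rightarrow> real"
    by (rule compact_imp_bounded[OF compact_continuous_image[OF that]]) simp
  have ulq: "uniform_limit ?I q D (at t)"
  proof -
    have "uniform_limit ?I (\<lambda>\<tau> x. (u \<tau> x - u t x) / (\<tau> - t) - (w \<tau> x - w t x) / (\<tau> - t)) D (at t)"
      unfolding D_def
      by (intro uniform_limit_intros uniform_limit_on_subset[OF U(1)] uniform_limit_on_subset[OF W(1)]) auto
    moreover have "(\<lambda>\<tau> x. (u \<tau> x - u t x) / (\<tau> - t) - (w \<tau> x - w t x) / (\<tau> - t)) = q"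
      by (auto simp: fun_eq_iff q_def V_def diff_divide_distrib)
    ultimately show ?thesis by simp
  qed
  have ulh: "uniform_limit ?I (\<lambda>\<tau> x. (\<tau> - t) :: real) (\<lambda>x. 0) (at t)"
  proof (rule uniform_limitI)
    fix e :: real assume e: "e > 0"
    have "((\<lambda>\<tau>. \<tau> - t) \<longlongrightarrow> 0) (at t)" by (auto intro!: tendsto_eq_intros)
    from tendstoD[OF this e] show "\<forall>\<^sub>F \<tau> in at t. \<forall>x\<in>?I. dist (\<tau> - t) 0 < e" by eventually_elim auto
  qed
  \<comment> \<open>The expression is the difference quotient of the square of \<open>V\<close>,
    written so that every factor has a uniform limit.\<close>
  have "uniform_limit ?I (\<lambda>\<tau> x. q \<tau> x * (2 * V t x + (\<tau> - t) * q \<tau> x)) (\<lambda>x. D x * (2 * V t x + 0 * D x)) (at t)"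
    by (intro uniform_lim_mult uniform_limit_intros ulq ulh bdd continuous_intros cD cV)
  hence ul: "uniform_limit ?I (\<lambda>\<tau> x. q \<tau> x * (2 * V t x + (\<tau> - t) * q \<tau> x)) (\<lambda>x. 2 * (V t x * D x)) (at t)"
    by (simp add: mult_ac)
  have "((\<lambda>\<tau>. integral ?I (\<lambda>x. q \<tau> x * (2 * V t x + (\<tau> - t) * q \<tau> x))) \<longlongrightarrow> integral ?I (\<lambda>x. 2 * (V t x * D x))) (at t)"
  proof (rule tendsto_integral_uniform[OF ul])
    show "\<forall>\<^sub>F \<tau> in at t. continuous_on ?I (\<lambda>x. q \<tau> x * (2 * V t x + (\<tau> - t) * q \<tau> x))"
      using ev
    proof eventually_elim
      case (elim \<tau>)
      have "continuous_on ?I (q \<tau>)" unfolding q_def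
        by (cases "\<tau> = t") (auto intro!: continuous_intros elim cV)
      thus ?case by (intro continuous_intros cV)
    qed
    show "continuous_on ?I (\<lambda>x. 2 * (V t x * D x))" by (intro continuous_intros cV cD)
  qed simp
  moreover have "\<forall>\<^sub>F \<tau> in at t. integral ?I (\<lambda>x. q \<tau> x * (2 * V t x + (\<tau> - t) * q \<tau> x)) =
      (integral ?I (\<lambda>x. (V \<tau> x)\<^sup>2) - integral ?I (\<lambda>x. (V t x)\<^sup>2)) / (\<tau> - t)"
    using ev eventually_neq_at_within[of t t UNIV]
  proof eventually_elim
    case (elim \<tau>)
    have i: "(\<lambda>x. (V \<tau> x)\<^sup>2) integrable_on ?I" "(\<lambda>x. (V t x)\<^sup>2) integrable_on ?I"
      by (intro integrable_continuous_real continuous_intros elim(1) cV)+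
    have qq: "q \<tau> x * (2 * V t x + (\<tau> - t) * q \<tau> x) = inverse (\<tau> - t) * ((V \<tau> x)\<^sup>2 - (V t x)\<^sup>2)" for x
    proof -
      have "(\<tau> - t) * q \<tau> x = V \<tau> x - V t x" using elim by (simp add: q_def)
      hence "q \<tau> x * (2 * V t x + (\<tau> - t) * q \<tau> x) = q \<tau> x * (V \<tau> x + V t x)" by simp
      also have "\<dots> = inverse (\<tau> - t) * ((V \<tau> x - V t x) * (V \<tau> x + V t x))"
        unfolding q_def by (simp add: divide_inverse mult_ac)
      finally show ?thesis by (simp add: power2_eq_square algebra_simps)
    qed
    have "integral ?I (\<lambda>x. q \<tau> x * (2 * V t x + (\<tau> - t) * q \<tau> x))
        = inverse (\<tau> - t) * integral ?I (\<lambda>x. (V \<tau> x)\<^sup>2 - (V t x)\<^sup>2)" unfolding qq by simp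
    thus ?case using integral_diff[OF i] by (simp add: divide_inverse)
  qed
  ultimately have "((\<lambda>\<tau>. (integral ?I (\<lambda>x. (V \<tau> x)\<^sup>2) - integral ?I (\<lambda>x. (V t x)\<^sup>2)) / (\<tau> - t))
      \<longlongrightarrow> integral ?I (\<lambda>x. 2 * (V t x * D x))) (at t)"
    by (rule Lim_transform_eventually)
  thus ?thesis unfolding has_field_derivative_iff V_def D_def by simp
qed

text \<open>The equation holds at positive times only, so the initial value of the energy has to
  come from continuity: the norm of \<open>lh (4 * \<mu> + \<alpha>)\<close> dominates the distance
  of both solutions to \<open>r0\<close> uniformly.\<close>

lemma energy_tendsto_0:
  assumes u: "asd_solution \<mu> \<alpha> r0 a u" and w: "asd_solution \<mu> \<alpha> r0 b w"
  shows "((\<lambda>\<tau>. integral {-pi..pi} (\<lambda>x. (u \<tau> x - w \<tau> x)\<^sup>2)) \<longlongrightarrow> 0) (at_right 0)"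
proof -
  let ?s = "4 * \<mu> + \<alpha>"
  define n :: "(real \<Rightarrow> real \<Rightarrow> real) \<Rightarrow> real \<Rightarrow> real" where "n u \<tau> = lh_norm ?s (\<lambda>x. u \<tau> x - r0 x)" for u \<tau>
  have *: "(n u \<longlongrightarrow> 0) (at_right 0) \<and> (\<forall>\<^sub>F \<tau> in at_right 0. (\<forall>x. \<bar>u \<tau> x - r0 x\<bar> \<le> n u \<tau>) \<and> continuous_on UNIV (u \<tau>))"
    if u: "asd_solution \<mu> \<alpha> r0 a u" for u a
  proof -
    have a: "0 < a" and c: "continuous_lh ?s {t. 0 \<le> t \<and> ereal t < a} u" and u0: "u 0 = r0"
      using u unfolding asd_solution_def by auto
    obtain T where T: "0 < T" "ereal T < a"
      using ereal_dense2[OF a] by (auto simp: zero_ereal_def)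
    have c': "continuous_lh ?s {0..T} u"
      by (rule continuous_lh_subset[OF c]) (use T in \<open>auto intro: le_less_trans[of _ "ereal T"]\<close>)
    have hs: "u t \<in> holder_space (nat \<lfloor>?s\<rfloor>) (frac ?s)" if "t \<in> {0..T}" for t
      using c' that lh_holder_space unfolding continuous_lh_def by blast
    have "(n u \<longlongrightarrow> 0) (at 0 within {0..T})"
      using c' T u0 unfolding continuous_lh_def n_def by auto
    hence "(n u \<longlongrightarrow> 0) (at_right 0)"
      using T by (simp add: at_within_Icc_at_right)
    moreover have "\<forall>\<^sub>F \<tau> in at_right 0. \<tau> \<in> {0<..<T}" using T by (intro eventually_at_right_real)
    hence "\<forall>\<^sub>F \<tau> in at_right 0. (\<forall>x. \<bar>u \<tau> x - r0 x\<bar> \<le> n u \<tau>) \<and> continuous_on UNIV (u \<tau>)"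
    proof eventually_elim
      case (elim \<tau>)
      have h: "u \<tau> \<in> holder_space (nat \<lfloor>?s\<rfloor>) (frac ?s)" "r0 \<in> holder_space (nat \<lfloor>?s\<rfloor>) (frac ?s)"
        using hs[of \<tau>] hs[of 0] elim T u0 by auto
      show ?case
        using abs_deriv_le_holder_norm[OF holder_space_diff(1)[OF h], of 0] holder_space_continuous[OF h(1), of 0]
        by (simp add: n_def lh_norm_def)
    qed
    ultimately show ?thesis by blast
  qed
  have "((\<lambda>\<tau>. 2 * pi * (n u \<tau> + n w \<tau>)\<^sup>2) \<longlongrightarrow> 2 * pi * (0 + 0)\<^sup>2) (at_right 0)"
    using *[OF u] *[OF w] by (intro tendsto_intros) auto
  hence lim: "((\<lambda>\<tau>. 2 * pi * (n u \<tau> + n w \<tau>)\<^sup>2) \<longlongrightarrow> 0) (at_right 0)" by simp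
  show ?thesis
  proof (rule Lim_null_comparison[OF _ lim])
    have "\<forall>\<^sub>F \<tau> in at_right 0. (\<forall>x. \<bar>u \<tau> x - r0 x\<bar> \<le> n u \<tau>) \<and> continuous_on UNIV (u \<tau>)" using *[OF u] by blast
    moreover have "\<forall>\<^sub>F \<tau> in at_right 0. (\<forall>x. \<bar>w \<tau> x - r0 x\<bar> \<le> n w \<tau>) \<and> continuous_on UNIV (w \<tau>)" using *[OF w] by blast
    ultimately show "\<forall>\<^sub>F \<tau> in at_right 0. norm (integral {-pi..pi} (\<lambda>x. (u \<tau> x - w \<tau> x)\<^sup>2)) \<le> 2 * pi * (n u \<tau> + n w \<tau>)\<^sup>2"
    proof eventually_elim
      case (elim \<tau>)
      have c: "continuous_on {-pi..pi} (u \<tau>)" "continuous_on {-pi..pi} (w \<tau>)"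
        using elim by (auto intro: continuous_on_subset)
      have "norm (integral {-pi..pi} (\<lambda>x. (u \<tau> x - w \<tau> x)\<^sup>2)) \<le> (n u \<tau> + n w \<tau>)\<^sup>2 * (pi - (-pi))"
      proof (rule integral_bound)
        fix x
        have "\<bar>u \<tau> x - w \<tau> x\<bar> \<le> n u \<tau> + n w \<tau>"
          using elim(1)[THEN conjunct1, THEN spec, of x] elim(2)[THEN conjunct1, THEN spec, of x] by linarith
        thus "norm ((u \<tau> x - w \<tau> x)\<^sup>2) \<le> (n u \<tau> + n w \<tau>)\<^sup>2"
          using power_mono[of "\<bar>u \<tau> x - w \<tau> x\<bar>" _ 2] by simp
      qed (auto intro!: continuous_intros c)
      thus ?case by (simp add: algebra_simps)
    qed
  qed
qed

text \<open>A Gronwall argument with a singular weight: multiplied by \<open>exp (- P s)\<close> the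
  energy is nonincreasing for \<open>s > 0\<close>, and since it tends to 0 at time 0 it cannot be
  positive later.\<close>

lemma asd_solution_unique:
  assumes u: "asd_solution \<mu> \<alpha> r0 a u" and w: "asd_solution \<mu> \<alpha> r0 b w"
    and \<alpha>: "0 < \<alpha>" "\<alpha> < 1" and \<mu>: "1/2 \<le> \<mu>" "\<mu> \<le> 1"
    and t: "0 \<le> t" "ereal t < a" "ereal t < b"
  shows "u t = w t"
proof (cases "t = 0")
  case True
  then show ?thesis using u w by (simp add: asd_solution_def)
next
  case False
  hence t0: "0 < t" using t by simp
  define S where "S = t + 1"
  have S: "S > 0" using t0 by (simp add: S_def)
  obtain m1 M1 where b1: "m1 > 0" "M1 \<ge> 0"
    "\<And>s x. s \<in> {0..t} \<Longrightarrow> u s x \<in> {m1..M1}"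
    "\<And>s x j. s \<in> {0..t} \<Longrightarrow> j \<in> {1, 2} \<Longrightarrow> \<bar>(deriv ^^ j) (u s) x\<bar> \<le> M1"
    "\<And>s x. s \<in> {0<..t} \<Longrightarrow> \<bar>(deriv ^^ 3) (u s) x\<bar> \<le> M1 * (s / S) powr (- 1 / 4)"
    "\<And>s x. s \<in> {0<..t} \<Longrightarrow> \<bar>(deriv ^^ 4) (u s) x\<bar> \<le> M1 * ((s / S) powr (- 1 / 4))\<^sup>2"
    unfolding S_def by (rule asd_solution_bounds[OF u \<alpha> \<mu> t0 t(2)]) blast
  obtain m2 M2 where b2: "m2 > 0" "M2 \<ge> 0"
    "\<And>s x. s \<in> {0..t} \<Longrightarrow> w s x \<in> {m2..M2}"
    "\<And>s x j. s \<in> {0..t} \<Longrightarrow> j \<in> {1, 2} \<Longrightarrow> \<bar>(deriv ^^ j) (w s) x\<bar> \<le> M2"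
    "\<And>s x. s \<in> {0<..t} \<Longrightarrow> \<bar>(deriv ^^ 3) (w s) x\<bar> \<le> M2 * (s / S) powr (- 1 / 4)"
    "\<And>s x. s \<in> {0<..t} \<Longrightarrow> \<bar>(deriv ^^ 4) (w s) x\<bar> \<le> M2 * ((s / S) powr (- 1 / 4))\<^sup>2"
    unfolding S_def by (rule asd_solution_bounds[OF w \<alpha> \<mu> t0 t(3)]) blast
  define m where "m = min m1 m2"
  define M where "M = M1 + M2"
  define L where "L s = (s / S) powr (- 1 / 4)" for s
  define E where "E s = integral {-pi..pi} (\<lambda>x. (u s x - w s x)\<^sup>2)" for s
  have m: "m > 0" using b1 b2 by (simp add: m_def)
  obtain C where C: "C \<ge> 0"
    "\<And>f h L \<beta> \<beta>'. f \<in> holder_space 4 \<beta> \<Longrightarrow> h \<in> holder_space 4 \<beta>' \<Longrightarrow> L \<ge> 1 \<Longrightarrow>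
       (\<And>x. f x \<in> {m..M} \<and> h x \<in> {m..M}) \<Longrightarrow>
       (\<And>j x. j \<in> {1, 2} \<Longrightarrow> \<bar>(deriv ^^ j) f x\<bar> \<le> M \<and> \<bar>(deriv ^^ j) h x\<bar> \<le> M) \<Longrightarrow>
       (\<And>x. \<bar>(deriv ^^ 3) f x\<bar> \<le> M * L \<and> \<bar>(deriv ^^ 3) h x\<bar> \<le> M * L \<and> \<bar>(deriv ^^ 4) h x\<bar> \<le> M * L\<^sup>2) \<Longrightarrow>
       integral {-pi..pi} (\<lambda>x. (f x - h x) * (asd_rhs f x - asd_rhs h x))
         \<le> C * L ^ 3 * integral {-pi..pi} (\<lambda>x. (f x - h x)\<^sup>2)"
    by (rule asd_energy[OF m]) (rule that; blast)
  have dom: "0 < s" "ereal s < a" "ereal s < b" if "s \<in> {0<..t}" for s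
    using that t by (auto intro: le_less_trans[of _ "ereal t"])
  have hsu: "u s \<in> holder_space 4 \<alpha>" and hsw: "w s \<in> holder_space 4 \<alpha>" if "s \<in> {0<..t}" for s
    using asd_solution_holder_space[OF u \<alpha>] asd_solution_holder_space[OF w \<alpha>] dom[OF that] by auto
  have L1: "L s \<ge> 1" if "s \<in> {0<..t}" for s
  proof -
    have "(s / S) powr 0 \<le> (s / S) powr (- 1 / 4)"
      using that S by (intro powr_mono') (auto simp: S_def)
    thus ?thesis using that S by (simp add: L_def)
  qed
  have E_nonneg: "E s \<ge> 0" for s     unfolding E_def by (cases "(\<lambda>x. (u s x - w s x)\<^sup>2) integrable_on {-pi..pi}")
      (auto intro: integral_nonneg simp: not_integrable_integral)
  define D where "D s = 2 * integral {-pi..pi} (\<lambda>x. (u s x - w s x) * (asd_rhs (u s) x - asd_rhs (w s) x))" for s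
  have dE: "(E has_real_derivative D s) (at s)" if "s \<in> {0<..t}" for s
    unfolding E_def[abs_def] D_def by (rule energy_has_derivative[OF u w \<alpha> dom[OF that]])
  have D_le: "D s \<le> 2 * (C * L s ^ 3 * E s)" if s: "s \<in> {0<..t}" for s
  proof -
    have s': "s \<in> {0..t}" using s by auto
    have L0: "L s \<ge> 0" using L1[OF s] by simp
    have M12: "M1 \<le> M" "M2 \<le> M" using b1 b2 by (auto simp: M_def)
    have "integral {-pi..pi} (\<lambda>x. (u s x - w s x) * (asd_rhs (u s) x - asd_rhs (w s) x)) \<le> C * L s ^ 3 * E s"
      unfolding E_def
    proof (rule C(2)[OF hsu[OF s] hsw[OF s] L1[OF s]])
      show "u s x \<in> {m..M} \<and> w s x \<in> {m..M}" for x
        using b1(3)[OF s', of x] b2(3)[OF s', of x] M12 by (auto simp: m_def)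
      show "\<bar>(deriv ^^ j) (u s) x\<bar> \<le> M \<and> \<bar>(deriv ^^ j) (w s) x\<bar> \<le> M" if "j \<in> {1, 2}" for j x
        using b1(4)[OF s' that, of x] b2(4)[OF s' that, of x] M12 by linarith
      show "\<bar>(deriv ^^ 3) (u s) x\<bar> \<le> M * L s \<and> \<bar>(deriv ^^ 3) (w s) x\<bar> \<le> M * L s \<and> \<bar>(deriv ^^ 4) (w s) x\<bar> \<le> M * (L s)\<^sup>2" for x
        using b1(5)[OF s, of x] b2(5)[OF s, of x] b2(6)[OF s, of x] L0
          mult_right_mono[OF M12(1), of "L s"] mult_right_mono[OF M12(2), of "L s"]
          mult_right_mono[OF M12(2), of "(L s)\<^sup>2"]
        unfolding L_def[symmetric] by auto
    qed
    thus ?thesis by (simp add: D_def)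
  qed
  \<comment> \<open>A primitive of \<open>2 * C * L s ^ 3\<close>, the 8 compensating the exponent
    1/4. That it exists down to \<open>s = 0\<close> expresses the integrability of the weight; its
    nonnegativity gives \<open>G s \<le> E s\<close>.\<close>
  define P where "P s = 8 * C * S * (s / S) powr (1 / 4)" for s
  define G where "G s = E s * exp (- P s)" for s
  have L3: "L s ^ 3 = (s / S) powr (- 3 / 4)" if "s > 0" for s
    unfolding L_def using that S by (simp add: powr_power)
  have dP: "(P has_real_derivative 2 * C * L s ^ 3) (at s)" if s: "s > 0" for s
  proof -
    have "((\<lambda>s. (s / S) powr (1 / 4)) has_real_derivative (1 / 4) * (s / S) powr (1 / 4 - 1) * (1 / S)) (at s)"
      using s S by (auto intro!: derivative_eq_intros)
    hence "(P has_real_derivative 8 * C * S * ((1 / 4) * (s / S) powr (1 / 4 - 1) * (1 / S))) (at s)"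
      unfolding P_def[abs_def] by (rule DERIV_cmult)
    moreover have "8 * C * S * ((1 / 4) * (s / S) powr (1 / 4 - 1) * (1 / S)) = 2 * C * L s ^ 3"
      unfolding L3[OF s] using S by simp
    ultimately show ?thesis by simp
  qed
  have dG: "(G has_real_derivative (D s - E s * (2 * C * L s ^ 3)) * exp (- P s)) (at s)" if "s \<in> {0<..t}" for s
    unfolding G_def[abs_def] using that
    by (auto intro!: derivative_eq_intros dE dP simp: algebra_simps)
  have G_mono: "G t \<le> G s" if s: "s \<in> {0<..t}" for s
  proof (rule DERIV_nonpos_imp_nonincreasing[of s t G])
    fix y assume "s \<le> y" "y \<le> t"
    hence y: "y \<in> {0<..t}" using s by auto
    have "(D y - E y * (2 * C * L y ^ 3)) * exp (- P y) \<le> 0"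
      using D_le[OF y] by (intro mult_nonpos_nonneg) (auto simp: mult_ac)
    thus "\<exists>d. (G has_real_derivative d) (at y) \<and> d \<le> 0" using dG[OF y] by blast
  qed (use s in auto)
  have G_le: "G t \<le> E s" if s: "s \<in> {0<..t}" for s
  proof -
    have "P s \<ge> 0" using C(1) S by (simp add: P_def)
    hence "G s \<le> E s * 1" unfolding G_def using E_nonneg by (intro mult_left_mono) auto
    thus ?thesis using G_mono[OF s] by simp
  qed
  have "G t \<le> 0"
  proof (rule tendsto_lowerbound)
    show "(E \<longlongrightarrow> 0) (at_right 0)" unfolding E_def[abs_def] by (rule energy_tendsto_0[OF u w])
    have "\<forall>\<^sub>F s in at_right 0. s \<in> {0<..<t}" using t0 by (intro eventually_at_right_real)
    thus "\<forall>\<^sub>F s in at_right 0. G t \<le> E s" by eventually_elim (auto intro: G_le)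
  qed auto
  hence "E t \<le> 0" unfolding G_def by (simp add: mult_le_0_iff)
  hence E0: "integral {-pi..pi} (\<lambda>x. (u t x - w t x)\<^sup>2) = 0" using E_nonneg[of t] unfolding E_def by linarith
  have tt: "t \<in> {0<..t}" using t0 by simp
  have c: "continuous_on {-pi..pi} (u t)" "continuous_on {-pi..pi} (w t)"
    using holder_space_continuous[OF hsu[OF tt], of 0] holder_space_continuous[OF hsw[OF tt], of 0] by auto
  have "continuous_on {-pi..pi} (\<lambda>x. (u t x - w t x)\<^sup>2)" by (intro continuous_intros c)
  hence z: "u t x = w t x" if "x \<in> {-pi..pi}" for x
    using integral_eq_0_iff[of "-pi" pi "\<lambda>x. (u t x - w t x)\<^sup>2"] E0 that by auto
  show ?thesis
  proof
    fix x
    have "torus_fun (\<lambda>x. u t x - w t x)"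
      using holder_space_torus_fun[OF hsu[OF tt], of 0] holder_space_torus_fun[OF hsw[OF tt], of 0]
      by (auto simp: torus_fun_def)
    then obtain y where "y \<in> torus" "u t x - w t x = u t y - w t y"
      using torus_fun_representative by blast
    thus "u t x = w t x" using z[of y] by (simp add: torus_def)
  qed
qed

section \<open>The maximal solution\<close>

lemma continuous_lh_local:
  assumes "\<And>t. t \<in> S \<Longrightarrow> \<exists>N w. open N \<and> t \<in> N \<and> continuous_lh s (S \<inter> N) w \<and> (\<forall>\<tau>\<in>S \<inter> N. u \<tau> = w \<tau>)"
  shows "continuous_lh s S u"
  unfolding continuous_lh_def
proof
  fix t assume t: "t \<in> S"
  then obtain N w where N: "open N" "t \<in> N" "continuous_lh s (S \<inter> N) w" "\<And>\<tau>. \<tau> \<in> S \<inter> N \<Longrightarrow> u \<tau> = w \<tau>"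
    using assms by metis
  have w: "w t \<in> lh s" "((\<lambda>\<tau>. lh_norm s (\<lambda>x. w \<tau> x - w t x)) \<longlongrightarrow> 0) (at t within S \<inter> N)"
    using N t unfolding continuous_lh_def by auto
  have "at t within S \<inter> N = at t within S"
    by (rule at_within_nhd[of t N]) (use N in auto)
  with w have lim: "((\<lambda>\<tau>. lh_norm s (\<lambda>x. w \<tau> x - w t x)) \<longlongrightarrow> 0) (at t within S)" by simp
  have "\<forall>\<^sub>F \<tau> in at t within S. \<tau> \<in> S \<inter> N"
    using eventually_nhds_in_open[OF N(1,2)] by (auto simp: eventually_at_filter elim: eventually_mono)
  hence "\<forall>\<^sub>F \<tau> in at t within S. lh_norm s (\<lambda>x. w \<tau> x - w t x) = lh_norm s (\<lambda>x. u \<tau> x - u t x)"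
    by eventually_elim (use N(4) t N(2) in auto)
  from Lim_transform_eventually[OF lim this]
  show "u t \<in> lh s \<and> ((\<lambda>\<tau>. lh_norm s (\<lambda>x. u \<tau> x - u t x)) \<longlongrightarrow> 0) (at t within S)"
    using w(1) N(2,4) t by auto
qed

lemma continuous_lh_cong:
  assumes "\<And>t. t \<in> S \<Longrightarrow> u t = w t"
  shows "continuous_lh s S u \<longleftrightarrow> continuous_lh s S w"
  using continuous_lh_local[of S s u] continuous_lh_local[of S s w] assms
  by (metis IntD1 UNIV_I inf_top.right_neutral open_UNIV)

lemma BUC_cong:
  assumes "\<And>t. t \<in> S \<Longrightarrow> u t = w t"
  shows "BUC s S u \<longleftrightarrow> BUC s S w"
  unfolding BUC_def using assms by simp

text \<open>For \<open>\<mu> < 1\<close> agreement at time 0 must not be demanded, because there the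
  time derivatives of two solutions may have unrelated values.\<close>

lemma BUC_weighted_cong:
  assumes "\<And>t. t \<in> J \<Longrightarrow> t \<noteq> 0 \<or> \<mu> = 1 \<Longrightarrow> u t = w t"
  shows "BUC_weighted \<mu> s J u \<longleftrightarrow> BUC_weighted \<mu> s J w"
proof (cases "\<mu> = 1")
  case True
  then show ?thesis using assms BUC_cong[of J u w] by (simp add: BUC_weighted_def)
next
  case False
  have e: "u t = w t" if "t \<in> J - {0}" for t using assms that by auto
  have "((\<lambda>t. t powr (1 - \<mu>) * lh_norm s (u t)) \<longlongrightarrow> 0) (at 0 within (J - {0})) \<longleftrightarrow>
      ((\<lambda>t. t powr (1 - \<mu>) * lh_norm s (w t)) \<longlongrightarrow> 0) (at 0 within (J - {0}))"
    by (rule tendsto_cong) (auto simp: eventually_at_filter e)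
  moreover have "BUC s (J - {0}) (\<lambda>t x. t powr (1 - \<mu>) * u t x) \<longleftrightarrow> BUC s (J - {0}) (\<lambda>t x. t powr (1 - \<mu>) * w t x)"
    by (rule BUC_cong) (simp add: e)
  moreover have "continuous_lh s (J - {0}) u \<longleftrightarrow> continuous_lh s (J - {0}) w"
    by (rule continuous_lh_cong) (rule e)
  ultimately show ?thesis using False by (simp add: BUC_weighted_def)
qed

text \<open>Both parts of \<open>C_weighted\<close> concern compact intervals or small
  neighbourhoods, so it suffices that each \<open>T < a\<close> is covered by some shorter interval;
  the supremum of the existence times need not be attained.\<close>

lemma C_weighted_exhaust:
  assumes "\<And>T. 0 < T \<Longrightarrow> ereal T < a \<Longrightarrow> \<exists>b w. ereal T < b \<and> b \<le> a \<and> C_weighted \<mu> s b w \<and>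
     (\<forall>t\<ge>0. ereal t < b \<longrightarrow> t \<noteq> 0 \<or> \<mu> = 1 \<longrightarrow> u t = w t)"
  shows "C_weighted \<mu> s a u"
  unfolding C_weighted_def
proof (intro conjI allI impI)
  show "continuous_lh s {t. 0 < t \<and> ereal t < a} u"
  proof (rule continuous_lh_local)
    fix t assume t: "t \<in> {t. 0 < t \<and> ereal t < a}"
    then obtain b w where b: "ereal t < b" "b \<le> a" "C_weighted \<mu> s b w"
      "\<forall>t\<ge>0. ereal t < b \<longrightarrow> t \<noteq> 0 \<or> \<mu> = 1 \<longrightarrow> u t = w t"
      using assms[of t] by blast
    obtain c where c: "t < c" "ereal c \<le> b"
      using ereal_dense2[OF b(1)] by (auto dest: less_imp_le)
    have sub: "{t. 0 < t \<and> ereal t < a} \<inter> {..<c} \<subseteq> {t. 0 < t \<and> ereal t < b}"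
      using c by (auto intro: less_le_trans[of _ "ereal c"])
    have "continuous_lh s ({t. 0 < t \<and> ereal t < a} \<inter> {..<c}) w"
      using b(3) unfolding C_weighted_def by (auto intro: continuous_lh_subset[OF _ sub])
    moreover have "\<forall>\<tau>\<in>{t. 0 < t \<and> ereal t < a} \<inter> {..<c}. u \<tau> = w \<tau>" using b(4) sub by fastforce
    ultimately show "\<exists>N w. open N \<and> t \<in> N \<and> continuous_lh s ({t. 0 < t \<and> ereal t < a} \<inter> N) w \<and>
        (\<forall>\<tau>\<in>{t. 0 < t \<and> ereal t < a} \<inter> N. u \<tau> = w \<tau>)"
      using c by (intro exI[of _ "{..<c}"] exI[of _ w]) auto
  qed
next
  fix T :: real assume T: "0 < T" "ereal T < a"
  then obtain b w where b: "ereal T < b" "b \<le> a" "C_weighted \<mu> s b w"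
      "\<forall>t\<ge>0. ereal t < b \<longrightarrow> t \<noteq> 0 \<or> \<mu> = 1 \<longrightarrow> u t = w t"
    using assms[of T] by blast
  have "BUC_weighted \<mu> s {0..T} w" using b T unfolding C_weighted_def by blast
  moreover have "u t = w t" if "t \<in> {0..T}" "t \<noteq> 0 \<or> \<mu> = 1" for t
  proof -
    have "ereal t < b" using that b(1) by (auto intro: le_less_trans[of _ "ereal T"])
    thus ?thesis using b(4) that by auto
  qed
  ultimately show "BUC_weighted \<mu> s {0..T} u" using BUC_weighted_cong[of "{0..T}" \<mu> u w s] by blast
qed

text \<open>For \<open>\<mu> = 1\<close> the value of the derivative at time 0 belongs to the
  function although the equation says nothing there. As a limit it is determined by positive times,
  so all solutions agree on it.\<close>

lemma asd_derivative_at_0: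
  assumes v: "C_weighted 1 \<alpha> b v" and \<alpha>: "0 < \<alpha>" "\<alpha> < 1" and b: "0 < b"
  shows "((\<lambda>s. v s x) \<longlongrightarrow> v 0 x) (at_right 0)"
proof -
  obtain T where T: "0 < T" "ereal T < b" using ereal_dense2[OF b] by (auto simp: zero_ereal_def)
  have buc: "BUC \<alpha> {0..T} v" using v T unfolding C_weighted_def BUC_weighted_def by auto
  have hs: "v t \<in> holder_space 0 \<alpha>" if "t \<in> {0..T}" for t
    using buc that lh_holder_space[of "v t" \<alpha>] nat_floor_4_plus[OF \<alpha>] unfolding BUC_def by auto
  show ?thesis
  proof (rule tendstoI)
    fix e :: real assume "e > 0"
    then obtain d where d: "d > 0"
      "\<And>t \<tau>. t \<in> {0..T} \<Longrightarrow> \<tau> \<in> {0..T} \<Longrightarrow> \<bar>t - \<tau>\<bar> < d \<Longrightarrow> lh_norm \<alpha> (\<lambda>x. v t x - v \<tau> x) < e"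
      using buc unfolding BUC_def by blast
    have "\<forall>\<^sub>F s in at_right 0. s \<in> {0<..<min d T}" using d T by (intro eventually_at_right_real) auto
    thus "\<forall>\<^sub>F s in at_right 0. dist (v s x) (v 0 x) < e"
    proof eventually_elim
      case (elim s)
      have "\<bar>v s x - v 0 x\<bar> \<le> lh_norm \<alpha> (\<lambda>x. v s x - v 0 x)"
        using abs_deriv_le_holder_norm[OF holder_space_diff(1)[OF hs hs], of s 0 0 x] elim T
          nat_floor_4_plus[OF \<alpha>] by (simp add: lh_norm_def)
      also have "\<dots> < e" using elim T by (intro d(2)) auto
      finally show ?case by (simp add: dist_real_def)
    qed
  qed
qed

text \<open>By uniqueness all solutions with the same initial value can be glued together.\<close>

lemma asd_maximal_solution_exists:
  assumes sol0: "asd_solution \<mu> \<alpha> r0 b0 w0"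
    and \<alpha>: "0 < \<alpha>" "\<alpha> < 1" and \<mu>: "1/2 \<le> \<mu>" "\<mu> \<le> 1"
  obtains a u where "asd_maximal_solution \<mu> \<alpha> r0 a u"
proof -
  let ?sol = "asd_solution \<mu> \<alpha> r0"
  define a where "a = Sup {b. \<exists>w. ?sol b w}"
  \<comment> \<open>Any solution that lives beyond \<open>t\<close> may be picked; uniqueness makes
    the choice immaterial.\<close>
  define u where "u t = (SOME f. \<exists>b w. ?sol b w \<and> ereal t < b \<and> f = w t)" for t
  have agree: "u t = w t" if w: "?sol b w" "0 \<le> t" "ereal t < b" for b w t
  proof -
    have "\<exists>b' w'. ?sol b' w' \<and> ereal t < b' \<and> u t = w' t"
      unfolding u_def by (rule someI[of _ "w t"]) (use w in blast)
    then obtain b' w' where "?sol b' w'" "ereal t < b'" "u t = w' t" by blast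
    thus ?thesis using asd_solution_unique[OF _ w(1) \<alpha> \<mu> w(2) _ w(3)] by metis
  qed
  have le_a: "b \<le> a" if "?sol b w" for b w unfolding a_def by (rule Sup_upper) (use that in blast)
  have exh: "\<exists>b w. ?sol b w \<and> ereal T < b \<and> b \<le> a" if "ereal T < a" for T
    using that le_a unfolding a_def less_Sup_iff by blast
  \<comment> \<open>The real number \<open>c\<close> between \<open>t\<close> and the possibly
    infinite \<open>b\<close> gives an open set of times on which a single solution is in
    charge.\<close>
  have near: "\<exists>b w c. ?sol b w \<and> t < c \<and> ereal c \<le> b" if t: "ereal t < a" for t
  proof -
    obtain b w where bw: "?sol b w" "ereal t < b" using exh[OF t] by blast
    obtain c where "ereal t < ereal c" "ereal c < b" using ereal_dense2[OF bw(2)] by blast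
    thus ?thesis using bw by (intro exI[of _ b] exI[of _ w] exI[of _ c]) auto
  qed
  \<comment> \<open>At time 0 the value is forced by the limit when \<open>\<mu> = 1\<close> and is
    irrelevant otherwise.\<close>
  define v where "v t x = (if t = 0 then Lim (at_right 0) (\<lambda>s. asd_rhs (u s) x) else asd_rhs (u t) x)" for t x
  have v_agree: "v t = vw t"
    if w: "?sol b w" and vw: "C_weighted \<mu> \<alpha> b vw"
      "\<And>t. 0 < t \<Longrightarrow> ereal t < b \<Longrightarrow> ((\<lambda>\<tau>. lh_norm \<alpha> (\<lambda>x. (w \<tau> x - w t x) / (\<tau> - t) - vw t x)) \<longlongrightarrow> 0) (at t)"
      and t: "0 \<le> t" "ereal t < b" "t \<noteq> 0 \<or> \<mu> = 1" for b w vw t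
  proof -
    have pos: "asd_rhs (u s) = vw s" if "0 < s" "ereal s < b" for s
      using asd_solution_time_derivative(1)[OF w \<alpha> that vw(1) vw(2)[OF that]] agree[OF w, of s] that by simp
    show ?thesis
    proof (cases "t = 0")
      case False
      thus ?thesis using pos[of t] t by (simp add: v_def[abs_def])
    next
      case True
      hence [simp]: "\<mu> = 1" using t by simp
      have b: "0 < b" using t True by (simp add: zero_ereal_def)
      obtain T where T: "0 < T" "ereal T < b" using ereal_dense2[OF b] by (auto simp: zero_ereal_def)
      show ?thesis
      proof
        fix x
        have "((\<lambda>s. vw s x) \<longlongrightarrow> vw 0 x) (at_right 0)"
          using asd_derivative_at_0[OF _ \<alpha> b] vw(1) by simp
        moreover have "\<forall>\<^sub>F s in at_right 0. s \<in> {0<..<T}" using T by (intro eventually_at_right_real)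
        hence "\<forall>\<^sub>F s in at_right 0. vw s x = asd_rhs (u s) x"
        proof eventually_elim
          case (elim s)
          hence "ereal s < b" using T by (auto intro: less_trans[of _ "ereal T"])
          thus ?case using pos[of s] elim by simp
        qed
        ultimately have "((\<lambda>s. asd_rhs (u s) x) \<longlongrightarrow> vw 0 x) (at_right 0)"
          by (rule Lim_transform_eventually)
        thus "v t x = vw t x" unfolding v_def True by (simp add: tendsto_Lim)
      qed
    qed
  qed
  have C: "C_weighted \<mu> s a u" if "\<And>b w. ?sol b w \<Longrightarrow> C_weighted \<mu> s b w" for s
  proof (rule C_weighted_exhaust)
    fix T assume "0 < T" "ereal T < a"
    then obtain b w where "?sol b w" "ereal T < b" "b \<le> a" using exh by blast
    thus "\<exists>b w. ereal T < b \<and> b \<le> a \<and> C_weighted \<mu> s b w \<and> (\<forall>t\<ge>0. ereal t < b \<longrightarrow> t \<noteq> 0 \<or> \<mu> = 1 \<longrightarrow> u t = w t)"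
      using that agree by blast
  qed
  have Cv: "C_weighted \<mu> \<alpha> a v"
  proof (rule C_weighted_exhaust)
    fix T assume "0 < T" "ereal T < a"
    then obtain b w where b: "?sol b w" "ereal T < b" "b \<le> a" using exh by blast
    then obtain vw where "C_weighted \<mu> \<alpha> b vw"
      "\<And>t. 0 < t \<Longrightarrow> ereal t < b \<Longrightarrow> ((\<lambda>\<tau>. lh_norm \<alpha> (\<lambda>x. (w \<tau> x - w t x) / (\<tau> - t) - vw t x)) \<longlongrightarrow> 0) (at t)"
      unfolding asd_solution_def C1_weighted_def by blast
    thus "\<exists>b w. ereal T < b \<and> b \<le> a \<and> C_weighted \<mu> \<alpha> b w \<and> (\<forall>t\<ge>0. ereal t < b \<longrightarrow> t \<noteq> 0 \<or> \<mu> = 1 \<longrightarrow> v t = w t)"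
      using v_agree[OF b(1)] b by blast
  qed
  have "asd_solution \<mu> \<alpha> r0 a u"
    unfolding asd_solution_def
  proof (intro conjI allI impI)
    show a0: "0 < a" using sol0 le_a[OF sol0] unfolding asd_solution_def by (auto intro: less_le_trans)
    show "u 0 = r0" using agree[OF sol0, of 0] sol0 unfolding asd_solution_def by (simp add: zero_ereal_def)
    show "C_weighted \<mu> (4 + \<alpha>) a u" by (rule C) (simp add: asd_solution_def)
    show "C1_weighted \<mu> \<alpha> a u"
      unfolding C1_weighted_def
    proof (intro conjI exI[of _ v] allI impI)
      show "C_weighted \<mu> \<alpha> a u" by (rule C) (simp add: asd_solution_def C1_weighted_def)
      show "C_weighted \<mu> \<alpha> a v" by (rule Cv)
      fix t :: real assume t: "0 < t" "ereal t < a"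
      obtain b w c where b: "?sol b w" "t < c" "ereal c \<le> b" using near[OF t(2)] by blast
      obtain vw where vw: "C_weighted \<mu> \<alpha> b vw"
        "\<And>t. 0 < t \<Longrightarrow> ereal t < b \<Longrightarrow> ((\<lambda>\<tau>. lh_norm \<alpha> (\<lambda>x. (w \<tau> x - w t x) / (\<tau> - t) - vw t x)) \<longlongrightarrow> 0) (at t)"
        using b(1) unfolding asd_solution_def C1_weighted_def by blast
      have lt: "ereal s < b" if "s < c" for s using b(3) that by (auto intro: less_le_trans[of _ "ereal c"])
      have "\<forall>\<^sub>F \<tau> in at t. \<tau> \<in> {0<..<c}" by (rule eventually_at_in_open') (use t b in auto)
      hence "\<forall>\<^sub>F \<tau> in at t. lh_norm \<alpha> (\<lambda>x. (w \<tau> x - w t x) / (\<tau> - t) - vw t x) =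
          lh_norm \<alpha> (\<lambda>x. (u \<tau> x - u t x) / (\<tau> - t) - v t x)"
      proof eventually_elim
        case (elim \<tau>)
        have "u \<tau> = w \<tau>" "u t = w t" "v t = vw t"
          using agree[OF b(1)] v_agree[OF b(1) vw] lt elim t b(2) by auto
        thus ?case by simp
      qed
      thus "((\<lambda>\<tau>. lh_norm \<alpha> (\<lambda>x. (u \<tau> x - u t x) / (\<tau> - t) - v t x)) \<longlongrightarrow> 0) (at t)"
        by (rule Lim_transform_eventually[OF vw(2)[OF t(1) lt[OF b(2)]]])
    qed
    show "continuous_lh (4 * \<mu> + \<alpha>) {t. 0 \<le> t \<and> ereal t < a} u"
    proof (rule continuous_lh_local)
      fix t assume t: "t \<in> {t. 0 \<le> t \<and> ereal t < a}"
      then obtain b w c where b: "?sol b w" "t < c" "ereal c \<le> b" using near by blast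
      have sub: "{t. 0 \<le> t \<and> ereal t < a} \<inter> {..<c} \<subseteq> {t. 0 \<le> t \<and> ereal t < b}"
        using b by (auto intro: less_le_trans[of _ "ereal c"])
      have "continuous_lh (4 * \<mu> + \<alpha>) ({t. 0 \<le> t \<and> ereal t < a} \<inter> {..<c}) w"
        using b(1) unfolding asd_solution_def by (auto intro: continuous_lh_subset[OF _ sub])
      moreover have "\<forall>\<tau>\<in>{t. 0 \<le> t \<and> ereal t < a} \<inter> {..<c}. u \<tau> = w \<tau>"
        using agree[OF b(1)] sub by blast
      ultimately show "\<exists>N w. open N \<and> t \<in> N \<and> continuous_lh (4 * \<mu> + \<alpha>) ({t. 0 \<le> t \<and> ereal t < a} \<inter> N) w \<and>
          (\<forall>\<tau>\<in>{t. 0 \<le> t \<and> ereal t < a} \<inter> N. u \<tau> = w \<tau>)"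
        using b by (intro exI[of _ "{..<c}"] exI[of _ w]) auto
    qed
    show "0 < u t x" if t: "0 \<le> t" "ereal t < a" for t x
    proof -
      obtain b w where b: "?sol b w" "ereal t < b" using exh[OF t(2)] by blast
      thus ?thesis using agree[OF b(1) t(1) b(2)] t unfolding asd_solution_def by auto
    qed
    fix t x :: real assume t: "0 < t" "ereal t < a"
    obtain b w c where b: "?sol b w" "t < c" "ereal c \<le> b" using near[OF t(2)] by blast
    have lt: "ereal s < b" if "s < c" for s using b(3) that by (auto intro: less_le_trans[of _ "ereal c"])
    have "((\<lambda>\<tau>. w \<tau> x) has_real_derivative asd_rhs (w t) x) (at t)"
      using b(1) t lt[OF b(2)] unfolding asd_solution_def by blast
    hence "((\<lambda>\<tau>. u \<tau> x) has_real_derivative asd_rhs (w t) x) (at t)"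
    proof (rule has_field_derivative_transform_within_open[where S = "{0<..<c}"])
      show "w s x = u s x" if "s \<in> {0<..<c}" for s using agree[OF b(1), of s] lt that by auto
    qed (use t b in auto)
    thus "((\<lambda>\<tau>. u \<tau> x) has_real_derivative asd_rhs (u t) x) (at t)"
      using agree[OF b(1), of t] t lt b(2) by simp
  qed
  moreover have "b \<le> a \<and> (\<forall>t\<ge>0. ereal t < b \<longrightarrow> w t = u t)" if "?sol b w" for b w
    using le_a[OF that] agree[OF that] by auto
  ultimately show ?thesis using that[of a u] unfolding asd_maximal_solution_def by blast
qed

section \<open>Trigonometric polynomials\<close>

text \<open>
  A list of triples \<open>(a, k, \<theta>)\<close> stands for the sum of the terms \<open>a * cos (k * x + \<theta>)\<close>.  The exponential
  weight makes the norm submultiplicative and lets it control all derivatives.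
\<close>

type_synonym trig_poly = "(real \<times> int \<times> real) list"

definition trig :: "trig_poly \<Rightarrow> real \<Rightarrow> real" where
  "trig l x = (\<Sum>(a, k, \<theta>)\<leftarrow>l. a * cos (of_int k * x + \<theta>))"

definition trig_norm :: "trig_poly \<Rightarrow> real" where
  "trig_norm l = (\<Sum>(a, k, \<theta>)\<leftarrow>l. \<bar>a\<bar> * exp (of_int \<bar>k\<bar>))"

text \<open>Each derivative shifts the phase by a quarter period, so cosines suffice and the
  frequencies stay unchanged.\<close>

definition trig_deriv :: "nat \<Rightarrow> trig_poly \<Rightarrow> trig_poly" where
  "trig_deriv j l = map (\<lambda>(a, k, \<theta>). (a * of_int k ^ j, k, \<theta> + real j * (pi / 2))) l"

lemma trig_Nil [simp]: "trig [] x = 0"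
  by (simp add: trig_def)

lemma trig_Cons [simp]: "trig ((a, k, \<theta>) # l) x = a * cos (of_int k * x + \<theta>) + trig l x"
  by (simp add: trig_def)

lemma trig_append [simp]: "trig (l @ l') x = trig l x + trig l' x"
  by (simp add: trig_def)

lemma trig_norm_Nil [simp]: "trig_norm [] = 0"
  by (simp add: trig_norm_def)

lemma trig_norm_Cons [simp]: "trig_norm ((a, k, \<theta>) # l) = \<bar>a\<bar> * exp (of_int \<bar>k\<bar>) + trig_norm l"
  by (simp add: trig_norm_def)

lemma trig_norm_append [simp]: "trig_norm (l @ l') = trig_norm l + trig_norm l'"
  by (simp add: trig_norm_def)

lemma trig_deriv_Nil [simp]: "trig_deriv j [] = []"
  by (simp add: trig_deriv_def)

lemma trig_deriv_Cons [simp]: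
  "trig_deriv j ((a, k, \<theta>) # l) = (a * of_int k ^ j, k, \<theta> + real j * (pi / 2)) # trig_deriv j l"
  by (simp add: trig_deriv_def)

lemma trig_deriv_0 [simp]: "trig_deriv 0 l = l"
  by (induction l) auto

lemma trig_norm_nonneg: "trig_norm l \<ge> 0"
  by (induction l) auto

lemma abs_trig_le: "\<bar>trig l x\<bar> \<le> trig_norm l"
proof (induction l)
  case (Cons t l)
  obtain a k \<theta> where [simp]: "t = (a, k, \<theta>)" by (cases t) auto
  have "\<bar>a * cos (of_int k * x + \<theta>)\<bar> \<le> \<bar>a\<bar> * exp (of_int \<bar>k\<bar>)"
    unfolding abs_mult by (intro mult_left_mono order_trans[OF abs_cos_le_one]) auto
  with Cons show ?case by simp
qed auto

lemma torus_fun_trig: "torus_fun (trig l)"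
proof -
  have "cos (of_int k * (x + 2 * pi) + \<theta>) = cos (of_int k * x + \<theta>)" for k :: int and x \<theta> :: real
  proof -
    have "of_int k * (x + 2 * pi) + \<theta> = (of_int k * x + \<theta>) + 2 * pi * of_int k" by (simp add: algebra_simps)
    moreover have "cos (2 * pi * of_int k) = 1" "sin (2 * pi * of_int k) = 0"
      by (auto simp: cos_one_2pi_int sin_zero_iff_int2 intro: exI[of _ k] exI[of _ "2 * k"])
    ultimately show ?thesis by (simp only: cos_add) simp
  qed
  hence "trig l (x + 2 * pi) = trig l x" for x by (induction l) auto
  thus ?thesis by (simp add: torus_fun_def)
qed

lemma trig_has_deriv: "(trig (trig_deriv j l) has_real_derivative trig (trig_deriv (Suc j) l) x) (at x)"
proof (induction l)
  case (Cons t l)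
  obtain a k \<theta> where [simp]: "t = (a, k, \<theta>)" by (cases t) auto
  define \<phi> where "\<phi> = \<theta> + real j * (pi / 2)"
  have "cos (of_int k * x + (\<theta> + real (Suc j) * (pi / 2))) = cos ((of_int k * x + \<phi>) + pi / 2)"
    by (simp add: \<phi>_def algebra_simps add_divide_distrib)
  also have "\<dots> = - sin (of_int k * x + \<phi>)" by (simp add: cos_add)
  finally have c: "cos (of_int k * x + (\<theta> + real (Suc j) * (pi / 2))) = - sin (of_int k * x + \<phi>)" .
  have "((\<lambda>x. a * of_int k ^ j * cos (of_int k * x + \<phi>)) has_real_derivative
      a * of_int k ^ j * (- sin (of_int k * x + \<phi>) * of_int k)) (at x)"
    by (auto intro!: derivative_eq_intros)
  hence "((\<lambda>x. a * of_int k ^ j * cos (of_int k * x + \<phi>)) has_real_derivative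
      a * of_int k ^ Suc j * cos (of_int k * x + (\<theta> + real (Suc j) * (pi / 2)))) (at x)"
    unfolding c by (simp add: mult_ac)
  from DERIV_add[OF this Cons]
  have "((\<lambda>x. a * of_int k ^ j * cos (of_int k * x + \<phi>) + trig (trig_deriv j l) x) has_real_derivative
      trig (trig_deriv (Suc j) (t # l)) x) (at x)" by simp
  moreover have "trig (trig_deriv j (t # l)) =
      (\<lambda>x. a * of_int k ^ j * cos (of_int k * x + \<phi>) + trig (trig_deriv j l) x)"
    by (simp add: fun_eq_iff \<phi>_def)
  ultimately show ?case by simp
qed (simp add: trig_def[abs_def])

lemma power_le_fact_exp:
  assumes "(x::real) \<ge> 0"
  shows "x ^ j \<le> fact j * exp x"
proof -
  have "x ^ j /\<^sub>R fact j \<le> (\<Sum>n. x ^ n /\<^sub>R fact n)"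
    using sum_le_suminf[of "\<lambda>n. x ^ n /\<^sub>R fact n" "{j}"] summable_exp_generic[of x] assms by simp
  hence "x ^ j / fact j \<le> exp x" unfolding exp_def by (simp add: scaleR_conv_of_real divide_inverse mult_ac)
  thus ?thesis by (simp add: field_simps)
qed

lemma abs_trig_deriv_le: "\<bar>trig (trig_deriv j l) x\<bar> \<le> fact j * trig_norm l"
proof (induction l)
  case (Cons t l)
  obtain a k \<theta> where [simp]: "t = (a, k, \<theta>)" by (cases t) auto
  define \<phi> where "\<phi> = of_int k * x + (\<theta> + real j * (pi / 2))"
  have "\<bar>a * of_int k ^ j * cos \<phi>\<bar> = \<bar>a\<bar> * (of_int \<bar>k\<bar> ^ j * \<bar>cos \<phi>\<bar>)"
    by (simp add: abs_mult power_abs)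
  also have "\<dots> \<le> \<bar>a\<bar> * (of_int \<bar>k\<bar> ^ j * 1)" by (intro mult_left_mono) auto
  also have "\<dots> \<le> \<bar>a\<bar> * (fact j * exp (of_int \<bar>k\<bar>))"
    using power_le_fact_exp[of "of_int \<bar>k\<bar>" j] by (intro mult_left_mono) auto
  finally have "\<bar>a * of_int k ^ j * cos \<phi>\<bar> \<le> fact j * (\<bar>a\<bar> * exp (of_int \<bar>k\<bar>))" by (simp add: mult_ac)
  with Cons show ?case unfolding \<phi>_def by (simp add: distrib_left)
qed auto

text \<open>A function has many representations as a list; asking for some representation with small
  norm avoids normal forms and makes the bound a property of the function.\<close>

definition trig_bound :: "(real \<Rightarrow> real) \<Rightarrow> real \<Rightarrow> bool" where
  "trig_bound f B \<longleftrightarrow> (\<exists>l. f = trig l \<and> trig_norm l \<le> B)"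

lemma trig_bound_trig: "trig_norm l \<le> B \<Longrightarrow> trig_bound (trig l) B"
  unfolding trig_bound_def by blast

lemma trig_bound_mono: "trig_bound f A \<Longrightarrow> A \<le> B \<Longrightarrow> trig_bound f B"
  unfolding trig_bound_def using order_trans by blast

lemma trig_bound_abs: "trig_bound f B \<Longrightarrow> \<bar>f x\<bar> \<le> B"
  unfolding trig_bound_def by (metis order_trans abs_trig_le)

lemma trig_bound_const: "\<bar>c\<bar> \<le> B \<Longrightarrow> trig_bound (\<lambda>x. c) B"
  unfolding trig_bound_def by (intro exI[of _ "[(c, 0, 0)]"]) (auto simp: fun_eq_iff)

lemma trig_bound_add:
  assumes "trig_bound f A" "trig_bound g B"
  shows "trig_bound (\<lambda>x. f x + g x) (A + B)"
proof -
  obtain l l' where "f = trig l" "trig_norm l \<le> A" "g = trig l'" "trig_norm l' \<le> B"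
    using assms unfolding trig_bound_def by blast
  thus ?thesis unfolding trig_bound_def by (intro exI[of _ "l @ l'"]) auto
qed

lemma trig_bound_sum:
  assumes "finite I" "\<And>i. i \<in> I \<Longrightarrow> trig_bound (f i) (B i)"
  shows "trig_bound (\<lambda>x. \<Sum>i\<in>I. f i x) (\<Sum>i\<in>I. B i)"
  using assms by (induction I rule: finite_induct) (auto intro: trig_bound_add trig_bound_const)

text \<open>The product-to-sum formula creates the frequencies \<open>k + m\<close> and
  \<open>k - m\<close> with half the coefficient each; both are at most
  \<open>\<bar>k\<bar> + \<bar>m\<bar>\<close>, so the exponential weights multiply.\<close>

lemma trig_bound_cos_mult:
  "trig_bound (\<lambda>x. a * cos (of_int k * x + \<theta>) * trig l x) (\<bar>a\<bar> * exp (of_int \<bar>k\<bar>) * trig_norm l)"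
proof (induction l)
  case Nil
  show ?case using trig_bound_const[of 0 0] by simp
next
  case (Cons t l)
  obtain b m \<psi> where [simp]: "t = (b, m, \<psi>)" by (cases t) auto
  let ?l = "[(a * b / 2, k + m, \<theta> + \<psi>), (a * b / 2, k - m, \<theta> - \<psi>)]"
  have eq: "a * cos (of_int k * x + \<theta>) * (b * cos (of_int m * x + \<psi>)) = trig ?l x" for x
  proof -
    have "cos (of_int k * x + \<theta>) * cos (of_int m * x + \<psi>)
        = (cos ((of_int k * x + \<theta>) - (of_int m * x + \<psi>)) + cos ((of_int k * x + \<theta>) + (of_int m * x + \<psi>))) / 2"
      by (rule cos_times_cos)
    moreover have "(of_int k * x + \<theta>) - (of_int m * x + \<psi>) = of_int (k - m) * x + (\<theta> - \<psi>)"
      "(of_int k * x + \<theta>) + (of_int m * x + \<psi>) = of_int (k + m) * x + (\<theta> + \<psi>)"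
      by (simp_all add: algebra_simps)
    ultimately have "cos (of_int k * x + \<theta>) * cos (of_int m * x + \<psi>)
        = (cos (of_int (k - m) * x + (\<theta> - \<psi>)) + cos (of_int (k + m) * x + (\<theta> + \<psi>))) / 2" by metis
    hence "a * b * (cos (of_int k * x + \<theta>) * cos (of_int m * x + \<psi>)) =
        a * b * ((cos (of_int (k - m) * x + (\<theta> - \<psi>)) + cos (of_int (k + m) * x + (\<theta> + \<psi>))) / 2)"
      by (rule arg_cong)
    also have "\<dots> = trig ?l x" by (simp add: distrib_left add_divide_distrib del: of_int_add of_int_diff)
    finally show ?thesis by (simp add: mult_ac)
  qed
  have e: "exp (of_int \<bar>k + m\<bar>) \<le> exp (of_int \<bar>k\<bar>) * exp (of_int \<bar>m\<bar> :: real)"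
    "exp (of_int \<bar>k - m\<bar>) \<le> exp (of_int \<bar>k\<bar>) * exp (of_int \<bar>m\<bar> :: real)"
    unfolding exp_add[symmetric] by (auto simp flip: of_int_add simp del: of_int_abs)
  have "trig_norm ?l = \<bar>a\<bar> * \<bar>b\<bar> * ((exp (of_int \<bar>k + m\<bar>) + exp (of_int \<bar>k - m\<bar>)) / 2)"
    by (simp add: abs_mult field_simps)
  also have "\<dots> \<le> \<bar>a\<bar> * \<bar>b\<bar> * (exp (of_int \<bar>k\<bar>) * exp (of_int \<bar>m\<bar>))"
    using e by (intro mult_left_mono) auto
  finally have "trig_bound (trig ?l) (\<bar>a\<bar> * \<bar>b\<bar> * (exp (of_int \<bar>k\<bar>) * exp (of_int \<bar>m\<bar>)))"
    by (rule trig_bound_trig)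
  from trig_bound_add[OF this Cons] show ?case
    unfolding eq[symmetric] by (simp add: algebra_simps)
qed

lemma trig_bound_mult:
  assumes "trig_bound f A" "trig_bound g B"
  shows "trig_bound (\<lambda>x. f x * g x) (A * B)"
proof -
  obtain l l' where l: "f = trig l" "trig_norm l \<le> A" "g = trig l'" "trig_norm l' \<le> B"
    using assms unfolding trig_bound_def by blast
  have "trig_bound (\<lambda>x. trig l x * trig l' x) (trig_norm l * trig_norm l')"
  proof (induction l)
    case Nil
    show ?case using trig_bound_const[of 0 0] by simp
  next
    case (Cons t l)
    obtain a k \<theta> where [simp]: "t = (a, k, \<theta>)" by (cases t) auto
    from trig_bound_add[OF trig_bound_cos_mult[of a k \<theta> l'] Cons] show ?case
      by (simp add: algebra_simps)
  qed
  thus ?thesis unfolding l(1,3)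
    by (rule trig_bound_mono) (intro mult_mono l trig_norm_nonneg order_trans[OF trig_norm_nonneg l(2)])
qed

text \<open>The bound for Fourier multipliers: \<open>h\<close> may rescale coefficients and change
  phases, but keeps the frequency and hence the weight.\<close>

lemma trig_norm_map_le:
  assumes "\<And>a k \<theta>. \<bar>fst (h (a, k, \<theta>))\<bar> \<le> C * \<bar>a\<bar>" "\<And>a k \<theta>. fst (snd (h (a, k, \<theta>))) = k"
  shows "trig_norm (map h l) \<le> C * trig_norm l"
proof (induction l)
  case (Cons t l)
  obtain a k \<theta> where [simp]: "t = (a, k, \<theta>)" by (cases t) auto
  obtain b \<psi> where h: "h (a, k, \<theta>) = (b, k, \<psi>)" using assms(2)[of a k \<theta>] by (cases "h (a, k, \<theta>)") auto
  have "\<bar>b\<bar> * exp (of_int \<bar>k\<bar>) \<le> (C * \<bar>a\<bar>) * exp (of_int \<bar>k\<bar>)"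
    using assms(1)[of a k \<theta>] h by (intro mult_right_mono) auto
  hence "\<bar>b\<bar> * exp (of_int \<bar>k\<bar>) \<le> C * (\<bar>a\<bar> * exp (of_int \<bar>k\<bar>))" by (simp add: mult_ac)
  hence "\<bar>b\<bar> * exp (of_int \<bar>k\<bar>) + trig_norm (map h l) \<le> C * (\<bar>a\<bar> * exp (of_int \<bar>k\<bar>)) + C * trig_norm l"
    using Cons by (rule add_mono)
  thus ?case unfolding list.map \<open>t = (a, k, \<theta>)\<close> h trig_norm_Cons distrib_left .
qed auto

section \<open>The unstable manifold as a formal power series\<close>

text \<open>
  Indices \<open>0\<close> to \<open>4\<close> of \<open>h\<close> stand for \<open>r - c\<close> and its first four space derivatives, index \<open>5\<close> for the
  time derivative.  The equation multiplied by \<open>r ^ 3 * (1 + r_x\<^sup>2) ^ 4\<close> is polynomial, and \<open>asd_N\<close>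
  collects the terms of order at least two about the constant solution \<open>c\<close>; every summand is written
  as a product that exhibits two small factors.
\<close>

definition asd_N :: "real \<Rightarrow> (nat \<Rightarrow> real fps) \<Rightarrow> real fps" where
  "asd_N c h = (let C = fps_const c; g = h 0; p = h 1; q = h 2; t = h 3; z = h 4; w = h 5;
       r = C + g; Q = 1 + p * p in
     p * p * (Q * Q * Q) + q * q * (fps_const 3 * r * r * r * q * Q)
     - q * q * (r * r * Q * Q)
     + p * p * (fps_const 2 * r * q * Q * Q) - p * t * (fps_const 2 * r * r * Q * Q)
     + p * p * (fps_const 7 * r * r * q * q * Q) + p * q * (fps_const 10 * r * r * r * t * Q)
     - p * p * (fps_const 18 * r * r * r * q * q * q)
     - (g * ((r * r + r * C + C * C) * (Q * Q * Q * Q)) + p * (p * (C * C * C) * (Q * Q * Q + Q * Q + Q + 1))) * w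
     - (g * (Q * Q * Q) + p * (p * C * (Q * Q + Q + 1))) * q
     - (g * ((r * r + r * C + C * C) * (Q * Q)) + p * (p * (C * C * C) * (Q + 1))) * z)"

text \<open>
  Stands for both the bounds on the coefficients and the truncation property: \<open>B\<close>, \<open>S\<close> and \<open>T\<close> are to
  be thought of as terms of order at least zero, one and two.
\<close>

locale order_classes =
  fixes B S T :: "((nat \<Rightarrow> real fps) \<Rightarrow> real fps) \<Rightarrow> bool"
  assumes S_proj: "i < 6 \<Longrightarrow> S (\<lambda>h. h i)"
    and B_const: "B (\<lambda>h. fps_const c)"
    and S_B: "S A \<Longrightarrow> B A"
    and B_add: "B A \<Longrightarrow> B A' \<Longrightarrow> B (\<lambda>h. A h + A' h)"
    and B_mult: "B A \<Longrightarrow> B A' \<Longrightarrow> B (\<lambda>h. A h * A' h)"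
    and S_add: "S A \<Longrightarrow> S A' \<Longrightarrow> S (\<lambda>h. A h + A' h)"
    and S_mult: "S A \<Longrightarrow> B A' \<Longrightarrow> S (\<lambda>h. A h * A' h)"
    and T_add: "T A \<Longrightarrow> T A' \<Longrightarrow> T (\<lambda>h. A h + A' h)"
    and T_mult: "S A \<Longrightarrow> S A' \<Longrightarrow> T (\<lambda>h. A h * A' h)"
    and T_B: "T A \<Longrightarrow> B A' \<Longrightarrow> T (\<lambda>h. A h * A' h)"
begin

lemma B_one: "B (\<lambda>h. 1)"
  using B_const[of 1] by simp

lemma B_proj: "i < 6 \<Longrightarrow> B (\<lambda>h. h i)"
  by (intro S_B S_proj)

lemma T_diff:
  assumes "T A" "T A'"
  shows "T (\<lambda>h. A h - A' h)"
proof -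
  have "T (\<lambda>h. A h + A' h * fps_const (-1))" by (intro T_add T_B B_const assms)
  moreover have "fps_const (-1 :: real) = -1" by (metis fps_const_neg fps_const_1_eq_1)
  ultimately show ?thesis by simp
qed

lemma T_mult_B: "S A \<Longrightarrow> S A' \<Longrightarrow> B A'' \<Longrightarrow> T (\<lambda>h. A h * A' h * A'' h)"
  by (intro T_B T_mult)

lemma T_asd_N: "T (asd_N c)"
  unfolding asd_N_def[abs_def] Let_def
  by (intro T_add T_diff T_mult_B T_mult S_add S_mult B_add B_mult B_const B_one B_proj S_proj) auto

end

subsection \<open>Truncation\<close>

text \<open>Vanishing constant terms are part of the relation, since they are what gains an order
  when two small factors are multiplied.\<close>

definition agree_below :: "nat \<Rightarrow> (nat \<Rightarrow> real fps) \<Rightarrow> (nat \<Rightarrow> real fps) \<Rightarrow> bool" where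
  "agree_below n h h' \<longleftrightarrow> (\<forall>i<6. fps_X ^ n dvd h i - h' i \<and> fps_X dvd h i \<and> fps_X dvd h' i)"

lemma dvd_mult_diff:
  fixes a a' b b' :: "'a :: comm_ring_1"
  assumes "d dvd (a - a') * b" "d dvd a' * (b - b')"
  shows "d dvd a * b - a' * b'"
proof -
  have "a * b - a' * b' = (a - a') * b + a' * (b - b')" by (simp add: algebra_simps)
  thus ?thesis using assms by simp
qed

text \<open>Each summand of \<open>(a - a') * b + a' * (b - b')\<close> contains a difference
  divisible by \<open>d ^ n\<close> and a further factor divisible by \<open>d\<close>.\<close>

lemma dvd_mult_diff_Suc:
  fixes a a' b b' d :: "'a :: comm_ring_1"
  assumes "d ^ n dvd a - a'" "d dvd b" "d dvd a'" "d ^ n dvd b - b'"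
  shows "d ^ Suc n dvd a * b - a' * b'"
proof (rule dvd_mult_diff)
  show "d ^ Suc n dvd (a - a') * b" unfolding power_Suc2 by (intro mult_dvd_mono assms)
  show "d ^ Suc n dvd a' * (b - b')" unfolding power_Suc by (intro mult_dvd_mono assms)
qed

interpretation trunc: order_classes
  "\<lambda>A. \<forall>n h h'. agree_below n h h' \<longrightarrow> fps_X ^ n dvd A h - A h'"
  "\<lambda>A. \<forall>n h h'. agree_below n h h' \<longrightarrow> fps_X ^ n dvd A h - A h' \<and> fps_X dvd A h \<and> fps_X dvd A h'"
  "\<lambda>A. \<forall>n h h'. agree_below n h h' \<longrightarrow> fps_X ^ Suc n dvd A h - A h' \<and> fps_X dvd A h \<and> fps_X dvd A h'"
proof
  fix A A' :: "(nat \<Rightarrow> real fps) \<Rightarrow> real fps"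
  have add: "A h + A' h - (A h' + A' h') = (A h - A h') + (A' h - A' h')" for h h' by simp
  { assume "\<forall>n h h'. agree_below n h h' \<longrightarrow> fps_X ^ n dvd A h - A h'"
      "\<forall>n h h'. agree_below n h h' \<longrightarrow> fps_X ^ n dvd A' h - A' h'"
    thus "\<forall>n h h'. agree_below n h h' \<longrightarrow> fps_X ^ n dvd A h + A' h - (A h' + A' h')"
      "\<forall>n h h'. agree_below n h h' \<longrightarrow> fps_X ^ n dvd A h * A' h - A h' * A' h'"
      unfolding add by (auto intro: dvd_mult_diff) }
  { assume "\<forall>n h h'. agree_below n h h' \<longrightarrow> fps_X ^ n dvd A h - A h' \<and> fps_X dvd A h \<and> fps_X dvd A h'"
      "\<forall>n h h'. agree_below n h h' \<longrightarrow> fps_X ^ n dvd A' h - A' h' \<and> fps_X dvd A' h \<and> fps_X dvd A' h'"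
    thus "\<forall>n h h'. agree_below n h h' \<longrightarrow> fps_X ^ n dvd A h + A' h - (A h' + A' h') \<and> fps_X dvd A h + A' h \<and> fps_X dvd A h' + A' h'"
      "\<forall>n h h'. agree_below n h h' \<longrightarrow> fps_X ^ Suc n dvd A h * A' h - A h' * A' h' \<and> fps_X dvd A h * A' h \<and> fps_X dvd A h' * A' h'"
      unfolding add by (auto simp del: power_Suc intro: dvd_mult_diff_Suc) }
  { assume "\<forall>n h h'. agree_below n h h' \<longrightarrow> fps_X ^ n dvd A h - A h' \<and> fps_X dvd A h \<and> fps_X dvd A h'"
      "\<forall>n h h'. agree_below n h h' \<longrightarrow> fps_X ^ n dvd A' h - A' h'"
    thus "\<forall>n h h'. agree_below n h h' \<longrightarrow> fps_X ^ n dvd A h * A' h - A h' * A' h' \<and> fps_X dvd A h * A' h \<and> fps_X dvd A h' * A' h'"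
      by (auto intro: dvd_mult_diff) }
  { assume "\<forall>n h h'. agree_below n h h' \<longrightarrow> fps_X ^ Suc n dvd A h - A h' \<and> fps_X dvd A h \<and> fps_X dvd A h'"
      "\<forall>n h h'. agree_below n h h' \<longrightarrow> fps_X ^ Suc n dvd A' h - A' h' \<and> fps_X dvd A' h \<and> fps_X dvd A' h'"
    thus "\<forall>n h h'. agree_below n h h' \<longrightarrow> fps_X ^ Suc n dvd A h + A' h - (A h' + A' h') \<and> fps_X dvd A h + A' h \<and> fps_X dvd A h' + A' h'"
      unfolding add by (auto simp del: power_Suc) }
  { assume "\<forall>n h h'. agree_below n h h' \<longrightarrow> fps_X ^ Suc n dvd A h - A h' \<and> fps_X dvd A h \<and> fps_X dvd A h'"
      "\<forall>n h h'. agree_below n h h' \<longrightarrow> fps_X ^ n dvd A' h - A' h'"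
    thus "\<forall>n h h'. agree_below n h h' \<longrightarrow> fps_X ^ Suc n dvd A h * A' h - A h' * A' h' \<and> fps_X dvd A h * A' h \<and> fps_X dvd A h' * A' h'"
      by (auto intro!: dvd_mult_diff simp: mult_dvd_mono dvd_mult2) }
qed (auto simp: agree_below_def)

text \<open>This makes the recursion well-founded: the nonlinear terms of order \<open>n\<close> see
  only modes of order below \<open>n\<close>.\<close>

lemma asd_N_nth_cong:
  assumes "agree_below n h h'"
  shows "fps_nth (asd_N c h) n = fps_nth (asd_N c h') n"
proof -
  have "fps_X ^ Suc n dvd asd_N c h - asd_N c h'"
    using trunc.T_asd_N[of c] assms by blast
  then obtain d where "asd_N c h - asd_N c h' = fps_X ^ Suc n * d" by (rule dvdE)
  hence "fps_nth (asd_N c h - asd_N c h') n = 0" by (simp only: fps_X_power_mult_nth) simp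
  thus ?thesis by simp
qed

lemma asd_N_zero: "asd_N c (\<lambda>i. 0) = 0"
  by (simp add: asd_N_def)

subsection \<open>Majorants\<close>

definition majorized :: "(real \<Rightarrow> real fps) \<Rightarrow> (nat \<Rightarrow> real) \<Rightarrow> bool" where
  "majorized A \<beta> \<longleftrightarrow> (\<forall>n. trig_bound (\<lambda>x. fps_nth (A x) n) (\<beta> n))"

lemma majorized_mono: "majorized A \<beta> \<Longrightarrow> (\<And>n. \<beta> n \<le> \<gamma> n) \<Longrightarrow> majorized A \<gamma>"
  unfolding majorized_def using trig_bound_mono by blast

lemma majorized_add: "majorized A \<beta> \<Longrightarrow> majorized A' \<gamma> \<Longrightarrow> majorized (\<lambda>x. A x + A' x) (\<lambda>n. \<beta> n + \<gamma> n)"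
  unfolding majorized_def by (auto intro: trig_bound_add)

lemma majorized_mult:
  assumes "majorized A \<beta>" "majorized A' \<gamma>"
  shows "majorized (\<lambda>x. A x * A' x) (\<lambda>n. \<Sum>i=0..n. \<beta> i * \<gamma> (n - i))"
  using assms unfolding majorized_def fps_mult_nth by (auto intro!: trig_bound_sum trig_bound_mult)

text \<open>The neutral element of convolution, that is, the coefficients of the series 1.\<close>

definition unit_seq :: "nat \<Rightarrow> real" where
  "unit_seq n = (if n = 0 then 1 else 0)"

text \<open>If the convolution square of \<open>b\<close> is at most \<open>\<epsilon> * b\<close>,
  bounds of the form \<open>p * unit_seq + q * b\<close> are closed under products, and a product of
  two series bounded by \<open>b\<close> gains the factor \<open>\<epsilon>\<close>.\<close>

definition majorant :: "(nat \<Rightarrow> real) \<Rightarrow> real \<Rightarrow> (nat \<Rightarrow> real \<Rightarrow> real fps) \<Rightarrow> bool" where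
  "majorant b \<epsilon> H \<longleftrightarrow> 0 \<le> \<epsilon> \<and> \<epsilon> \<le> 1 \<and> (\<forall>n. 0 \<le> b n) \<and> (\<forall>n. (\<Sum>i=0..n. b i * b (n - i)) \<le> \<epsilon> * b n) \<and>
     (\<forall>i<6. majorized (H i) b)"

lemma majorized_affine_mult:
  assumes H: "majorant b \<epsilon> H"
    and A: "majorized A (\<lambda>n. p * unit_seq n + q * b n)" "majorized A' (\<lambda>n. p' * unit_seq n + q' * b n)"
    and pos: "0 \<le> q" "0 \<le> q'"
  shows "majorized (\<lambda>x. A x * A' x) (\<lambda>n. (p * p') * unit_seq n + (p * q' + p' * q + q * q' * \<epsilon>) * b n)"
proof (rule majorized_mono[OF majorized_mult[OF A]])
  fix n
  have e1: "(\<Sum>i=0..n. unit_seq i * f (n - i)) = f n" for f :: "nat \<Rightarrow> real"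
    using sum.delta[of "{0..n}" 0 "\<lambda>i. f (n - i)"] by (simp add: unit_seq_def if_distrib[of "\<lambda>x. x * _"] cong: if_cong)
  have e2: "(\<Sum>i=0..n. f i * unit_seq (n - i)) = f n" for f :: "nat \<Rightarrow> real"
  proof -
    have "(\<Sum>i=0..n. f i * unit_seq (n - i)) = (\<Sum>i=0..n. if n = i then f i else 0)"
      by (intro sum.cong) (auto simp: unit_seq_def)
    thus ?thesis by (simp add: sum.delta')
  qed
  have "(\<Sum>i=0..n. (p * unit_seq i + q * b i) * (p' * unit_seq (n - i) + q' * b (n - i)))
    = (\<Sum>i=0..n. p * p' * (unit_seq i * unit_seq (n - i)) + p * q' * (unit_seq i * b (n - i))
        + p' * q * (b i * unit_seq (n - i)) + q * q' * (b i * b (n - i)))"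
    by (intro sum.cong) (auto simp: algebra_simps)
  also have "\<dots> = p * p' * unit_seq n + p * q' * b n + p' * q * b n + q * q' * (\<Sum>i=0..n. b i * b (n - i))"
    by (simp only: sum.distrib sum_distrib_left[symmetric] e1 e2)
  also have "\<dots> \<le> p * p' * unit_seq n + p * q' * b n + p' * q * b n + q * q' * (\<epsilon> * b n)"
    using H pos unfolding majorant_def by (intro add_left_mono mult_left_mono) auto
  finally show "(\<Sum>i=0..n. (p * unit_seq i + q * b i) * (p' * unit_seq (n - i) + q' * b (n - i)))
      \<le> p * p' * unit_seq n + (p * q' + p' * q + q * q' * \<epsilon>) * b n"
    by (simp add: algebra_simps)
qed

lemma majorized_affine_mono:
  assumes H: "majorant b \<epsilon> H" and A: "majorized A (\<lambda>n. p * unit_seq n + q * b n)" and le: "p \<le> p'" "q \<le> q'"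
  shows "majorized A (\<lambda>n. p' * unit_seq n + q' * b n)"
proof (rule majorized_mono[OF A])
  fix n show "p * unit_seq n + q * b n \<le> p' * unit_seq n + q' * b n"
    using H le unfolding majorant_def by (intro add_mono mult_right_mono) (auto simp: unit_seq_def)
qed

lemma majorized_affine_add:
  assumes "majorized A (\<lambda>n. p * unit_seq n + q * b n)" "majorized A' (\<lambda>n. p' * unit_seq n + q' * b n)"
  shows "majorized (\<lambda>x. A x + A' x) (\<lambda>n. (p + p') * unit_seq n + (q + q') * b n)"
  using majorized_add[OF assms] by (simp add: algebra_simps)

text \<open>\<open>u\<close> tells whether a constant part is allowed and \<open>v\<close> records
  the gain in \<open>\<epsilon>\<close>. The constant \<open>C\<close> depends on the expression
  \<open>A\<close> alone and precedes \<open>b\<close>, \<open>\<epsilon>\<close> and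
  \<open>H\<close>, so \<open>\<epsilon>\<close> can later be chosen small against it.\<close>

definition maj_class :: "real \<Rightarrow> (real \<Rightarrow> real) \<Rightarrow> ((nat \<Rightarrow> real fps) \<Rightarrow> real fps) \<Rightarrow> bool" where
  "maj_class u v A \<longleftrightarrow> (\<exists>C\<ge>0. \<forall>b \<epsilon> H. majorant b \<epsilon> H \<longrightarrow>
     majorized (\<lambda>x. A (\<lambda>i. H i x)) (\<lambda>n. (C * u) * unit_seq n + (C * v \<epsilon>) * b n))"

lemma maj_class_add:
  assumes "maj_class u v A" "maj_class u v A'"
  shows "maj_class u v (\<lambda>h. A h + A' h)"
proof -
  obtain C where C: "C \<ge> 0" "\<And>b \<epsilon> H. majorant b \<epsilon> H \<Longrightarrow>
     majorized (\<lambda>x. A (\<lambda>i. H i x)) (\<lambda>n. (C * u) * unit_seq n + (C * v \<epsilon>) * b n)"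
    using assms(1) unfolding maj_class_def by blast
  obtain C' where C': "C' \<ge> 0" "\<And>b \<epsilon> H. majorant b \<epsilon> H \<Longrightarrow>
     majorized (\<lambda>x. A' (\<lambda>i. H i x)) (\<lambda>n. (C' * u) * unit_seq n + (C' * v \<epsilon>) * b n)"
    using assms(2) unfolding maj_class_def by blast
  show ?thesis unfolding maj_class_def
  proof (intro exI[of _ "C + C'"] conjI allI impI)
    fix b \<epsilon> H assume "majorant b \<epsilon> H"
    from majorized_affine_add[OF C(2)[OF this] C'(2)[OF this]]
    show "majorized (\<lambda>x. A (\<lambda>i. H i x) + A' (\<lambda>i. H i x)) (\<lambda>n. (C + C') * u * unit_seq n + (C + C') * v \<epsilon> * b n)"
      by (simp add: algebra_simps)
  qed (use C(1) C'(1) in simp)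
qed

lemma maj_class_mult:
  assumes A: "maj_class u v A" "maj_class u' v' A'"
    and nn: "\<And>\<epsilon>. 0 \<le> \<epsilon> \<Longrightarrow> \<epsilon> \<le> 1 \<Longrightarrow> 0 \<le> v \<epsilon> \<and> 0 \<le> v' \<epsilon>"
    and D: "u * u' \<le> D * u''"
      "\<And>\<epsilon>. 0 \<le> \<epsilon> \<Longrightarrow> \<epsilon> \<le> 1 \<Longrightarrow> u * v' \<epsilon> + u' * v \<epsilon> + v \<epsilon> * v' \<epsilon> * \<epsilon> \<le> D * v'' \<epsilon>" "0 \<le> D"
  shows "maj_class u'' v'' (\<lambda>h. A h * A' h)"
proof -
  obtain C where C: "C \<ge> 0" "\<And>b \<epsilon> H. majorant b \<epsilon> H \<Longrightarrow>
     majorized (\<lambda>x. A (\<lambda>i. H i x)) (\<lambda>n. (C * u) * unit_seq n + (C * v \<epsilon>) * b n)"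
    using A(1) unfolding maj_class_def by blast
  obtain C' where C': "C' \<ge> 0" "\<And>b \<epsilon> H. majorant b \<epsilon> H \<Longrightarrow>
     majorized (\<lambda>x. A' (\<lambda>i. H i x)) (\<lambda>n. (C' * u') * unit_seq n + (C' * v' \<epsilon>) * b n)"
    using A(2) unfolding maj_class_def by blast
  show ?thesis unfolding maj_class_def
  proof (intro exI[of _ "C * C' * D"] conjI allI impI)
    fix b \<epsilon> H assume H: "majorant b \<epsilon> H"
    hence e: "0 \<le> \<epsilon>" "\<epsilon> \<le> 1" by (auto simp: majorant_def)
    have q: "0 \<le> C * v \<epsilon>" "0 \<le> C' * v' \<epsilon>" using nn[OF e] C(1) C'(1) by auto
    have CC: "0 \<le> C * C'" using C(1) C'(1) by simp
    show "majorized (\<lambda>x. A (\<lambda>i. H i x) * A' (\<lambda>i. H i x))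
        (\<lambda>n. C * C' * D * u'' * unit_seq n + C * C' * D * v'' \<epsilon> * b n)"
    proof (rule majorized_affine_mono[OF H majorized_affine_mult[OF H C(2)[OF H] C'(2)[OF H] q]])
      show "C * u * (C' * u') \<le> C * C' * D * u''"
        using mult_left_mono[OF D(1) CC] by (simp add: mult_ac)
      show "C * u * (C' * v' \<epsilon>) + C' * u' * (C * v \<epsilon>) + C * v \<epsilon> * (C' * v' \<epsilon>) * \<epsilon> \<le> C * C' * D * v'' \<epsilon>"
        using mult_left_mono[OF D(2)[OF e] CC] by (simp add: algebra_simps)
    qed
  qed (use C(1) C'(1) D(3) in simp)
qed

interpretation maj: order_classes "maj_class 1 (\<lambda>\<epsilon>. 1)" "maj_class 0 (\<lambda>\<epsilon>. 1)" "maj_class 0 (\<lambda>\<epsilon>. \<epsilon>)"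
proof
  fix A A' :: "(nat \<Rightarrow> real fps) \<Rightarrow> real fps" and c :: real and i :: nat
  show "maj_class 0 (\<lambda>\<epsilon>. 1) (\<lambda>h. h i)" if "i < 6"
    unfolding maj_class_def by (rule exI[of _ 1]) (use that in \<open>auto simp: majorant_def\<close>)
  show "maj_class 1 (\<lambda>\<epsilon>. 1) (\<lambda>h. fps_const c)"
    unfolding maj_class_def majorized_def
    by (rule exI[of _ "\<bar>c\<bar>"]) (auto simp: majorant_def unit_seq_def intro!: trig_bound_const)
  show "maj_class 1 (\<lambda>\<epsilon>. 1) A" if A: "maj_class 0 (\<lambda>\<epsilon>. 1) A"
  proof -
    obtain C where C: "C \<ge> 0" "\<And>b \<epsilon> H. majorant b \<epsilon> H \<Longrightarrow>
       majorized (\<lambda>x. A (\<lambda>i. H i x)) (\<lambda>n. (C * 0) * unit_seq n + (C * 1) * b n)"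
      using A unfolding maj_class_def by blast
    show ?thesis unfolding maj_class_def
    proof (intro exI[of _ C] conjI allI impI C(1))
      fix b \<epsilon> H assume H: "majorant b \<epsilon> H"
      show "majorized (\<lambda>x. A (\<lambda>i. H i x)) (\<lambda>n. (C * 1) * unit_seq n + (C * 1) * b n)"
        by (rule majorized_affine_mono[OF H C(2)[OF H]]) (use C(1) in auto)
    qed
  qed
  \<comment> \<open>Here and below the instantiated constant counts the surviving terms among
    \<open>u * v'\<close>, \<open>u' * v\<close> and \<open>v * v' * \<epsilon>\<close>, using
    \<open>\<epsilon> \<le> 1\<close>.\<close>
  show "maj_class 1 (\<lambda>\<epsilon>. 1) (\<lambda>h. A h * A' h)" if "maj_class 1 (\<lambda>\<epsilon>. 1) A" "maj_class 1 (\<lambda>\<epsilon>. 1) A'"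
    by (rule maj_class_mult[OF that, of 3]) auto
  show "maj_class 0 (\<lambda>\<epsilon>. 1) (\<lambda>h. A h * A' h)" if "maj_class 0 (\<lambda>\<epsilon>. 1) A" "maj_class 1 (\<lambda>\<epsilon>. 1) A'"
    by (rule maj_class_mult[OF that, of 2]) auto
  show "maj_class 0 (\<lambda>\<epsilon>. \<epsilon>) (\<lambda>h. A h * A' h)" if "maj_class 0 (\<lambda>\<epsilon>. 1) A" "maj_class 0 (\<lambda>\<epsilon>. 1) A'"
    by (rule maj_class_mult[OF that, of 1]) auto
  show "maj_class 0 (\<lambda>\<epsilon>. \<epsilon>) (\<lambda>h. A h * A' h)" if "maj_class 0 (\<lambda>\<epsilon>. \<epsilon>) A" "maj_class 1 (\<lambda>\<epsilon>. 1) A'"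
    by (rule maj_class_mult[OF that, of 2]) (auto intro: mult_left_le)
qed (fact maj_class_add)+

lemma asd_N_majorized:
  obtains C where "C \<ge> 0" "\<And>b \<epsilon> H n. majorant b \<epsilon> H \<Longrightarrow> trig_bound (\<lambda>x. fps_nth (asd_N c (\<lambda>i. H i x)) n) (C * \<epsilon> * b n)"
proof -
  have "maj_class 0 (\<lambda>\<epsilon>. \<epsilon>) (asd_N c)" by (rule maj.T_asd_N)
  then obtain C where C: "C \<ge> 0" "\<forall>b \<epsilon> H. majorant b \<epsilon> H \<longrightarrow>
      majorized (\<lambda>x. asd_N c (\<lambda>i. H i x)) (\<lambda>n. (C * 0) * unit_seq n + (C * \<epsilon>) * b n)"
    unfolding maj_class_def by blast
  show ?thesis
  proof (rule that[OF C(1)])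
    fix b \<epsilon> H n assume "majorant b \<epsilon> H"
    with C(2) have "majorized (\<lambda>x. asd_N c (\<lambda>i. H i x)) (\<lambda>n. (C * 0) * unit_seq n + (C * \<epsilon>) * b n)" by blast
    thus "trig_bound (\<lambda>x. fps_nth (asd_N c (\<lambda>i. H i x)) n) (C * \<epsilon> * b n)" by (simp add: majorized_def)
  qed
qed

text \<open>The squares in the denominator make the sequence submultiplicative up to a small factor.\<close>

definition geom_maj :: "real \<Rightarrow> real \<Rightarrow> nat \<Rightarrow> real" where
  "geom_maj \<delta> R n = \<delta> * R ^ n / (real n)\<^sup>2"

text \<open>The term \<open>i = 0\<close> is 0 because of division by zero; the others are compared
  with a telescoping sum.\<close>

lemma sum_inverse_squares_le: "(\<Sum>i=0..n. 1 / (real i)\<^sup>2) \<le> 2"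
proof -
  have bound: "(\<Sum>i=0..Suc n. 1 / (real i)\<^sup>2) \<le> 2 - 1 / real (Suc n)" for n
  proof (induction n)
    case 0
    show ?case by simp
  next
    case (Suc n)
    define m where "m = real (Suc n)"
    have m: "m > 0" "real (Suc (Suc n)) = m + 1" by (auto simp: m_def)
    have "1 / (m + 1)\<^sup>2 \<le> 1 / (m * (m + 1))"
      using m by (intro divide_left_mono) (auto simp: power2_eq_square)
    also have "\<dots> = 1 / m - 1 / (m + 1)" using m by (simp add: field_simps)
    finally have "1 / (real (Suc (Suc n)))\<^sup>2 \<le> 1 / real (Suc n) - 1 / real (Suc (Suc n))"
      unfolding m(2) m_def .
    with Suc show ?case unfolding sum.atLeast0_atMost_Suc[of _ "Suc n"] by linarith
  qed
  have "(\<Sum>i=0..n. 1 / (real i)\<^sup>2) \<le> (\<Sum>i=0..Suc n. 1 / (real i)\<^sup>2)" by (rule sum_mono2) auto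
  also have "\<dots> \<le> 2 - 1 / real (Suc n)" by (rule bound)
  also have "\<dots> \<le> 2" by simp
  finally show ?thesis .
qed

text \<open>With \<open>n = a + b\<close> the inequality
  \<open>(a + b)\<^sup>2 \<le> 2 * (a\<^sup>2 + b\<^sup>2)\<close> separates the two inverse squares
  at the price of a factor 2, and each of the two remaining sums is at most 2; this makes the
  8.\<close>

lemma geom_maj_conv:
  assumes "\<delta> \<ge> 0" "R \<ge> 0"
  shows "(\<Sum>i=0..n. geom_maj \<delta> R i * geom_maj \<delta> R (n - i)) \<le> 8 * \<delta> * geom_maj \<delta> R n"
proof -
  have summand: "1 / (real i)\<^sup>2 * (1 / (real (n - i))\<^sup>2) \<le> 2 / (real n)\<^sup>2 * (1 / (real i)\<^sup>2 + 1 / (real (n - i))\<^sup>2)"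
    if "i \<le> n" for i
  proof (cases "i = 0 \<or> i = n")
    \<comment> \<open>At either end one factor is \<open>1 / 0 = 0\<close>, so the left-hand side
      vanishes.\<close>
    case True
    then show ?thesis by auto
  next
    case False
    define a b where "a = real i" "b = real (n - i)"
    have ab: "a > 0" "b > 0" "real n = a + b" using False that by (auto simp: a_b_def)
    have "0 \<le> (a - b)\<^sup>2" by simp
    hence "(a + b)\<^sup>2 \<le> 2 * (a\<^sup>2 + b\<^sup>2)" by (simp add: power2_eq_square algebra_simps)
    hence "1 / (a\<^sup>2 * b\<^sup>2) \<le> 2 * (a\<^sup>2 + b\<^sup>2) / ((a + b)\<^sup>2 * (a\<^sup>2 * b\<^sup>2))"
      using ab by (simp add: divide_simps)
    also have "\<dots> = 2 / (a + b)\<^sup>2 * (1 / a\<^sup>2 + 1 / b\<^sup>2)" using ab by (simp add: field_simps)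
    finally show ?thesis unfolding ab(3) a_b_def[symmetric] by simp
  qed
  have "(\<Sum>i=0..n. geom_maj \<delta> R i * geom_maj \<delta> R (n - i))
     = (\<Sum>i=0..n. \<delta>\<^sup>2 * R ^ n * (1 / (real i)\<^sup>2 * (1 / (real (n - i))\<^sup>2)))"
  proof (intro sum.cong refl)
    fix i assume "i \<in> {0..n}"
    hence "R ^ n = R ^ i * R ^ (n - i)" by (simp flip: power_add)
    thus "geom_maj \<delta> R i * geom_maj \<delta> R (n - i) = \<delta>\<^sup>2 * R ^ n * (1 / (real i)\<^sup>2 * (1 / (real (n - i))\<^sup>2))"
      by (simp add: geom_maj_def power2_eq_square)
  qed
  also have "\<dots> \<le> (\<Sum>i=0..n. \<delta>\<^sup>2 * R ^ n * (2 / (real n)\<^sup>2 * (1 / (real i)\<^sup>2 + 1 / (real (n - i))\<^sup>2)))"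
    using assms by (intro sum_mono mult_left_mono summand) auto
  also have "\<dots> = \<delta>\<^sup>2 * R ^ n * (2 / (real n)\<^sup>2) * ((\<Sum>i=0..n. 1 / (real i)\<^sup>2) + (\<Sum>i=0..n. 1 / (real (n - i))\<^sup>2))"
    unfolding sum.distrib[symmetric] sum_distrib_left by (simp only: mult.assoc)
  also have "(\<Sum>i=0..n. 1 / (real (n - i))\<^sup>2) = (\<Sum>i=0..n. 1 / (real i)\<^sup>2)"
    using sum.atLeastAtMost_rev[of "\<lambda>i. 1 / (real (n - i))\<^sup>2" 0 n] by (auto intro!: sum.cong)
  also have "\<delta>\<^sup>2 * R ^ n * (2 / (real n)\<^sup>2) * ((\<Sum>i=0..n. 1 / (real i)\<^sup>2) + (\<Sum>i=0..n. 1 / (real i)\<^sup>2))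
      \<le> \<delta>\<^sup>2 * R ^ n * (2 / (real n)\<^sup>2) * (2 + 2)"
    using assms by (intro mult_left_mono add_mono sum_inverse_squares_le) auto
  also have "\<dots> = 8 * \<delta> * geom_maj \<delta> R n" by (simp add: geom_maj_def power2_eq_square)
  finally show ?thesis .
qed

subsection \<open>The linearization\<close>

text \<open>The growth rate of the mode \<open>cos (k * x)\<close> is \<open>k\<^sup>2 / c\<^sup>2 - k ^ 4\<close>; the largest one is chosen.\<close>

lemma unstable_mode:
  assumes "0 < c" "c < (1::real)"
  obtains k0 :: int and \<nu> :: real where "\<nu> = of_int k0 ^ 2 / c\<^sup>2 - of_int k0 ^ 4" "\<nu> > 0"
    "\<And>k::int. of_int k ^ 2 / c\<^sup>2 - of_int k ^ 4 \<le> \<nu>"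
proof -
  define f :: "int \<Rightarrow> real" where "f k = of_int k ^ 2 / c\<^sup>2 - of_int k ^ 4" for k
  \<comment> \<open>For \<open>\<bar>k\<bar> \<ge> 1 / c\<close> the rate is not positive, so the
    maximum over this finite range is global; \<open>c < 1\<close> makes the rate at
    \<open>k = 1\<close> positive.\<close>
  define I where "I = {1..\<lceil>1 / c\<rceil>}"
  have I: "finite I" "1 \<in> I" using assms by (auto simp: I_def)
  then obtain k0 where k0: "k0 \<in> I" "\<And>k. k \<in> I \<Longrightarrow> f k \<le> f k0"
    using finite_has_maximal2[of "f ` I" "f 1"] Max_ge[of "f ` I"] Max_in[of "f ` I"]
    by (metis empty_iff finite_imageI imageE image_eqI image_is_empty)
  have "c\<^sup>2 < 1" using assms by (simp add: power_less_one_iff)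
  hence "f 1 > 0" using assms by (simp add: f_def)
  hence pos: "f k0 > 0" using k0(2)[OF I(2)] by simp
  have "f k \<le> f k0" for k
  proof -
    consider "k = 0" | "\<bar>k\<bar> \<in> I" | "\<bar>k\<bar> > \<lceil>1 / c\<rceil>" unfolding I_def by fastforce
    thus ?thesis
    proof cases
      case 1
      then show ?thesis using pos by (simp add: f_def)
    next
      case 2
      have "f k = f \<bar>k\<bar>" by (simp add: f_def)
      then show ?thesis using k0(2)[OF 2] by simp
    next
      case 3
      have "1 / c \<le> of_int \<bar>k\<bar>" using 3 by linarith
      hence "1 / c \<le> \<bar>of_int k\<bar>" by simp
      hence "(1 / c)\<^sup>2 \<le> (of_int k)\<^sup>2" using assms by (simp add: abs_le_square_iff[symmetric])
      hence "(of_int k)\<^sup>2 * (1 / c)\<^sup>2 \<le> (of_int k)\<^sup>2 * (of_int k :: real)\<^sup>2" by (intro mult_left_mono) auto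
      hence "f k \<le> 0" by (simp add: f_def power_divide flip: power_mult power_add)
      then show ?thesis using pos by simp
    qed
  qed
  thus ?thesis using that[of "f k0" k0] pos unfolding f_def by blast
qed

text \<open>This is \<open>c ^ 3\<close> times the gap between \<open>n * \<nu>\<close> and the
  growth rate of mode \<open>k\<close>; the factor stems from the cleared denominators.\<close>

definition lin_symbol :: "real \<Rightarrow> real \<Rightarrow> nat \<Rightarrow> int \<Rightarrow> real" where
  "lin_symbol c \<nu> n k = c ^ 3 * (real n * \<nu> + of_int k ^ 4) - c * of_int k ^ 2"

text \<open>Applied with \<open>\<kappa> = 1 / c\<^sup>2\<close>, \<open>a = k\<^sup>2\<close> and
  \<open>y = n * \<nu>\<close>. From \<open>n \<ge> 2\<close> the rate is at most half of
  \<open>y\<close>, which excludes small divisors; completing the square in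
  \<open>a - \<kappa>\<close> shows that the gap also controls \<open>k ^ 4\<close>.\<close>

lemma growth_rate_gap:
  fixes \<kappa> a y \<nu> :: real
  assumes "\<kappa> * a - a\<^sup>2 \<le> \<nu>" "2 * \<nu> \<le> y" "0 < \<nu>"
  shows "\<nu> \<le> y - (\<kappa> * a - a\<^sup>2)" "y \<le> 2 * (y - (\<kappa> * a - a\<^sup>2))" "a\<^sup>2 \<le> 2 * (y - (\<kappa> * a - a\<^sup>2)) + \<kappa>\<^sup>2"
proof -
  have "0 \<le> (a - \<kappa>)\<^sup>2" by simp
  hence "2 * (\<kappa> * a) \<le> a\<^sup>2 + \<kappa>\<^sup>2" by (simp add: power2_diff mult_ac)
  thus "\<nu> \<le> y - (\<kappa> * a - a\<^sup>2)" "y \<le> 2 * (y - (\<kappa> * a - a\<^sup>2))" "a\<^sup>2 \<le> 2 * (y - (\<kappa> * a - a\<^sup>2)) + \<kappa>\<^sup>2"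
    using assms by auto
qed

text \<open>One constant, independent of \<open>n\<close> and \<open>k\<close>, covers all four
  space derivatives and the time derivative: dividing by the symbol regains everything the
  nonlinearity differentiates.\<close>

lemma lin_symbol_lower:
  assumes c: "c > 0" and \<nu>: "\<nu> > 0" "\<And>k::int. of_int k ^ 2 / c\<^sup>2 - of_int k ^ 4 \<le> \<nu>"
  obtains K where "K > 0" "\<And>n k j. 2 \<le> n \<Longrightarrow> j \<le> 4 \<Longrightarrow> of_int \<bar>k\<bar> ^ j \<le> K * lin_symbol c \<nu> n k"
    "\<And>n k. 2 \<le> n \<Longrightarrow> real n * \<nu> \<le> K * lin_symbol c \<nu> n k"
proof -
  define \<kappa> where "\<kappa> = 1 / c\<^sup>2"
  define K0 where "K0 = 4 + \<kappa>\<^sup>2 / \<nu> + 1 / \<nu>"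
  have K0: "K0 > 0" unfolding K0_def using \<nu> by (intro add_pos_nonneg) auto
  have *: "1 + of_int k ^ 4 \<le> K0 * (real n * \<nu> - (\<kappa> * of_int k ^ 2 - of_int k ^ 4))"
    "real n * \<nu> \<le> K0 * (real n * \<nu> - (\<kappa> * of_int k ^ 2 - of_int k ^ 4))"
    if n: "2 \<le> n" for n :: nat and k :: int
  proof -
    define X where "X = real n * \<nu> - (\<kappa> * of_int k ^ 2 - of_int k ^ 4)"
    have le: "\<kappa> * of_int k ^ 2 - of_int k ^ 4 \<le> \<nu>" using \<nu>(2)[of k] by (simp add: \<kappa>_def)
    have n2: "2 * \<nu> \<le> real n * \<nu>" using n \<nu>(1) by (intro mult_right_mono) auto
    have k4: "(of_int k :: real) ^ 4 = ((of_int k)\<^sup>2)\<^sup>2" by (simp flip: power_mult)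
    have X1: "\<nu> \<le> X" and X2: "real n * \<nu> \<le> 2 * X" and X3: "of_int k ^ 4 \<le> 2 * X + \<kappa>\<^sup>2"
      using growth_rate_gap[OF le[unfolded k4] n2 \<nu>(1)] unfolding X_def k4 by auto
    note X3
    also have "\<kappa>\<^sup>2 \<le> \<kappa>\<^sup>2 / \<nu> * X" using mult_left_mono[OF X1, of "\<kappa>\<^sup>2 / \<nu>"] \<nu>(1) by simp
    finally have k4: "of_int k ^ 4 \<le> (2 + \<kappa>\<^sup>2 / \<nu>) * X" by (simp add: algebra_simps)
    have one: "1 \<le> 1 / \<nu> * X" using X1 \<nu>(1) by simp
    have X0: "X \<ge> 0" using X1 \<nu>(1) by simp
    have "1 + of_int k ^ 4 \<le> (2 + \<kappa>\<^sup>2 / \<nu> + 1 / \<nu>) * X" using k4 one by (simp add: algebra_simps)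
    also have "\<dots> \<le> K0 * X" using X0 by (intro mult_right_mono) (auto simp: K0_def)
    finally show "1 + of_int k ^ 4 \<le> K0 * (real n * \<nu> - (\<kappa> * of_int k ^ 2 - of_int k ^ 4))" unfolding X_def .
    have "2 * X \<le> K0 * X" using X0 \<nu>(1) by (intro mult_right_mono) (auto simp: K0_def)
    with X2 show "real n * \<nu> \<le> K0 * (real n * \<nu> - (\<kappa> * of_int k ^ 2 - of_int k ^ 4))" unfolding X_def by linarith
  qed
  have sym: "K0 / c ^ 3 * lin_symbol c \<nu> n k = K0 * (real n * \<nu> - (\<kappa> * of_int k ^ 2 - of_int k ^ 4))" for n k
    using c by (simp add: lin_symbol_def \<kappa>_def field_simps power2_eq_square power3_eq_cube)
  show ?thesis
  proof (rule that[of "K0 / c ^ 3"])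
    show "K0 / c ^ 3 > 0" using K0 c by simp
    show "real n * \<nu> \<le> K0 / c ^ 3 * lin_symbol c \<nu> n k" if "2 \<le> n" for n k
      unfolding sym by (rule *(2)[OF that])
    show "of_int \<bar>k\<bar> ^ j \<le> K0 / c ^ 3 * lin_symbol c \<nu> n k" if "2 \<le> n" "j \<le> 4" for n k j
    proof -
      have "of_int \<bar>k\<bar> ^ j \<le> (1 + of_int k ^ 4 :: real)"
      proof (cases "k = 0")
        case True
        then show ?thesis by (cases j) auto
      next
        case False
        hence "(1::real) \<le> of_int \<bar>k\<bar>" by linarith
        hence "of_int \<bar>k\<bar> ^ j \<le> (of_int \<bar>k\<bar> ^ 4 :: real)" using that by (intro power_increasing) auto
        thus ?thesis by simp
      qed
      also have "\<dots> \<le> K0 / c ^ 3 * lin_symbol c \<nu> n k" unfolding sym by (rule *(1)[OF that(1)])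
      finally show ?thesis .
    qed
  qed
qed

definition lin_op :: "real \<Rightarrow> real \<Rightarrow> nat \<Rightarrow> trig_poly \<Rightarrow> real \<Rightarrow> real" where
  "lin_op c \<nu> n l x = c ^ 3 * (real n * \<nu> * trig l x + trig (trig_deriv 4 l) x) + c * trig (trig_deriv 2 l) x"

lemma lin_op_Cons:
  "lin_op c \<nu> n ((a, k, \<theta>) # l) x = a * lin_symbol c \<nu> n k * cos (of_int k * x + \<theta>) + lin_op c \<nu> n l x"
proof -
  have "cos (of_int k * x + (\<theta> + 2 * pi)) = cos (of_int k * x + \<theta>)"
    using cos_periodic[of "of_int k * x + \<theta>"] by (simp add: add.assoc)
  moreover have "cos (of_int k * x + (\<theta> + pi)) = - cos (of_int k * x + \<theta>)"
    using cos_periodic_pi[of "of_int k * x + \<theta>"] by (simp add: add.assoc)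
  ultimately show ?thesis by (simp add: lin_op_def lin_symbol_def algebra_simps)
qed

text \<open>The operator multiplies each cosine by its symbol, so the solution divides the
  coefficients by it, and the lower bounds on the symbol become norm bounds.\<close>

lemma lin_op_solve:
  assumes f: "trig_bound f B" and n: "2 \<le> n" and K: "K > 0"
    and \<sigma>: "\<And>k j. j \<le> 4 \<Longrightarrow> of_int \<bar>k\<bar> ^ j \<le> K * lin_symbol c \<nu> n k"
      "\<And>k. real n * \<nu> \<le> K * lin_symbol c \<nu> n k" and \<nu>: "\<nu> > 0"
  obtains l where "\<And>x. lin_op c \<nu> n l x = f x" "\<And>j. j \<le> 4 \<Longrightarrow> trig_norm (trig_deriv j l) \<le> K * B"
    "real n * \<nu> * trig_norm l \<le> K * B"
proof -
  obtain l where l: "f = trig l" "trig_norm l \<le> B" using f unfolding trig_bound_def by blast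
  let ?\<sigma> = "lin_symbol c \<nu> n"
  have pos: "?\<sigma> k > 0" for k
  proof -
    have "1 \<le> K * ?\<sigma> k" using \<sigma>(1)[of 0 k] by simp
    thus ?thesis using K by (metis less_le_trans zero_less_mult_pos zero_less_one)
  qed
  define h where "h = (\<lambda>(a :: real, k, \<theta> :: real). (a / ?\<sigma> k, k, \<theta>))"
  have le: "K * trig_norm l \<le> K * B" using l K by simp
  have eq: "lin_op c \<nu> n (map h l) x = f x" for x
    unfolding l(1)
  proof (induction l)
    case Nil
    then show ?case by (simp add: lin_op_def)
  next
    case (Cons t l)
    obtain a k \<theta> where [simp]: "t = (a, k, \<theta>)" by (cases t) auto
    show ?case using Cons pos[of k] by (simp add: lin_op_Cons h_def)
  qed
  have norms: "trig_norm (trig_deriv j (map h l)) \<le> K * B" if "j \<le> 4" for j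
  proof -
    let ?g = "\<lambda>(a :: real, k, \<theta>). (a / ?\<sigma> k * of_int k ^ j, k, \<theta> + real j * (pi / 2))"
    have "trig_deriv j (map h l) = map ?g l" by (simp add: trig_deriv_def h_def case_prod_beta)
    moreover have "trig_norm (map ?g l) \<le> K * trig_norm l"
    proof (rule trig_norm_map_le)
      fix a \<theta> :: real and k :: int
      have "of_int \<bar>k\<bar> ^ j / ?\<sigma> k \<le> K" using \<sigma>(1)[OF that, of k] pos[of k] by (simp add: pos_divide_le_eq)
      hence "\<bar>a\<bar> * (of_int \<bar>k\<bar> ^ j / ?\<sigma> k) \<le> \<bar>a\<bar> * K" by (intro mult_left_mono) auto
      thus "\<bar>fst (?g (a, k, \<theta>))\<bar> \<le> K * \<bar>a\<bar>" using pos[of k] by (simp add: abs_mult power_abs mult_ac)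
    qed auto
    ultimately show ?thesis using le by simp
  qed
  have "real n * \<nu> * trig_norm (map h l) \<le> K * B"
  proof -
    have nl: "real n * \<nu> > 0" using n \<nu> by simp
    have "trig_norm (map h l) \<le> (K / (real n * \<nu>)) * trig_norm l"
    proof (rule trig_norm_map_le)
      fix a \<theta> :: real and k :: int
      have "1 / ?\<sigma> k \<le> K / (real n * \<nu>)" using \<sigma>(2)[of k] pos[of k] nl by (simp add: divide_simps mult_ac)
      hence "\<bar>a\<bar> * (1 / ?\<sigma> k) \<le> \<bar>a\<bar> * (K / (real n * \<nu>))" by (intro mult_left_mono) auto
      thus "\<bar>fst (h (a, k, \<theta>))\<bar> \<le> K / (real n * \<nu>) * \<bar>a\<bar>" using pos[of k] by (simp add: h_def mult_ac)
    qed (auto simp: h_def)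
    hence "real n * \<nu> * trig_norm (map h l) \<le> real n * \<nu> * ((K / (real n * \<nu>)) * trig_norm l)"
      using nl by (intro mult_left_mono) auto
    also have "\<dots> = K * trig_norm l" using n \<nu> by simp
    finally show ?thesis using le by simp
  qed
  with eq norms show ?thesis by (rule that)
qed

subsection \<open>The recursion\<close>

text \<open>The variable of the power series is the amplitude
  \<open>s = s0 * exp (\<nu> * t)\<close>, so the time derivative multiplies the coefficient of
  order \<open>m\<close> by \<open>m * \<nu>\<close>; \<open>x\<close> is a mere parameter.\<close>

definition mode_series :: "real \<Rightarrow> (nat \<Rightarrow> trig_poly) \<Rightarrow> nat \<Rightarrow> real \<Rightarrow> real fps" where
  "mode_series \<nu> L i x = Abs_fps (\<lambda>m. if i < 5 then trig (trig_deriv i (L m)) x else real m * \<nu> * trig (L m) x)"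

definition modes_bounded :: "real \<Rightarrow> (nat \<Rightarrow> real) \<Rightarrow> nat \<Rightarrow> trig_poly \<Rightarrow> bool" where
  "modes_bounded \<nu> b n l \<longleftrightarrow> (\<forall>j\<le>4. trig_norm (trig_deriv j l) \<le> b n) \<and> real n * \<nu> * trig_norm l \<le> b n"

lemma majorized_mode_series:
  assumes "\<And>n. modes_bounded \<nu> b n (L n)" "\<nu> > 0"
  shows "majorized (mode_series \<nu> L i) b"
  unfolding majorized_def
proof
  fix n
  show "trig_bound (\<lambda>x. fps_nth (mode_series \<nu> L i x) n) (b n)"
  proof (cases "i < 5")
    case True
    then show ?thesis using assms(1)[of n] trig_bound_trig[of "trig_deriv i (L n)" "b n"]
      by (simp add: mode_series_def modes_bounded_def)
  next
    case False
    have "trig_bound (\<lambda>x. (real n * \<nu>) * trig (L n) x) ((real n * \<nu>) * trig_norm (L n))"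
      using assms(2) by (intro trig_bound_mult trig_bound_const trig_bound_trig) auto
    hence "trig_bound (\<lambda>x. (real n * \<nu>) * trig (L n) x) (b n)"
      by (rule trig_bound_mono) (use assms(1)[of n] in \<open>simp add: modes_bounded_def\<close>)
    then show ?thesis using False by (simp add: mode_series_def)
  qed
qed

lemma fps_X_power_dvdI:
  assumes "\<And>m. m < n \<Longrightarrow> fps_nth A m = 0"
  shows "fps_X ^ n dvd (A :: 'a :: comm_ring_1 fps)"
proof -
  have "A = fps_X ^ n * fps_shift n A"
    using assms by (intro fps_ext) (simp add: fps_X_power_mult_nth)
  thus ?thesis by (metis dvd_triv_left)
qed

text \<open>The bound propagates because the smallness \<open>\<epsilon>\<close> of the quadratic
  terms beats the constant \<open>C\<close> of the nonlinearity times the constant \<open>K\<close>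
  of the inverse linear operator, at every order alike.\<close>

lemma formal_solution:
  assumes c: "c > 0" and \<nu>: "\<nu> > 0" "\<nu> = of_int k0 ^ 2 / c\<^sup>2 - of_int k0 ^ 4"
      "\<And>k::int. of_int k ^ 2 / c\<^sup>2 - of_int k ^ 4 \<le> \<nu>"
  obtains L \<delta> R where "\<delta> > 0" "R > 0" "L 0 = []" "L 1 = [(1, k0, 0)]"
    "\<And>n. modes_bounded \<nu> (geom_maj \<delta> R) n (L n)"
    "\<And>n x. lin_op c \<nu> n (L n) x = fps_nth (asd_N c (\<lambda>i. mode_series \<nu> L i x)) n"
proof -
  obtain K where K: "K > 0" "\<And>n k j. 2 \<le> n \<Longrightarrow> j \<le> 4 \<Longrightarrow> of_int \<bar>k\<bar> ^ j \<le> K * lin_symbol c \<nu> n k"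
    "\<And>n k. 2 \<le> n \<Longrightarrow> real n * \<nu> \<le> K * lin_symbol c \<nu> n k"
    using lin_symbol_lower[OF c \<nu>(1,3)] by blast
  obtain C where C: "C \<ge> 0"
    "\<And>b \<epsilon> H n. majorant b \<epsilon> H \<Longrightarrow> trig_bound (\<lambda>x. fps_nth (asd_N c (\<lambda>i. H i x)) n) (C * \<epsilon> * b n)"
    using asd_N_majorized[of c] by blast
  \<comment> \<open>Chosen so that \<open>K * C * \<epsilon> \<le> 1\<close>, which lets the bound
    \<open>b n\<close> reproduce itself. Then \<open>\<delta> = \<epsilon> / 8\<close> turns the
    factor of \<open>geom_maj_conv\<close> into \<open>\<epsilon>\<close>, and \<open>R\<close>
    remains free to fit the first mode: \<open>M\<close> bounds it with all its derivatives, and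
    \<open>R = M / \<delta>\<close> gives \<open>b 1 = M\<close>.\<close>
  define \<epsilon> where "\<epsilon> = 1 / (K * C + 1)"
  have KC: "K * C \<ge> 0" using K(1) C(1) by simp
  have \<epsilon>: "\<epsilon> > 0" "\<epsilon> \<le> 1" "K * (C * \<epsilon>) \<le> 1" using KC by (auto simp: \<epsilon>_def field_simps)
  define \<delta> where "\<delta> = \<epsilon> / 8"
  have \<delta>: "\<delta> > 0" "8 * \<delta> = \<epsilon>" using \<epsilon> by (auto simp: \<delta>_def)
  define M where "M = (1 + of_int k0 ^ 4 + \<nu>) * exp (of_int \<bar>k0\<bar> :: real)"
  have M: "M > 0" unfolding M_def using \<nu>(1) by (intro mult_pos_pos add_nonneg_pos) auto
  define R where "R = M / \<delta>"
  have R: "R > 0" "\<delta> * R = M" using M \<delta> by (auto simp: R_def)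
  define b where "b = geom_maj \<delta> R"
  have b_nonneg: "b n \<ge> 0" for n using \<delta> R by (simp add: b_def geom_maj_def)
  have b0: "b 0 = 0" and b1: "b 1 = M" using R by (simp_all add: b_def geom_maj_def)
  \<comment> \<open>Modes of order \<open>n\<close> and above are erased, so that the condition on
    the \<open>n\<close>-th mode refers to earlier ones only.\<close>
  define trunc :: "nat \<Rightarrow> (nat \<Rightarrow> trig_poly) \<Rightarrow> nat \<Rightarrow> trig_poly" where
    "trunc n f m = (if m < n then f m else [])" for n f m
  define P where "P f n l \<longleftrightarrow> (n = 0 \<longrightarrow> l = []) \<and> (n = 1 \<longrightarrow> l = [(1, k0, 0)]) \<and>
     (2 \<le> n \<longrightarrow> (\<forall>x. lin_op c \<nu> n l x = fps_nth (asd_N c (\<lambda>i. mode_series \<nu> (trunc n f) i x)) n)) \<and>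
     modes_bounded \<nu> b n l" for f n l
  have "\<exists>f. \<forall>n. P f n (f n)"
  proof (rule dependent_wf_choice[OF wf_less_than])
    fix f g :: "nat \<Rightarrow> trig_poly" and n r assume "\<And>m. (m, n) \<in> less_than \<Longrightarrow> f m = g m"
    hence "trunc n f = trunc n g" by (auto simp: trunc_def fun_eq_iff)
    thus "P f n r = P g n r" by (simp add: P_def)
  next
    fix n and f :: "nat \<Rightarrow> trig_poly" assume IH: "\<And>m. (m, n) \<in> less_than \<Longrightarrow> P f m (f m)"
    consider "n = 0" | "n = 1" | "2 \<le> n" by linarith
    thus "\<exists>l. P f n l"
    proof cases
      case 1
      then show ?thesis by (intro exI[of _ "[]"]) (simp add: P_def modes_bounded_def b0)
    next
      case 2
      have "of_int \<bar>k0\<bar> ^ j \<le> (1 + of_int k0 ^ 4 + \<nu> :: real)" if "j \<le> 4" for j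
      proof (cases "k0 = 0")
        case True
        then show ?thesis using \<nu>(1) by (cases j) auto
      next
        case False
        hence "(1::real) \<le> of_int \<bar>k0\<bar>" by linarith
        hence "of_int \<bar>k0\<bar> ^ j \<le> (of_int \<bar>k0\<bar> ^ 4 :: real)" using that by (intro power_increasing) auto
        thus ?thesis using \<nu>(1) by simp
      qed
      hence "of_int \<bar>k0\<bar> ^ j * exp (of_int \<bar>k0\<bar>) \<le> M" if "j \<le> 4" for j
        unfolding M_def using that by (intro mult_right_mono) auto
      moreover have "\<nu> * exp (of_int \<bar>k0\<bar>) \<le> M" unfolding M_def by (intro mult_right_mono) auto
      ultimately have "modes_bounded \<nu> b 1 [(1, k0, 0)]"
        using b1 by (auto simp: modes_bounded_def power_abs)
      then show ?thesis using 2 by (intro exI[of _ "[(1, k0, 0)]"]) (simp add: P_def)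
    next
      case 3
      have mb: "modes_bounded \<nu> b m (trunc n f m)" for m
        using IH[of m] b_nonneg[of m] unfolding P_def trunc_def by (auto simp: modes_bounded_def)
      have "majorant b \<epsilon> (mode_series \<nu> (trunc n f))"
        unfolding majorant_def
        using \<epsilon> b_nonneg majorized_mode_series[OF mb \<nu>(1)] geom_maj_conv[of \<delta> R] \<delta> R(1) unfolding b_def by auto
      from lin_op_solve[OF C(2)[OF this] 3 K(1) K(2)[OF 3] K(3)[OF 3] \<nu>(1)]
      obtain l where l: "\<And>x. lin_op c \<nu> n l x = fps_nth (asd_N c (\<lambda>i. mode_series \<nu> (trunc n f) i x)) n"
        "\<And>j. j \<le> 4 \<Longrightarrow> trig_norm (trig_deriv j l) \<le> K * (C * \<epsilon> * b n)"
        "real n * \<nu> * trig_norm l \<le> K * (C * \<epsilon> * b n)" by blast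
      have "K * (C * \<epsilon> * b n) \<le> b n"
        using mult_right_mono[OF \<epsilon>(3) b_nonneg[of n]] by (simp add: mult_ac)
      hence "modes_bounded \<nu> b n l" using l(2,3) by (force simp: modes_bounded_def)
      thus ?thesis using 3 l(1) by (intro exI[of _ l]) (simp add: P_def)
    qed
  qed
  then obtain L where L: "\<And>n. P L n (L n)" by blast
  show ?thesis
  proof (rule that[OF \<delta>(1) R(1)])
    show L0: "L 0 = []" using L[of 0] by (simp add: P_def)
    show L1: "L 1 = [(1, k0, 0)]" using L[of 1] by (simp add: P_def)
    show "modes_bounded \<nu> (geom_maj \<delta> R) n (L n)" for n using L[of n] by (simp add: P_def b_def)
    fix n x
    have X: "fps_X dvd mode_series \<nu> M i x" if "M 0 = []" for M i
    proof -
      have "fps_nth (mode_series \<nu> M i x) 0 = 0" using that by (simp add: mode_series_def)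
      thus ?thesis using fps_X_power_dvdI[of 1 "mode_series \<nu> M i x"] by simp
    qed
    have agree: "agree_below n (\<lambda>i. mode_series \<nu> L i x) (\<lambda>i. mode_series \<nu> (trunc n L) i x)"
      unfolding agree_below_def
    proof (intro allI impI conjI X)
      fix i
      show "fps_X ^ n dvd mode_series \<nu> L i x - mode_series \<nu> (trunc n L) i x"
        by (rule fps_X_power_dvdI) (simp add: mode_series_def trunc_def)
    qed (use L0 in \<open>auto simp: trunc_def\<close>)
    have N: "fps_nth (asd_N c (\<lambda>i. mode_series \<nu> L i x)) n = fps_nth (asd_N c (\<lambda>i. mode_series \<nu> (trunc n L) i x)) n"
      by (rule asd_N_nth_cong[OF agree])
    consider "n = 0" | "n = 1" | "2 \<le> n" by linarith
    thus "lin_op c \<nu> n (L n) x = fps_nth (asd_N c (\<lambda>i. mode_series \<nu> L i x)) n"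
    proof cases
      case 3
      then show ?thesis using L[of n] N by (simp add: P_def)
    next
      case 1
      have "mode_series \<nu> (trunc n L) i x = 0" for i by (intro fps_ext) (simp add: mode_series_def trunc_def 1)
      then show ?thesis unfolding N using asd_N_zero[of c] 1 L0 by (simp add: lin_op_def)
    next
      case 2
      have "mode_series \<nu> (trunc n L) i x = 0" for i
        by (intro fps_ext) (simp add: mode_series_def trunc_def 2 L0)
      hence "fps_nth (asd_N c (\<lambda>i. mode_series \<nu> L i x)) n = 0" unfolding N using asd_N_zero[of c] by simp
      \<comment> \<open>At order 1 there is nothing to solve: mode \<open>k0\<close> grows exactly
        at the rate \<open>\<nu>\<close>, so it lies in the kernel.\<close>
      moreover have "lin_symbol c \<nu> 1 k0 = 0"
        using c unfolding lin_symbol_def \<nu>(2) by (simp add: field_simps power2_eq_square power3_eq_cube)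
      hence "lin_op c \<nu> 1 [(1, k0, 0)] x = 0" by (simp add: lin_op_Cons) (simp add: lin_op_def)
      ultimately show ?thesis using 2 L1 by simp
    qed
  qed
qed

section \<open>Orbits on the unstable manifold\<close>

text \<open>Space modes and coefficients are separated because time enters through the coefficients
  only: orbit, velocity, differences and difference quotients are all superpositions of the same
  modes.\<close>

definition superpose :: "(nat \<Rightarrow> trig_poly) \<Rightarrow> (nat \<Rightarrow> real) \<Rightarrow> real \<Rightarrow> real" where
  "superpose \<Phi> a x = (\<Sum>n. a n * trig (\<Phi> n) x)"

definition superpose_deriv :: "(nat \<Rightarrow> trig_poly) \<Rightarrow> nat \<Rightarrow> (nat \<Rightarrow> real) \<Rightarrow> real \<Rightarrow> real" where
  "superpose_deriv \<Phi> j a x = (\<Sum>n. a n * trig (trig_deriv j (\<Phi> n)) x)"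

definition curve :: "(nat \<Rightarrow> trig_poly) \<Rightarrow> (nat \<Rightarrow> real \<Rightarrow> real) \<Rightarrow> real \<Rightarrow> real \<Rightarrow> real" where
  "curve \<Phi> a t = superpose \<Phi> (\<lambda>n. a n t)"

text \<open>The factor of \<open>smooth_in_little_holder\<close>, times the factorial that bounds
  derivatives up to order \<open>k + 1\<close> by the exponentially weighted norm.\<close>

definition lh_const :: "real \<Rightarrow> real" where
  "lh_const s = (real (nat \<lfloor>s\<rfloor>) + 5) * fact (Suc (nat \<lfloor>s\<rfloor>))"

lemma lh_norm_nonneg: "f \<in> lh s \<Longrightarrow> 0 \<le> lh_norm s f"
  using abs_deriv_le_holder_norm[OF lh_holder_space, of f s 0 0] unfolding lh_norm_def by auto

lemma lh_const_nonneg: "lh_const s \<ge> 0"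
  by (simp add: lh_const_def)

section \<open>Superpositions of fixed modes with variable coefficients\<close>

context
  fixes \<Phi> :: "nat \<Rightarrow> trig_poly" and \<beta> :: "nat \<Rightarrow> real"
  assumes \<beta>: "\<And>n. trig_norm (\<Phi> n) \<le> \<beta> n"
begin

lemma superpose_term_le: "\<bar>a * trig (trig_deriv j (\<Phi> n)) x\<bar> \<le> fact j * (\<bar>a\<bar> * \<beta> n)"
proof -
  have "\<bar>a * trig (trig_deriv j (\<Phi> n)) x\<bar> \<le> \<bar>a\<bar> * (fact j * trig_norm (\<Phi> n))"
    unfolding abs_mult by (intro mult_left_mono abs_trig_deriv_le) auto
  also have "\<dots> \<le> \<bar>a\<bar> * (fact j * \<beta> n)" by (intro mult_left_mono \<beta>) auto
  finally show ?thesis by (simp add: mult_ac)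
qed

lemma superpose_summable:
  assumes "summable (\<lambda>n. \<bar>a n\<bar> * \<beta> n)"
  shows "summable (\<lambda>n. a n * trig (trig_deriv j (\<Phi> n)) x)"
  by (rule summable_comparison_test'[OF summable_mult[OF assms, of "fact j"], of 0])
     (simp add: superpose_term_le del: abs_mult)

lemma superpose_deriv_abs_le:
  assumes "summable (\<lambda>n. \<bar>a n\<bar> * \<beta> n)"
  shows "\<bar>superpose_deriv \<Phi> j a x\<bar> \<le> fact j * (\<Sum>n. \<bar>a n\<bar> * \<beta> n)"
proof -
  have "norm (\<Sum>n. a n * trig (trig_deriv j (\<Phi> n)) x) \<le> (\<Sum>n. fact j * (\<bar>a n\<bar> * \<beta> n))"
    by (rule norm_suminf_le[OF _ summable_mult[OF assms]]) (simp only: real_norm_def superpose_term_le)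
  thus ?thesis using suminf_mult[OF assms, of "fact j"] by (simp add: superpose_deriv_def)
qed

lemma superpose_deriv_has_deriv:
  assumes "summable (\<lambda>n. \<bar>a n\<bar> * \<beta> n)"
  shows "(superpose_deriv \<Phi> j a has_real_derivative superpose_deriv \<Phi> (Suc j) a x) (at x)"
  unfolding superpose_deriv_def[abs_def]
proof (rule has_field_derivative_series'(2)[of UNIV _ _ 0])
  show "((\<lambda>x. a n * trig (trig_deriv j (\<Phi> n)) x) has_real_derivative a n * trig (trig_deriv (Suc j) (\<Phi> n)) x)
      (at x within UNIV)" for n x
    using DERIV_cmult[OF trig_has_deriv] by simp
  show "uniformly_convergent_on UNIV (\<lambda>n x. \<Sum>i<n. a i * trig (trig_deriv (Suc j) (\<Phi> i)) x)"
    by (rule Weierstrass_m_test'[OF _ summable_mult[OF assms, of "fact (Suc j)"]])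
       (simp only: real_norm_def superpose_term_le)
  show "summable (\<lambda>n. a n * trig (trig_deriv j (\<Phi> n)) 0)" by (rule superpose_summable[OF assms])
qed auto

lemma torus_fun_superpose: "torus_fun (superpose \<Phi> a)"
  using torus_fun_trig by (simp add: torus_fun_def superpose_def)

lemma superpose_smooth:
  assumes "summable (\<lambda>n. \<bar>a n\<bar> * \<beta> n)" and \<gamma>: "0 < \<gamma>" "\<gamma> < 1"
  shows "superpose \<Phi> a \<in> little_holder_space k \<gamma>"
    and "holder_norm k \<gamma> (superpose \<Phi> a) \<le> (real k + 5) * (fact (Suc k) * (\<Sum>n. \<bar>a n\<bar> * \<beta> n))"
proof -
  have S: "(\<Sum>n. \<bar>a n\<bar> * \<beta> n) \<ge> 0"
    using \<beta> trig_norm_nonneg by (intro suminf_nonneg assms(1)) (meson abs_ge_zero mult_nonneg_nonneg order_trans)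
  have B: "\<bar>superpose_deriv \<Phi> j a x\<bar> \<le> fact (Suc k) * (\<Sum>n. \<bar>a n\<bar> * \<beta> n)" if "j \<le> Suc k" for j x
  proof -
    have "\<bar>superpose_deriv \<Phi> j a x\<bar> \<le> fact j * (\<Sum>n. \<bar>a n\<bar> * \<beta> n)" by (rule superpose_deriv_abs_le[OF assms(1)])
    also have "\<dots> \<le> fact (Suc k) * (\<Sum>n. \<bar>a n\<bar> * \<beta> n)" using that S by (intro mult_right_mono fact_mono) auto
    finally show ?thesis .
  qed
  have e: "superpose \<Phi> a = superpose_deriv \<Phi> 0 a" by (simp add: superpose_def[abs_def] superpose_deriv_def[abs_def])
  note * = smooth_in_little_holder[of k "\<lambda>j. superpose_deriv \<Phi> j a", OF superpose_deriv_has_deriv[OF assms(1)] B _ \<gamma>]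
  show "superpose \<Phi> a \<in> little_holder_space k \<gamma>"
    "holder_norm k \<gamma> (superpose \<Phi> a) \<le> (real k + 5) * (fact (Suc k) * (\<Sum>n. \<bar>a n\<bar> * \<beta> n))"
    using * torus_fun_superpose[of a] unfolding e by auto
qed

lemma superpose_lh:
  assumes "summable (\<lambda>n. \<bar>a n\<bar> * \<beta> n)" and s: "s \<notin> \<int>"
  shows "superpose \<Phi> a \<in> lh s" and "lh_norm s (superpose \<Phi> a) \<le> lh_const s * (\<Sum>n. \<bar>a n\<bar> * \<beta> n)"
proof -
  have f: "0 < frac s" "frac s < 1" using s frac_ge_0[of s] frac_eq_0_iff[of s] frac_lt_1[of s] by linarith+
  show "superpose \<Phi> a \<in> lh s" unfolding lh_def by (rule superpose_smooth(1)[OF assms(1) f])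
  show "lh_norm s (superpose \<Phi> a) \<le> lh_const s * (\<Sum>n. \<bar>a n\<bar> * \<beta> n)"
    using superpose_smooth(2)[OF assms(1) f] by (simp add: lh_norm_def lh_const_def mult.assoc)
qed

lemma superpose_lincomb:
  assumes "summable (\<lambda>n. \<bar>a n\<bar> * \<beta> n)" "summable (\<lambda>n. \<bar>a' n\<bar> * \<beta> n)"
  shows "(\<lambda>x. p * superpose \<Phi> a x + q * superpose \<Phi> a' x) = superpose \<Phi> (\<lambda>n. p * a n + q * a' n)"
proof
  fix x
  have s: "summable (\<lambda>n. a n * trig (\<Phi> n) x)" "summable (\<lambda>n. a' n * trig (\<Phi> n) x)"
    using superpose_summable[OF assms(1), of 0 x] superpose_summable[OF assms(2), of 0 x] by auto
  show "p * superpose \<Phi> a x + q * superpose \<Phi> a' x = superpose \<Phi> (\<lambda>n. p * a n + q * a' n) x"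
    unfolding superpose_def suminf_mult[OF s(1), symmetric] suminf_mult[OF s(2), symmetric]
    by (subst suminf_add[OF summable_mult[OF s(1)] summable_mult[OF s(2)]]) (simp add: algebra_simps)
qed

lemma superpose_summable_le:
  assumes "\<And>n. \<bar>a n\<bar> \<le> K * M n" and M: "summable (\<lambda>n. M n * \<beta> n)"
  shows "summable (\<lambda>n. \<bar>a n\<bar> * \<beta> n)" and "(\<Sum>n. \<bar>a n\<bar> * \<beta> n) \<le> K * (\<Sum>n. M n * \<beta> n)"
proof -
  have b0: "\<beta> n \<ge> 0" for n using \<beta>[of n] trig_norm_nonneg[of "\<Phi> n"] by linarith
  have le: "\<bar>a n\<bar> * \<beta> n \<le> K * (M n * \<beta> n)" for n
    using mult_right_mono[OF assms(1) b0] by (simp add: mult_ac)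
  show sm: "summable (\<lambda>n. \<bar>a n\<bar> * \<beta> n)"
    by (rule summable_comparison_test'[OF summable_mult[OF M, of K], of 0]) (use le b0 in \<open>auto simp: abs_mult\<close>)
  have "(\<Sum>n. \<bar>a n\<bar> * \<beta> n) \<le> (\<Sum>n. K * (M n * \<beta> n))" by (intro suminf_le le sm summable_mult M)
  also have "\<dots> = K * (\<Sum>n. M n * \<beta> n)" by (rule suminf_mult[OF M])
  finally show "(\<Sum>n. \<bar>a n\<bar> * \<beta> n) \<le> K * (\<Sum>n. M n * \<beta> n)" .
qed

lemma superpose_lh_le:
  assumes a: "\<And>n. \<bar>a n\<bar> \<le> K * M n" and M: "summable (\<lambda>n. M n * \<beta> n)" and s: "s \<notin> \<int>"
  shows "superpose \<Phi> a \<in> lh s" and "lh_norm s (superpose \<Phi> a) \<le> lh_const s * (K * (\<Sum>n. M n * \<beta> n))"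
proof -
  note sm = superpose_summable_le(1)[OF a M]
  show "superpose \<Phi> a \<in> lh s" by (rule superpose_lh(1)[OF sm s])
  from superpose_summable_le(2)[OF a M] have "lh_const s * (\<Sum>n. \<bar>a n\<bar> * \<beta> n) \<le> lh_const s * (K * (\<Sum>n. M n * \<beta> n))"
    using lh_const_nonneg by (rule mult_left_mono)
  with superpose_lh(2)[OF sm s] show "lh_norm s (superpose \<Phi> a) \<le> lh_const s * (K * (\<Sum>n. M n * \<beta> n))"
    by (rule order_trans)
qed

context
  fixes a :: "nat \<Rightarrow> real \<Rightarrow> real" and M :: "nat \<Rightarrow> real" and tb s :: real
  assumes M: "summable (\<lambda>n. M n * \<beta> n)" and s: "s \<notin> \<int>"
    and a: "\<And>n t. t \<in> {0..tb} \<Longrightarrow> \<bar>a n t\<bar> \<le> M n"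
      "\<And>n t \<tau>. t \<in> {0..tb} \<Longrightarrow> \<tau> \<in> {0..tb} \<Longrightarrow> \<bar>a n t - a n \<tau>\<bar> \<le> M n * \<bar>t - \<tau>\<bar>"
begin

lemma summable_curve: "t \<in> {0..tb} \<Longrightarrow> summable (\<lambda>n. \<bar>a n t\<bar> * \<beta> n)"
  by (rule superpose_summable_le(1)[of "\<lambda>n. a n t" 1 M, OF _ M]) (use a in auto)

lemma curve_lh: "t \<in> {0..tb} \<Longrightarrow> curve \<Phi> a t \<in> lh s"
  unfolding curve_def by (rule superpose_lh(1)[OF summable_curve s])

text \<open>The single estimate behind all continuity claims: \<open>p = q = 1\<close> gives
  Lipschitz continuity in time, and values of a weight at two times give the uniform continuity
  required by \<open>BUC\<close>.\<close>

lemma scaled_curve_diff: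
  assumes t: "t \<in> {0..tb}" "\<tau> \<in> {0..tb}"
  shows "lh_norm s (\<lambda>x. p * curve \<Phi> a t x - q * curve \<Phi> a \<tau> x)
    \<le> lh_const s * ((\<bar>p - q\<bar> + \<bar>q\<bar> * \<bar>t - \<tau>\<bar>) * (\<Sum>n. M n * \<beta> n))"
proof -
  have e: "(\<lambda>x. p * curve \<Phi> a t x - q * curve \<Phi> a \<tau> x) = superpose \<Phi> (\<lambda>n. p * a n t + - q * a n \<tau>)"
    unfolding curve_def superpose_lincomb[OF summable_curve[OF t(1)] summable_curve[OF t(2)], symmetric] by simp
  show ?thesis unfolding e
  proof (rule superpose_lh_le(2)[OF _ M s])
    fix n
    have "\<bar>p * a n t + - q * a n \<tau>\<bar> = \<bar>(p - q) * a n t + q * (a n t - a n \<tau>)\<bar>" by (simp add: algebra_simps)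
    also have "\<dots> \<le> \<bar>p - q\<bar> * \<bar>a n t\<bar> + \<bar>q\<bar> * \<bar>a n t - a n \<tau>\<bar>" by (metis abs_mult abs_triangle_ineq)
    also have "\<dots> \<le> \<bar>p - q\<bar> * M n + \<bar>q\<bar> * (M n * \<bar>t - \<tau>\<bar>)"
      using a t by (intro add_mono mult_left_mono) auto
    finally show "\<bar>p * a n t + - q * a n \<tau>\<bar> \<le> (\<bar>p - q\<bar> + \<bar>q\<bar> * \<bar>t - \<tau>\<bar>) * M n" by (simp add: algebra_simps)
  qed
qed

lemma scaled_curve_lh:
  assumes t: "t \<in> {0..tb}"
  shows "(\<lambda>x. p * curve \<Phi> a t x) \<in> lh s" "lh_norm s (\<lambda>x. p * curve \<Phi> a t x) \<le> lh_const s * (\<bar>p\<bar> * (\<Sum>n. M n * \<beta> n))"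
proof -
  have e: "(\<lambda>x. p * curve \<Phi> a t x) = superpose \<Phi> (\<lambda>n. p * a n t)"
    using superpose_lincomb[OF summable_curve[OF t] summable_curve[OF t], of p 0] by (simp add: curve_def)
  have b: "\<bar>p * a n t\<bar> \<le> \<bar>p\<bar> * M n" for n using a(1)[OF t] by (simp add: abs_mult mult_left_mono)
  show "(\<lambda>x. p * curve \<Phi> a t x) \<in> lh s" "lh_norm s (\<lambda>x. p * curve \<Phi> a t x) \<le> lh_const s * (\<bar>p\<bar> * (\<Sum>n. M n * \<beta> n))"
    unfolding e by (rule superpose_lh_le[OF b M s])+
qed

lemma curve_diff_lh:
  assumes t: "t \<in> {0..tb}" "\<tau> \<in> {0..tb}"
  shows "(\<lambda>x. p * curve \<Phi> a t x - q * curve \<Phi> a \<tau> x) \<in> holder_space (nat \<lfloor>s\<rfloor>) (frac s)"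
  using holder_space_lincomb(1)[OF lh_holder_space[OF curve_lh[OF t(1)]] lh_holder_space[OF curve_lh[OF t(2)]], of p "-q"]
  by simp

lemma continuous_lh_curve: "continuous_lh s {0..tb} (curve \<Phi> a)"
  unfolding continuous_lh_def
proof (intro ballI conjI curve_lh)
  fix t assume t: "t \<in> {0..tb}"
  let ?K = "lh_const s * (\<Sum>n. M n * \<beta> n)"
  have "((\<lambda>\<tau>. ?K * \<bar>\<tau> - t\<bar>) \<longlongrightarrow> ?K * \<bar>t - t\<bar>) (at t within {0..tb})" by (intro tendsto_intros)
  hence lim: "((\<lambda>\<tau>. ?K * \<bar>\<tau> - t\<bar>) \<longlongrightarrow> 0) (at t within {0..tb})" by simp
  show "((\<lambda>\<tau>. lh_norm s (\<lambda>x. curve \<Phi> a \<tau> x - curve \<Phi> a t x)) \<longlongrightarrow> 0) (at t within {0..tb})"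
  proof (rule Lim_null_comparison[OF _ lim])
    have "norm (lh_norm s (\<lambda>x. curve \<Phi> a \<tau> x - curve \<Phi> a t x)) \<le> ?K * \<bar>\<tau> - t\<bar>" if "\<tau> \<in> {0..tb}" for \<tau>
    proof -
      have "0 \<le> lh_norm s (\<lambda>x. curve \<Phi> a \<tau> x - curve \<Phi> a t x)"
        using abs_deriv_le_holder_norm[OF curve_diff_lh[OF that t, of 1 1], of 0 0] unfolding lh_norm_def by auto
      thus ?thesis using scaled_curve_diff[OF that t, of 1 1] by (simp add: mult_ac)
    qed
    thus "\<forall>\<^sub>F \<tau> in at t within {0..tb}. norm (lh_norm s (\<lambda>x. curve \<Phi> a \<tau> x - curve \<Phi> a t x)) \<le> ?K * \<bar>\<tau> - t\<bar>"
      by (auto simp: eventually_at_filter)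
  qed
qed

lemma BUC_scaled_curve:
  assumes J: "J \<subseteq> {0..tb}" and tb: "0 \<le> tb" and w: "uniformly_continuous_on {0..tb} w"
  shows "BUC s J (\<lambda>t x. w t * curve \<Phi> a t x)"
  unfolding BUC_def
proof (intro conjI ballI allI impI)
  show "(\<lambda>x. w t * curve \<Phi> a t x) \<in> lh s" if "t \<in> J" for t using scaled_curve_lh(1) J that by blast
  let ?S = "\<Sum>n. M n * \<beta> n"
  have b0: "\<beta> n \<ge> 0" for n using \<beta>[of n] trig_norm_nonneg[of "\<Phi> n"] by linarith
  have "M n \<ge> 0" for n using a(1)[of 0 n] tb by auto
  hence S0: "?S \<ge> 0" by (intro suminf_nonneg M mult_nonneg_nonneg b0)
  have "bounded (w ` {0..tb})"
    by (intro compact_imp_bounded compact_continuous_image uniformly_continuous_imp_continuous w) auto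
  hence "\<exists>W. \<forall>t\<in>{0..tb}. \<bar>w t\<bar> \<le> W" by (simp add: bounded_iff)
  then obtain W where W: "\<And>t. t \<in> {0..tb} \<Longrightarrow> \<bar>w t\<bar> \<le> W" by blast
  have W0: "W \<ge> 0" using W[of 0] tb by auto
  show "\<exists>B. \<forall>t\<in>J. lh_norm s (\<lambda>x. w t * curve \<Phi> a t x) \<le> B"
  proof (intro exI ballI)
    fix t assume "t \<in> J"
    hence t: "t \<in> {0..tb}" using J by auto
    have "lh_norm s (\<lambda>x. w t * curve \<Phi> a t x) \<le> lh_const s * (\<bar>w t\<bar> * ?S)" by (rule scaled_curve_lh(2)[OF t])
    also have "\<dots> \<le> lh_const s * (W * ?S)" by (intro mult_left_mono mult_right_mono W t S0 lh_const_nonneg)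
    finally show "lh_norm s (\<lambda>x. w t * curve \<Phi> a t x) \<le> lh_const s * (W * ?S)" .
  qed
  fix e :: real assume e: "e > 0"
  define K where "K = lh_const s * ?S + 1"
  have K: "K > 0" "lh_const s * ?S \<le> K" using S0 lh_const_nonneg[of s] by (auto simp: K_def add_nonneg_pos)
  define e' where "e' = e / (2 * K)"
  have e': "e' > 0" using e K by (simp add: e'_def)
  obtain d where d: "d > 0" "\<And>t \<tau>. t \<in> {0..tb} \<Longrightarrow> \<tau> \<in> {0..tb} \<Longrightarrow> \<bar>\<tau> - t\<bar> < d \<Longrightarrow> \<bar>w \<tau> - w t\<bar> < e'"
    using w e' unfolding uniformly_continuous_on_def dist_real_def by metis
  define d' where "d' = min d (e' / (W + 1))"
  have d': "d' > 0" using d e' W0 by (simp add: d'_def)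
  show "\<exists>d>0. \<forall>t\<in>J. \<forall>\<tau>\<in>J. \<bar>t - \<tau>\<bar> < d \<longrightarrow> lh_norm s (\<lambda>x. w t * curve \<Phi> a t x - w \<tau> * curve \<Phi> a \<tau> x) < e"
  proof (intro exI[of _ d'] conjI d' ballI impI)
    fix t \<tau> assume "t \<in> J" "\<tau> \<in> J" and lt: "\<bar>t - \<tau>\<bar> < d'"
    hence t: "t \<in> {0..tb}" "\<tau> \<in> {0..tb}" using J by auto
    have 1: "\<bar>w t - w \<tau>\<bar> < e'" using lt d(2)[OF t(2,1)] by (auto simp: d'_def)
    have "\<bar>w \<tau>\<bar> * \<bar>t - \<tau>\<bar> \<le> W * (e' / (W + 1))"
      using W[OF t(2)] lt W0 by (intro mult_mono) (auto simp: d'_def)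
    also have "\<dots> \<le> e'" using W0 e' by (simp add: field_simps)
    finally have "\<bar>w t - w \<tau>\<bar> + \<bar>w \<tau>\<bar> * \<bar>t - \<tau>\<bar> \<le> 2 * e'" using 1 by linarith
    hence "(\<bar>w t - w \<tau>\<bar> + \<bar>w \<tau>\<bar> * \<bar>t - \<tau>\<bar>) * (lh_const s * ?S) \<le> 2 * e' * (lh_const s * ?S)"
      using S0 lh_const_nonneg by (intro mult_right_mono) auto
    also have "\<dots> < 2 * e' * K" using e' by (simp add: K_def)
    also have "\<dots> = e" using K by (simp add: e'_def)
    finally show "lh_norm s (\<lambda>x. w t * curve \<Phi> a t x - w \<tau> * curve \<Phi> a \<tau> x) < e"
      using scaled_curve_diff[OF t, of "w t" "w \<tau>"] by (simp add: mult_ac)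
  qed
qed

text \<open>The curve is bounded down to time 0, so for \<open>\<mu> < 1\<close> the weight alone
  forces the limit 0; for \<open>\<mu> = 1\<close> the weight is the constant 1.\<close>

lemma C_weighted_curve:
  assumes tb: "0 < tb" and \<mu>: "\<mu> \<le> 1"
  shows "C_weighted \<mu> s (ereal tb) (curve \<Phi> a)"
  unfolding C_weighted_def
proof (intro conjI allI impI)
  show "continuous_lh s {t. 0 < t \<and> ereal t < ereal tb} (curve \<Phi> a)"
    by (rule continuous_lh_subset[OF continuous_lh_curve]) auto
  fix T :: real assume T: "0 < T" "ereal T < ereal tb"
  have sub: "{0..T} \<subseteq> {0..tb}" "{0..T} - {0} \<subseteq> {0..tb}" using T by auto
  show "BUC_weighted \<mu> s {0..T} (curve \<Phi> a)"
  proof (cases "\<mu> = 1")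
    case True
    have "BUC s {0..T} (\<lambda>t x. 1 * curve \<Phi> a t x)"
      using BUC_scaled_curve[OF sub(1), of "\<lambda>t. 1"] tb by (simp add: uniformly_continuous_on_const)
    then show ?thesis using True by (simp add: BUC_weighted_def)
  next
    case False
    hence m: "1 - \<mu> > 0" using \<mu> by simp
    have cw: "continuous_on {0..tb} (\<lambda>t. t powr (1 - \<mu>))"
      using m by (intro continuous_on_powr') (auto intro: continuous_intros)
    have "BUC s ({0..T} - {0}) (\<lambda>t x. t powr (1 - \<mu>) * curve \<Phi> a t x)"
      using BUC_scaled_curve[OF sub(2), of "\<lambda>t. t powr (1 - \<mu>)"] tb cw by (auto intro: compact_uniformly_continuous)
    moreover have "continuous_lh s ({0..T} - {0}) (curve \<Phi> a)"
      by (rule continuous_lh_subset[OF continuous_lh_curve sub(2)])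
    moreover have "((\<lambda>t. t powr (1 - \<mu>) * lh_norm s (curve \<Phi> a t)) \<longlongrightarrow> 0) (at 0 within ({0..T} - {0}))"
    proof -
      let ?K = "lh_const s * (\<Sum>n. M n * \<beta> n)"
      have "((\<lambda>t. t powr (1 - \<mu>)) \<longlongrightarrow> 0 powr (1 - \<mu>)) (at 0 within {0..tb})"
        by (rule cw[unfolded continuous_on_def, THEN bspec]) (use tb in simp)
      hence "((\<lambda>t. t powr (1 - \<mu>)) \<longlongrightarrow> 0) (at 0 within ({0..T} - {0}))"
        using sub(2) m by (auto intro: tendsto_within_subset)
      hence lim: "((\<lambda>t. t powr (1 - \<mu>) * ?K) \<longlongrightarrow> 0) (at 0 within ({0..T} - {0}))"
        by (rule tendsto_mult_left_zero)
      show ?thesis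
      proof (rule Lim_null_comparison[OF _ lim])
        have "norm (t powr (1 - \<mu>) * lh_norm s (curve \<Phi> a t)) \<le> t powr (1 - \<mu>) * ?K" if "t \<in> {0..T} - {0}" for t
        proof -
          have t: "t \<in> {0..tb}" using that sub by blast
          have "0 \<le> lh_norm s (curve \<Phi> a t)" "lh_norm s (curve \<Phi> a t) \<le> ?K"
            using lh_norm_nonneg[OF curve_lh[OF t]] scaled_curve_lh(2)[OF t, of 1] by auto
          thus ?thesis by (simp add: mult_left_mono)
        qed
        thus "\<forall>\<^sub>F t in at 0 within {0..T} - {0}. norm (t powr (1 - \<mu>) * lh_norm s (curve \<Phi> a t)) \<le> t powr (1 - \<mu>) * ?K"
          by (auto simp: eventually_at_filter)
      qed
    qed
    ultimately show ?thesis using False by (simp add: BUC_weighted_def)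
  qed
qed

end

end

subsection \<open>Evaluation of the formal solution\<close>

text \<open>Convergence and value travel together, because \<open>eval_fps\<close> respects products
  only inside the discs of convergence.\<close>

definition evals :: "real \<Rightarrow> real fps \<Rightarrow> real \<Rightarrow> bool" where
  "evals s A v \<longleftrightarrow> ereal (norm s) < fps_conv_radius A \<and> eval_fps A s = v"

lemma evals_const: "evals s (fps_const c) c"
  by (simp add: evals_def)

lemma evals_one: "evals s 1 1"
  by (simp add: evals_def)

lemma evals_add: "evals s A u \<Longrightarrow> evals s B v \<Longrightarrow> evals s (A + B) (u + v)"
  unfolding evals_def using fps_conv_radius_add[of A B] eval_fps_add[of s A B]
  by (auto intro: less_le_trans[of _ "min (fps_conv_radius A) (fps_conv_radius B)"])

lemma evals_diff: "evals s A u \<Longrightarrow> evals s B v \<Longrightarrow> evals s (A - B) (u - v)"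
  unfolding evals_def using fps_conv_radius_diff[of A B] eval_fps_diff[of s A B]
  by (auto intro: less_le_trans[of _ "min (fps_conv_radius A) (fps_conv_radius B)"])

lemma evals_mult: "evals s A u \<Longrightarrow> evals s B v \<Longrightarrow> evals s (A * B) (u * v)"
  unfolding evals_def using fps_conv_radius_mult[of A B] eval_fps_mult[of s A B]
  by (auto intro: less_le_trans[of _ "min (fps_conv_radius A) (fps_conv_radius B)"])

lemma evals_asd_N:
  fixes c :: real and v :: "nat \<Rightarrow> real"
  assumes "\<And>i. i < 6 \<Longrightarrow> evals s (h i) (v i)"
  defines "g \<equiv> v 0" and "p \<equiv> v 1" and "q \<equiv> v 2" and "t \<equiv> v 3" and "z \<equiv> v 4" and "w \<equiv> v 5"
    and "r \<equiv> c + v 0" and "Q \<equiv> 1 + v 1 * v 1"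
  shows "evals s (asd_N c h) (p * p * (Q * Q * Q) + q * q * (3 * r * r * r * q * Q)
     - q * q * (r * r * Q * Q)
     + p * p * (2 * r * q * Q * Q) - p * t * (2 * r * r * Q * Q)
     + p * p * (7 * r * r * q * q * Q) + p * q * (10 * r * r * r * t * Q)
     - p * p * (18 * r * r * r * q * q * q)
     - (g * ((r * r + r * c + c * c) * (Q * Q * Q * Q)) + p * (p * (c * c * c) * (Q * Q * Q + Q * Q + Q + 1))) * w
     - (g * (Q * Q * Q) + p * (p * c * (Q * Q + Q + 1))) * q
     - (g * ((r * r + r * c + c * c) * (Q * Q)) + p * (p * (c * c * c) * (Q + 1))) * z)"
  unfolding asd_N_def Let_def assms(2-)
  by (intro evals_add evals_diff evals_mult evals_const evals_one assms(1)) auto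

text \<open>Undoes the preparation of the equation: the higher order terms are merged with the
  linear part again, and the denominators are restored.\<close>

lemma asd_polynomial_identity:
  fixes g p q t z w c r Q :: real
  assumes "c ^ 3 * (w + z) + c * q = p * p * (Q * Q * Q) + q * q * (3 * r * r * r * q * Q)
     - q * q * (r * r * Q * Q)
     + p * p * (2 * r * q * Q * Q) - p * t * (2 * r * r * Q * Q)
     + p * p * (7 * r * r * q * q * Q) + p * q * (10 * r * r * r * t * Q)
     - p * p * (18 * r * r * r * q * q * q)
     - (g * ((r * r + r * c + c * c) * (Q * Q * Q * Q)) + p * (p * (c * c * c) * (Q * Q * Q + Q * Q + Q + 1))) * w
     - (g * (Q * Q * Q) + p * (p * c * (Q * Q + Q + 1))) * q
     - (g * ((r * r + r * c + c * c) * (Q * Q)) + p * (p * (c * c * c) * (Q + 1))) * z"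
    and r: "r = c + g" "r > 0" and Q: "Q = 1 + p\<^sup>2"
  shows "w = - asd_a p * z + asd_b r p q * t + asd_c r p q"
proof -
  \<comment> \<open>The hypothesis with its expansion about \<open>c\<close> collapsed, which is the
    quasilinear equation times \<open>r ^ 3 * Q ^ 4\<close>.\<close>
  have 1: "r ^ 3 * Q ^ 4 * w = - (r * q * Q ^ 3) + p\<^sup>2 * Q ^ 3 + 2 * r * p\<^sup>2 * q * Q\<^sup>2 - r\<^sup>2 * q\<^sup>2 * Q\<^sup>2
      - 2 * r\<^sup>2 * p * t * Q\<^sup>2 - r ^ 3 * z * Q\<^sup>2 + 7 * r\<^sup>2 * p\<^sup>2 * q\<^sup>2 * Q + 3 * r ^ 3 * q ^ 3 * Q
      + 10 * r ^ 3 * p * q * t * Q - 18 * r ^ 3 * p\<^sup>2 * q ^ 3"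
    using assms(1) r(1) Q by algebra
  have Q0: "Q \<noteq> 0" unfolding Q using one_plus_square_pos[of p] by simp
  define i j where ij: "i = inverse r" "j = inverse Q"
  have ri: "r * i = 1" "Q * j = 1" using r(2) Q0 by (simp_all add: ij)
  have "w = r ^ 3 * Q ^ 4 * w * i ^ 3 * j ^ 4" using ri by algebra
  also have "\<dots> = - (j ^ 2) * z + (10 * p * q * j ^ 3 - 2 * p * (i * j ^ 2)) * t +
     (p\<^sup>2 * (i ^ 3 * j) - q * (i\<^sup>2 * j) + 2 * p\<^sup>2 * q * (i\<^sup>2 * j ^ 2) - q\<^sup>2 * (i * j ^ 2)
     + 7 * p\<^sup>2 * q\<^sup>2 * (i * j ^ 3) + 3 * q ^ 3 * j ^ 3 - 18 * p\<^sup>2 * q ^ 3 * j ^ 4)"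
    unfolding 1 using ri by algebra
  finally show ?thesis
    unfolding asd_a_def asd_b_def asd_c_def Q[symmetric] divide_inverse inverse_mult_distrib
      power_inverse[symmetric] ij[symmetric] by simp
qed

lemma conv_radius_geometric:
  fixes A :: "real fps"
  assumes "\<And>n. \<bar>fps_nth A n\<bar> \<le> \<delta> * R ^ n" "R > 0" "\<bar>s\<bar> * R < 1"
  shows "ereal (norm s) < fps_conv_radius A"
proof -
  have "\<bar>s\<bar> < 1 / R" using assms by (simp add: field_simps)
  then obtain y where y: "\<bar>s\<bar> < y" "y < 1 / R" using dense by blast
  have y0: "y > 0" using y by linarith
  have yR: "y * R < 1" using y assms(2) by (simp add: field_simps)
  have "summable (\<lambda>n. \<delta> * (y * R) ^ n)" using y0 yR assms(2) by (intro summable_mult summable_geometric) auto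
  hence "summable (\<lambda>n. fps_nth A n * y ^ n)"
  proof (rule summable_comparison_test')
    fix n
    have "norm (fps_nth A n * y ^ n) = \<bar>fps_nth A n\<bar> * y ^ n" using y0 by (simp add: abs_mult)
    also have "\<dots> \<le> \<delta> * R ^ n * y ^ n" using y0 by (intro mult_right_mono assms(1)) auto
    finally show "norm (fps_nth A n * y ^ n) \<le> \<delta> * (y * R) ^ n" by (simp add: power_mult_distrib mult_ac)
  qed
  hence "fps_conv_radius A \<ge> ereal (norm y)" unfolding fps_conv_radius_def by (rule conv_radius_geI)
  thus ?thesis using y y0 by (auto intro: less_le_trans[of _ "ereal y"])
qed

text \<open>The conditions on \<open>\<sigma>\<close>: the series converge with ratio 1/2, the
  radius stays positive, and at amplitude \<open>\<sigma> / 2\<close> the quadratic remainder is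
  smaller than the linear term.\<close>

locale unstable_manifold =
  fixes c \<nu> \<delta> R \<sigma> :: real and L :: "nat \<Rightarrow> trig_poly" and k0 :: int
  assumes c: "c > 0" and \<nu>: "\<nu> > 0" and \<delta>: "\<delta> > 0" and R: "R > 0"
    and \<sigma>: "\<sigma> > 0" "\<sigma> * R \<le> 1/2" "2 * \<delta> * (\<sigma> * R) < c" "2 * \<delta> * R * (\<sigma> * R) \<le> 1/2"
    and L: "L 0 = []" "L 1 = [(1, k0, 0)]"
    and bounded: "\<And>n. modes_bounded \<nu> (geom_maj \<delta> R) n (L n)"
    and equation: "\<And>n x. lin_op c \<nu> n (L n) x = fps_nth (asd_N c (\<lambda>i. mode_series \<nu> L i x)) n"
begin

lemma geom_maj_le: "geom_maj \<delta> R n \<le> \<delta> * R ^ n"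
proof (cases "n = 0")
  case False
  hence "1 \<le> (real n)\<^sup>2" by simp
  hence "\<delta> * R ^ n / (real n)\<^sup>2 \<le> \<delta> * R ^ n / 1" using \<delta> R False by (intro divide_left_mono) auto
  thus ?thesis by (simp add: geom_maj_def)
qed (use \<delta> in \<open>simp add: geom_maj_def\<close>)

lemma mode_series_nth_le: "\<bar>fps_nth (mode_series \<nu> L i x) n\<bar> \<le> \<delta> * R ^ n"
proof -
  have "majorized (mode_series \<nu> L i) (geom_maj \<delta> R)" by (rule majorized_mode_series[OF bounded \<nu>])
  hence "trig_bound (\<lambda>x. fps_nth (mode_series \<nu> L i x) n) (geom_maj \<delta> R n)" by (simp add: majorized_def)
  from trig_bound_abs[OF this] show ?thesis using geom_maj_le order_trans by blast
qed

lemma evals_mode_series: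
  assumes "\<bar>s\<bar> \<le> \<sigma>"
  shows "evals s (mode_series \<nu> L i x) (eval_fps (mode_series \<nu> L i x) s)"
proof -
  have "\<bar>s\<bar> * R \<le> \<sigma> * R" using assms R by (intro mult_right_mono) auto
  hence "\<bar>s\<bar> * R < 1" using \<sigma> by linarith
  thus ?thesis unfolding evals_def using conv_radius_geometric[OF mode_series_nth_le R] by blast
qed

definition "F i s x = eval_fps (mode_series \<nu> L i x) s"

text \<open>The equations of all orders combine to one identity of formal series, and evaluating it
  inside the disc of convergence gives the polynomial form of the equation at real numbers.\<close>

lemma F_equation:
  assumes s: "\<bar>s\<bar> \<le> \<sigma>" and pos: "c + F 0 s x > 0"
  shows "F 5 s x = - asd_a (F 1 s x) * F 4 s x + asd_b (c + F 0 s x) (F 1 s x) (F 2 s x) * F 3 s x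
     + asd_c (c + F 0 s x) (F 1 s x) (F 2 s x)"
proof -
  let ?h = "\<lambda>i. mode_series \<nu> L i x"
  have "fps_const (c ^ 3) * (?h 5 + ?h 4) + fps_const c * ?h 2 = asd_N c ?h"
  proof (rule fps_ext)
    fix n
    show "fps_nth (fps_const (c ^ 3) * (?h 5 + ?h 4) + fps_const c * ?h 2) n = fps_nth (asd_N c ?h) n"
      unfolding equation[symmetric] by (simp add: lin_op_def mode_series_def)
  qed
  moreover have "evals s (fps_const (c ^ 3) * (?h 5 + ?h 4) + fps_const c * ?h 2) (c ^ 3 * (F 5 s x + F 4 s x) + c * F 2 s x)"
    unfolding F_def by (intro evals_add evals_mult evals_const evals_mode_series[OF s])
  moreover note evals_asd_N[of s ?h "\<lambda>i. F i s x" c]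
  ultimately have "c ^ 3 * (F 5 s x + F 4 s x) + c * F 2 s x = eval_fps (asd_N c ?h) s"
    "evals s (?h i) (F i s x)" for i
    using evals_mode_series[OF s] by (auto simp: evals_def F_def)
  note e = this
  show ?thesis
    by (rule asd_polynomial_identity[OF _ refl pos refl])
       (use e(1) evals_asd_N[of s ?h "\<lambda>i. F i s x" c, OF e(2)] in \<open>simp add: evals_def power2_eq_square\<close>)
qed

text \<open>The cylinder enters as mode of order 0, so the whole solution and not only its
  perturbation is a superposition.\<close>

definition "modes n = (if n = 0 then [(c, 0, 0)] else L n)"
definition "weight n = (if n = 0 then c else \<delta> * R ^ n)"

lemma trig_norm_modes: "trig_norm (modes n) \<le> weight n"
proof (cases "n = 0")
  case True
  then show ?thesis using c by (simp add: modes_def weight_def)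
next
  case False
  have "trig_norm (trig_deriv 0 (L n)) \<le> geom_maj \<delta> R n" using bounded[of n] unfolding modes_bounded_def by blast
  thus ?thesis using False geom_maj_le[of n] by (simp add: modes_def weight_def)
qed

lemma weight_nonneg: "0 \<le> weight n"
  using c \<delta> R by (simp add: weight_def)

text \<open>The square dominates 1, \<open>n * \<nu>\<close> and its square: the sizes of a
  coefficient, of its time derivative, and of the Lipschitz constant of that derivative.\<close>

definition "bnd n = (1 + real n * \<nu>)\<^sup>2 * \<sigma> ^ n"

lemma summable_bnd: "summable (\<lambda>n. bnd n * weight n)"
proof -
  \<comment> \<open>The quadratic factor is bounded by a multiple of \<open>(3/2) ^ n\<close>, while
    \<open>(\<sigma> * R) ^ n \<le> (1/2) ^ n\<close>; the product is still geometric with ratio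
    3/4.\<close>
  define \<tau> where "\<tau> = ln (3/2 :: real)"
  have \<tau>: "\<tau> > 0" "exp \<tau> = 3/2" by (auto simp: \<tau>_def)
  define K where "K = (2 + 4 * \<nu>\<^sup>2 / \<tau>\<^sup>2) * (c + \<delta>)"
  have "summable (\<lambda>n. K * (3/4) ^ n :: real)" by (intro summable_mult summable_geometric) simp
  thus ?thesis
  proof (rule summable_comparison_test')
    fix n
    have "(real n * \<tau>)\<^sup>2 \<le> fact 2 * exp (real n * \<tau>)" using \<tau> by (intro power_le_fact_exp) auto
    moreover have "exp (real n * \<tau>) = (3/2) ^ n" by (simp only: exp_of_nat_mult \<tau>(2))
    ultimately have "(real n)\<^sup>2 * \<tau>\<^sup>2 \<le> 2 * (3/2) ^ n" by (simp add: power_mult_distrib)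
    hence "(real n)\<^sup>2 \<le> 2 * (3/2) ^ n / \<tau>\<^sup>2" using \<tau>(1) by (simp only: pos_le_divide_eq zero_less_power)
    hence "\<nu>\<^sup>2 * (real n)\<^sup>2 \<le> \<nu>\<^sup>2 * (2 * (3/2) ^ n / \<tau>\<^sup>2)" by (intro mult_left_mono) auto
    moreover have "(1 + real n * \<nu>)\<^sup>2 \<le> 2 + 2 * (\<nu>\<^sup>2 * (real n)\<^sup>2)"
    proof -
      have "0 \<le> (1 - real n * \<nu>)\<^sup>2" by simp
      thus ?thesis by (simp add: power2_eq_square algebra_simps)
    qed
    moreover have "2 \<le> 2 * (3/2 :: real) ^ n" using one_le_power[of "3/2 :: real" n] by simp
    ultimately have "(1 + real n * \<nu>)\<^sup>2 \<le> 2 * (3/2) ^ n + 2 * (\<nu>\<^sup>2 * (2 * (3/2) ^ n / \<tau>\<^sup>2))" by linarith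
    also have "\<dots> = (2 + 4 * \<nu>\<^sup>2 / \<tau>\<^sup>2) * (3/2) ^ n" by (simp add: algebra_simps)
    finally have 1: "(1 + real n * \<nu>)\<^sup>2 \<le> (2 + 4 * \<nu>\<^sup>2 / \<tau>\<^sup>2) * (3/2) ^ n" .
    have "\<sigma> ^ n * weight n \<le> \<sigma> ^ n * ((c + \<delta>) * R ^ n)"
      using \<sigma> c \<delta> R by (intro mult_left_mono) (auto simp: weight_def)
    also have "\<dots> = (c + \<delta>) * (\<sigma> * R) ^ n" by (simp add: power_mult_distrib)
    also have "\<dots> \<le> (c + \<delta>) * (1/2) ^ n" using \<sigma> R c \<delta> by (intro mult_left_mono power_mono) auto
    finally have 2: "\<sigma> ^ n * weight n \<le> (c + \<delta>) * (1/2) ^ n" .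
    have "bnd n * weight n = (1 + real n * \<nu>)\<^sup>2 * (\<sigma> ^ n * weight n)" by (simp add: bnd_def)
    also have "\<dots> \<le> ((2 + 4 * \<nu>\<^sup>2 / \<tau>\<^sup>2) * (3/2) ^ n) * ((c + \<delta>) * (1/2) ^ n)"
      by (rule mult_mono[OF 1 2]) (use \<sigma> c \<delta> weight_nonneg in auto)
    also have "\<dots> = K * ((3/2) ^ n * (1/2) ^ n)" by (simp add: K_def)
    also have "(3/2) ^ n * (1/2) ^ n = (3/4 :: real) ^ n" by (simp flip: power_mult_distrib)
    finally have "bnd n * weight n \<le> K * (3/4) ^ n" .
    moreover have "0 \<le> bnd n * weight n" using \<sigma> weight_nonneg by (simp add: bnd_def)
    ultimately show "norm (bnd n * weight n) \<le> K * (3/4) ^ n" by simp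
  qed
qed

lemma bnd_ge:
  "\<sigma> ^ n \<le> bnd n" "real n * \<nu> * \<sigma> ^ n \<le> bnd n" "(real n * \<nu>)\<^sup>2 * \<sigma> ^ n \<le> bnd n"
proof -
  define m where "m = real n * \<nu>"
  have m: "0 \<le> m" "0 \<le> m\<^sup>2" using \<nu> by (auto simp: m_def)
  have "(1 + m)\<^sup>2 = 1 + 2 * m + m\<^sup>2" by (simp add: power2_eq_square algebra_simps)
  hence "1 \<le> (1 + m)\<^sup>2" "m \<le> (1 + m)\<^sup>2" "m\<^sup>2 \<le> (1 + m)\<^sup>2" using m by linarith+
  hence "1 \<le> (1 + real n * \<nu>)\<^sup>2" "real n * \<nu> \<le> (1 + real n * \<nu>)\<^sup>2" "(real n * \<nu>)\<^sup>2 \<le> (1 + real n * \<nu>)\<^sup>2"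
    by (simp_all only: m_def)
  thus "\<sigma> ^ n \<le> bnd n" "real n * \<nu> * \<sigma> ^ n \<le> bnd n" "(real n * \<nu>)\<^sup>2 * \<sigma> ^ n \<le> bnd n"
    unfolding bnd_def using \<sigma>(1) mult_right_mono[of 1 "(1 + real n * \<nu>)\<^sup>2" "\<sigma> ^ n"]
    by (auto intro: mult_right_mono)
qed

lemma summable_small: "\<bar>s\<bar> \<le> \<sigma> \<Longrightarrow> summable (\<lambda>n. \<bar>s ^ n\<bar> * weight n)"
proof -
  assume s: "\<bar>s\<bar> \<le> \<sigma>"
  show ?thesis
  proof (rule superpose_summable_le(1)[OF trig_norm_modes _ summable_bnd, of _ 1])
    show "\<bar>s ^ n\<bar> \<le> 1 * bnd n" for n
      using power_mono[OF s, of n] bnd_ge(1)[of n] by (simp add: power_abs)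

  qed
qed

lemma modes_deriv_sum:
  assumes s: "\<bar>s\<bar> \<le> \<sigma>" and j: "j < 5"
  shows "superpose_deriv modes j (\<lambda>n. s ^ n) x = (if j = 0 then c else 0) + F j s x"
proof -
  define d where "d = (if j = 0 then c else 0)"
  have ev: "summable (\<lambda>n. fps_nth (mode_series \<nu> L j x) n * s ^ n)"
    using evals_mode_series[OF s, of j x] by (intro summable_fps) (simp add: evals_def)
  have "(\<lambda>n. (if n = 0 then d else 0) + fps_nth (mode_series \<nu> L j x) n * s ^ n) sums (d + F j s x)"
    using sums_add[OF sums_single[of 0 "\<lambda>_. d"] summable_sums[OF ev]] by (simp add: F_def eval_fps_def)
  moreover have "(\<lambda>n. (if n = 0 then d else 0) + fps_nth (mode_series \<nu> L j x) n * s ^ n) =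
      (\<lambda>n. s ^ n * trig (trig_deriv j (modes n)) x)"
    using j L(1) by (auto simp: fun_eq_iff modes_def mode_series_def d_def)
  ultimately show ?thesis unfolding superpose_deriv_def d_def by (simp add: sums_iff)
qed

lemma modes_time_sum: "superpose modes (\<lambda>n. real n * \<nu> * s ^ n) x = F 5 s x"
  unfolding superpose_def F_def eval_fps_def
  by (rule arg_cong[of _ _ suminf]) (auto simp: fun_eq_iff mode_series_def modes_def)

text \<open>Geometric tails from orders 1 and 2 with ratio
  \<open>\<bar>s\<bar> * R \<le> 1/2\<close>. The second bound is taken at \<open>x = 0\<close>,
  where the first mode equals 1 whatever \<open>k0\<close> is.\<close>

lemma F_small:
  assumes s: "\<bar>s\<bar> \<le> \<sigma>"
  shows "\<bar>F i s x\<bar> \<le> 2 * \<delta> * (\<bar>s\<bar> * R)" and "\<bar>F 0 s 0 - s\<bar> \<le> 2 * \<delta> * (\<bar>s\<bar> * R)\<^sup>2"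
proof -
  let ?f = "\<lambda>n. fps_nth (mode_series \<nu> L i x) n * s ^ n"
  define y where "y = \<bar>s\<bar> * R"
  have "\<bar>s\<bar> * R \<le> \<sigma> * R" using s R by (intro mult_right_mono) auto
  hence "y \<le> 1/2" unfolding y_def using \<sigma>(2) by linarith
  hence y: "0 \<le> y" "y \<le> 1/2" using R by (simp_all add: y_def)
  have ge: "1 / (1 - y) \<le> 2" using y by (simp add: field_simps)
  have le: "\<bar>fps_nth (mode_series \<nu> L i x) n * s ^ n\<bar> \<le> \<delta> * y ^ n" for n i x
  proof -
    have "\<bar>fps_nth (mode_series \<nu> L i x) n * s ^ n\<bar> \<le> (\<delta> * R ^ n) * \<bar>s\<bar> ^ n"
      unfolding abs_mult power_abs by (intro mult_right_mono mode_series_nth_le) auto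
    thus ?thesis by (simp add: y_def power_mult_distrib mult_ac)
  qed
  have sg: "summable (\<lambda>n. \<delta> * y ^ n)" using y by (intro summable_mult summable_geometric) auto
  have tail: "\<bar>\<Sum>n. fps_nth (mode_series \<nu> L i x) (n + k) * s ^ (n + k)\<bar> \<le> 2 * \<delta> * y ^ k" for i x k
  proof -
    have sk: "summable (\<lambda>n. \<delta> * y ^ (n + k))" using summable_ignore_initial_segment[OF sg, of k] .
    have "norm (\<Sum>n. fps_nth (mode_series \<nu> L i x) (n + k) * s ^ (n + k)) \<le> (\<Sum>n. \<delta> * y ^ (n + k))"
      by (rule norm_suminf_le[OF _ sk]) (use le in simp)
    also have "\<dots> = (\<Sum>n. (\<delta> * y ^ k) * y ^ n)" by (simp add: power_add mult_ac)
    also have "\<dots> = \<delta> * y ^ k * (1 / (1 - y))"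
      using y by (subst suminf_mult) (auto simp: suminf_geometric summable_geometric)
    also have "\<dots> \<le> \<delta> * y ^ k * 2" using \<delta> y by (intro mult_left_mono ge) auto
    finally show ?thesis by simp
  qed
  have split: "F i s x = (\<Sum>n. fps_nth (mode_series \<nu> L i x) (n + k) * s ^ (n + k)) +
      (\<Sum>n<k. fps_nth (mode_series \<nu> L i x) n * s ^ n)" for i x k
    unfolding F_def eval_fps_def
  proof (rule suminf_split_initial_segment)
    show "summable (\<lambda>n. fps_nth (mode_series \<nu> L i x) n * s ^ n)"
      using evals_mode_series[OF s, of i x] by (intro summable_fps) (simp add: evals_def)
  qed
  have z: "fps_nth (mode_series \<nu> L i x) 0 = 0" for i x by (simp add: mode_series_def L)
  show "\<bar>F i s x\<bar> \<le> 2 * \<delta> * (\<bar>s\<bar> * R)"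
    using split[of i x 1] tail[of i x 1] z by (simp add: y_def)
  have "(\<Sum>n<2. fps_nth (mode_series \<nu> L 0 0) n * s ^ n) = s"
    using z[of 0 0] L(2) by (simp add: numeral_2_eq_2 mode_series_def)
  thus "\<bar>F 0 s 0 - s\<bar> \<le> 2 * \<delta> * (\<bar>s\<bar> * R)\<^sup>2"
    using split[of 0 0 2] tail[of 0 0 2] by (simp add: y_def)
qed

lemma F_positive: "\<bar>s\<bar> \<le> \<sigma> \<Longrightarrow> 0 < c + F 0 s x"
proof -
  assume s: "\<bar>s\<bar> \<le> \<sigma>"
  have "2 * \<delta> * (\<bar>s\<bar> * R) \<le> 2 * \<delta> * (\<sigma> * R)" using s \<delta> R by (intro mult_left_mono mult_right_mono) auto
  thus ?thesis using F_small(1)[OF s, of 0 x] \<sigma> by linarith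
qed

subsection \<open>The orbits solve the surface diffusion problem\<close>

definition "phase s0 n t = (s0 * exp (\<nu> * t)) ^ n"
definition "orbit s0 t = superpose modes (\<lambda>n. phase s0 n t)"
definition "velocity s0 t = superpose modes (\<lambda>n. real n * \<nu> * phase s0 n t)"
definition "exit_time s0 = ln (\<sigma> / s0) / \<nu>"

lemma phase_deriv: "(phase s0 n has_real_derivative real n * \<nu> * phase s0 n t) (at t)"
proof -
  have e: "phase s0 n = (\<lambda>t. s0 ^ n * exp (real n * (\<nu> * t)))"
    by (simp add: fun_eq_iff phase_def power_mult_distrib exp_of_nat_mult)
  show ?thesis unfolding e by (rule derivative_eq_intros refl | simp)+
qed

lemma exp_le_sigma:
  assumes "0 < s0" "t \<le> exit_time s0"
  shows "s0 * exp (\<nu> * t) \<le> \<sigma>"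
proof -
  have "\<nu> * t \<le> ln (\<sigma> / s0)" using assms \<nu> by (simp add: exit_time_def field_simps)
  hence "exp (\<nu> * t) \<le> \<sigma> / s0" using assms \<sigma> by (metis divide_pos_pos exp_le_cancel_iff exp_ln)
  thus ?thesis using assms by (simp add: field_simps)
qed

lemma phase_le: "0 < s0 \<Longrightarrow> t \<le> exit_time s0 \<Longrightarrow> 0 \<le> phase s0 n t \<and> phase s0 n t \<le> \<sigma> ^ n"
  unfolding phase_def using exp_le_sigma by (intro conjI power_mono) auto

lemma phase_bounds:
  assumes s0: "0 < s0" and t: "t \<in> {0..exit_time s0}" "\<tau> \<in> {0..exit_time s0}"
  shows "\<bar>phase s0 n t\<bar> \<le> bnd n" "\<bar>phase s0 n t - phase s0 n \<tau>\<bar> \<le> bnd n * \<bar>t - \<tau>\<bar>"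
    "\<bar>real n * \<nu> * phase s0 n t\<bar> \<le> bnd n"
    "\<bar>real n * \<nu> * phase s0 n t - real n * \<nu> * phase s0 n \<tau>\<bar> \<le> bnd n * \<bar>t - \<tau>\<bar>"
proof -
  have n0: "0 \<le> real n * \<nu>" using \<nu> by simp
  have p: "0 \<le> phase s0 n t" "phase s0 n t \<le> \<sigma> ^ n" if "t \<in> {0..exit_time s0}" for t
    using phase_le[OF s0, of t n] that by auto
  have d1: "\<bar>real n * \<nu> * phase s0 n t\<bar> \<le> real n * \<nu> * \<sigma> ^ n" if "t \<in> {0..exit_time s0}" for t
    using abs_of_nonneg[OF mult_nonneg_nonneg[OF n0 p(1)[OF that]]] mult_left_mono[OF p(2)[OF that] n0] by simp
  have lip: "\<bar>phase s0 n t - phase s0 n \<tau>\<bar> \<le> (real n * \<nu> * \<sigma> ^ n) * \<bar>t - \<tau>\<bar>"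
    using field_differentiable_bound[of "{0..exit_time s0}" "phase s0 n" "\<lambda>t. real n * \<nu> * phase s0 n t"
        "real n * \<nu> * \<sigma> ^ n" t \<tau>] t d1 has_field_derivative_at_within[OF phase_deriv] by simp
  show "\<bar>phase s0 n t\<bar> \<le> bnd n" using p[OF t(1)] bnd_ge(1)[of n] by simp
  show "\<bar>real n * \<nu> * phase s0 n t\<bar> \<le> bnd n" using d1[OF t(1)] bnd_ge(2)[of n] by linarith
  have "(real n * \<nu> * \<sigma> ^ n) * \<bar>t - \<tau>\<bar> \<le> bnd n * \<bar>t - \<tau>\<bar>" by (intro mult_right_mono bnd_ge) auto
  thus "\<bar>phase s0 n t - phase s0 n \<tau>\<bar> \<le> bnd n * \<bar>t - \<tau>\<bar>" using lip by linarith
  have "\<bar>real n * \<nu> * phase s0 n t - real n * \<nu> * phase s0 n \<tau>\<bar> = (real n * \<nu>) * \<bar>phase s0 n t - phase s0 n \<tau>\<bar>"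
    unfolding right_diff_distrib[symmetric] abs_mult[of "real n * \<nu>"] using abs_of_nonneg[OF n0] by simp
  also have "\<dots> \<le> (real n * \<nu>) * ((real n * \<nu> * \<sigma> ^ n) * \<bar>t - \<tau>\<bar>)" using lip n0 by (rule mult_left_mono)
  also have "\<dots> = ((real n * \<nu>)\<^sup>2 * \<sigma> ^ n) * \<bar>t - \<tau>\<bar>" by (simp add: power2_eq_square)
  also have "\<dots> \<le> bnd n * \<bar>t - \<tau>\<bar>" by (intro mult_right_mono bnd_ge) auto
  finally show "\<bar>real n * \<nu> * phase s0 n t - real n * \<nu> * phase s0 n \<tau>\<bar> \<le> bnd n * \<bar>t - \<tau>\<bar>" .
qed

text \<open>The mean value theorem replaces the quotient by a derivative at an intermediate time,
  and the Lipschitz bound of the derivative makes the error linear in the time step, summably in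
  \<open>n\<close>.\<close>

lemma phase_quotient:
  assumes s0: "0 < s0" and t: "t \<in> {0..exit_time s0}" "\<tau> \<in> {0..exit_time s0}" "\<tau> \<noteq> t"
  shows "\<bar>(phase s0 n \<tau> - phase s0 n t) / (\<tau> - t) - real n * \<nu> * phase s0 n t\<bar> \<le> \<bar>\<tau> - t\<bar> * bnd n"
proof -
  have mvt: "\<exists>z. min t \<tau> < z \<and> z < max t \<tau> \<and> phase s0 n \<tau> - phase s0 n t = (\<tau> - t) * (real n * \<nu> * phase s0 n z)"
  proof (cases "t < \<tau>")
    case True
    then show ?thesis using MVT2[OF True phase_deriv] by (auto simp: min_def max_def)
  next
    case False
    hence lt: "\<tau> < t" using t by simp
    obtain z where "\<tau> < z" "z < t" "phase s0 n t - phase s0 n \<tau> = (t - \<tau>) * (real n * \<nu> * phase s0 n z)"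
      using MVT2[OF lt phase_deriv] by blast
    moreover from this have "phase s0 n \<tau> - phase s0 n t = (\<tau> - t) * (real n * \<nu> * phase s0 n z)"
      by (simp add: algebra_simps)
    ultimately show ?thesis using lt by (intro exI[of _ z]) auto
  qed
  then obtain z where z: "min t \<tau> < z" "z < max t \<tau>"
    "phase s0 n \<tau> - phase s0 n t = (\<tau> - t) * (real n * \<nu> * phase s0 n z)" by blast
  have "(phase s0 n \<tau> - phase s0 n t) / (\<tau> - t) = real n * \<nu> * phase s0 n z" using z(3) t(3) by simp
  moreover have "z \<in> {0..exit_time s0}" using z t by (auto simp: min_def max_def split: if_splits)
  ultimately have "\<bar>(phase s0 n \<tau> - phase s0 n t) / (\<tau> - t) - real n * \<nu> * phase s0 n t\<bar> \<le> bnd n * \<bar>z - t\<bar>"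
    using phase_bounds(4)[OF s0 _ t(1), of z n] by simp
  also have "\<dots> \<le> bnd n * \<bar>\<tau> - t\<bar>"
    using z \<sigma>(1) by (intro mult_left_mono) (auto simp: bnd_def min_def max_def split: if_splits)
  finally show ?thesis by (simp add: mult.commute)
qed

text \<open>At amplitude \<open>s\<close> the termwise space derivatives of the orbit are
  \<open>c + F 0\<close> and \<open>F 1\<close> to \<open>F 4\<close>, and its velocity is
  \<open>F 5\<close>; the quasilinear form of the right-hand side therefore reduces the claim to
  \<open>F_equation\<close>.\<close>

lemma velocity_eq_asd_rhs:
  assumes s0: "0 < s0" and t: "t \<in> {0..exit_time s0}"
  shows "velocity s0 t x = asd_rhs (orbit s0 t) x" "0 < orbit s0 t x"
proof -
  define s where "s = s0 * exp (\<nu> * t)"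
  have s: "\<bar>s\<bar> \<le> \<sigma>" using exp_le_sigma[OF s0] t s0 by (simp add: s_def abs_mult)
  note sm = summable_small[OF s]
  have orb: "orbit s0 t = superpose_deriv modes 0 (\<lambda>n. s ^ n)"
    by (simp add: orbit_def phase_def s_def superpose_def[abs_def] superpose_deriv_def[abs_def])
  have D: "superpose_deriv modes 0 (\<lambda>n. s ^ n) x = c + F 0 s x"
    "superpose_deriv modes 1 (\<lambda>n. s ^ n) x = F 1 s x" "superpose_deriv modes 2 (\<lambda>n. s ^ n) x = F 2 s x"
    "superpose_deriv modes 3 (\<lambda>n. s ^ n) x = F 3 s x" "superpose_deriv modes 4 (\<lambda>n. s ^ n) x = F 4 s x" for x
    using modes_deriv_sum[OF s, of _ x] by simp_all
  have pos: "0 < superpose_deriv modes 0 (\<lambda>n. s ^ n) x" for x using F_positive[OF s, of x] D(1) by simp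
  thus "0 < orbit s0 t x" by (simp add: orb)
  note d = superpose_deriv_has_deriv[OF trig_norm_modes sm]
  have "asd_rhs (orbit s0 t) x = - asd_a (F 1 s x) * F 4 s x + asd_b (c + F 0 s x) (F 1 s x) (F 2 s x) * F 3 s x
     + asd_c (c + F 0 s x) (F 1 s x) (F 2 s x)"
  proof -
    let ?f = "\<lambda>j. superpose_deriv modes j (\<lambda>n. s ^ n)"
    have dd: "(?f 0 has_real_derivative ?f 1 x) (at x)" "(?f 1 has_real_derivative ?f 2 x) (at x)"
      "(?f 2 has_real_derivative ?f 3 x) (at x)" "(?f 3 has_real_derivative ?f 4 x) (at x)" for x
      using d[of 0] d[of 1] d[of 2] d[of 3] by (simp_all add: numeral_eq_Suc)
    show ?thesis unfolding orb asd_rhs_quasilinear[OF dd pos] D ..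
  qed
  also have "\<dots> = F 5 s x" using F_equation[OF s F_positive[OF s]] by simp
  also have "\<dots> = velocity s0 t x" using modes_time_sum[of s x] by (simp add: velocity_def phase_def s_def)
  finally show "velocity s0 t x = asd_rhs (orbit s0 t) x" by simp
qed

lemma orbit_derivative:
  assumes s0: "0 < s0" and t: "0 < t" "t < exit_time s0" and s: "s \<notin> \<int>"
  shows "((\<lambda>\<tau>. lh_norm s (\<lambda>x. (orbit s0 \<tau> x - orbit s0 t x) / (\<tau> - t) - velocity s0 t x)) \<longlongrightarrow> 0) (at t)"
    and "((\<lambda>\<tau>. orbit s0 \<tau> x) has_real_derivative velocity s0 t x) (at t)"
proof -
  let ?q = "\<lambda>\<tau> x. (orbit s0 \<tau> x - orbit s0 t x) / (\<tau> - t) - velocity s0 t x"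
  let ?K = "lh_const s * (\<Sum>n. bnd n * weight n)"
  have t': "t \<in> {0..exit_time s0}" using t by simp
  have sm: "summable (\<lambda>n. \<bar>phase s0 n \<tau>\<bar> * weight n)" "summable (\<lambda>n. \<bar>real n * \<nu> * phase s0 n \<tau>\<bar> * weight n)"
    if "\<tau> \<in> {0..exit_time s0}" for \<tau>
    using superpose_summable_le(1)[OF trig_norm_modes _ summable_bnd, of "\<lambda>n. phase s0 n \<tau>" 1]
      superpose_summable_le(1)[OF trig_norm_modes _ summable_bnd, of "\<lambda>n. real n * \<nu> * phase s0 n \<tau>" 1]
      phase_bounds(1,3)[OF s0 that that] by auto
  have q: "?q \<tau> \<in> lh s" "lh_norm s (?q \<tau>) \<le> ?K * \<bar>\<tau> - t\<bar>" if \<tau>: "\<tau> \<in> {0..exit_time s0}" "\<tau> \<noteq> t" for \<tau>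
  proof -
    let ?p = "1 / (\<tau> - t)"
    have quo: "\<bar>1 * (?p * phase s0 n \<tau> + - ?p * phase s0 n t) + -1 * (real n * \<nu> * phase s0 n t)\<bar> \<le> \<bar>\<tau> - t\<bar> * bnd n" for n
      using phase_quotient[OF s0 t' \<tau>, of n] by (simp add: diff_divide_distrib)
    have bd: "\<bar>?p * phase s0 n \<tau> + - ?p * phase s0 n t\<bar> \<le> (\<bar>\<tau> - t\<bar> + 1) * bnd n" for n
      using quo[of n] phase_bounds(3)[OF s0 t' t', of n] by (simp add: distrib_right)
    have "?q \<tau> = superpose modes (\<lambda>n. 1 * (?p * phase s0 n \<tau> + - ?p * phase s0 n t) + -1 * (real n * \<nu> * phase s0 n t))"
      unfolding superpose_lincomb[OF trig_norm_modes superpose_summable_le(1)[OF trig_norm_modes bd summable_bnd] sm(2)[OF t'], symmetric]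
        superpose_lincomb[OF trig_norm_modes sm(1)[OF \<tau>(1)] sm(1)[OF t'], symmetric]
      by (simp add: orbit_def velocity_def fun_eq_iff diff_divide_distrib)
    thus "?q \<tau> \<in> lh s" "lh_norm s (?q \<tau>) \<le> ?K * \<bar>\<tau> - t\<bar>"
      using superpose_lh_le[OF trig_norm_modes quo summable_bnd s] by (simp_all add: mult_ac)
  qed
  have "((\<lambda>\<tau>. ?K * \<bar>\<tau> - t\<bar>) \<longlongrightarrow> ?K * \<bar>t - t\<bar>) (at t)" by (intro tendsto_intros)
  hence lim: "((\<lambda>\<tau>. ?K * \<bar>\<tau> - t\<bar>) \<longlongrightarrow> 0) (at t)" by simp
  have ev: "\<forall>\<^sub>F \<tau> in at t. \<tau> \<in> {0<..<exit_time s0} \<and> \<tau> \<noteq> t"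
    by (intro eventually_conj eventually_at_in_open' eventually_neq_at_within) (use t in auto)
  show L: "((\<lambda>\<tau>. lh_norm s (?q \<tau>)) \<longlongrightarrow> 0) (at t)"
  proof (rule Lim_null_comparison[OF _ lim])
    show "\<forall>\<^sub>F \<tau> in at t. norm (lh_norm s (?q \<tau>)) \<le> ?K * \<bar>\<tau> - t\<bar>"
      using ev
    proof eventually_elim
      case (elim \<tau>)
      hence "\<tau> \<in> {0..exit_time s0}" "\<tau> \<noteq> t" by auto
      from q[OF this] show ?case using lh_norm_nonneg by simp
    qed
  qed
  have "((\<lambda>\<tau>. ?q \<tau> x) \<longlongrightarrow> 0) (at t)"
  proof (rule Lim_null_comparison[OF _ L])
    show "\<forall>\<^sub>F \<tau> in at t. norm (?q \<tau> x) \<le> lh_norm s (?q \<tau>)"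
      using ev
    proof eventually_elim
      case (elim \<tau>)
      hence "?q \<tau> \<in> lh s" by (intro q) auto
      from abs_deriv_le_holder_norm[OF lh_holder_space[OF this], of 0 x] show ?case by (simp add: lh_norm_def)
    qed
  qed
  thus "((\<lambda>\<tau>. orbit s0 \<tau> x) has_real_derivative velocity s0 t x) (at t)"
    unfolding has_field_derivative_iff by (simp add: LIM_zero_iff)
qed

lemma orbit_asd_solution:
  assumes s0: "0 < s0" "s0 < \<sigma>" and \<alpha>: "0 < \<alpha>" "\<alpha> < 1" and \<mu>: "\<mu> \<le> 1" and int: "4 * \<mu> + \<alpha> \<notin> \<int>"
  shows "asd_solution \<mu> \<alpha> (orbit s0 0) (ereal (exit_time s0)) (orbit s0)"
proof -
  have tb: "0 < exit_time s0" unfolding exit_time_def using s0 \<nu> by (intro divide_pos_pos ln_gt_zero) auto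
  have ints: "\<alpha> \<notin> \<int>" "4 + \<alpha> \<notin> \<int>"
  proof -
    have "frac \<alpha> \<noteq> 0" "frac (4 + \<alpha>) \<noteq> 0" using nat_floor_4_plus[OF \<alpha>] \<alpha> by auto
    thus "\<alpha> \<notin> \<int>" "4 + \<alpha> \<notin> \<int>" by (simp_all add: frac_eq_0_iff)
  qed
  have orb: "orbit s0 = curve modes (phase s0)"
    by (simp add: fun_eq_iff orbit_def curve_def)
  have vel: "velocity s0 = curve modes (\<lambda>n t. real n * \<nu> * phase s0 n t)"
    by (simp add: fun_eq_iff velocity_def curve_def)
  have C: "C_weighted \<mu> s (ereal (exit_time s0)) (orbit s0)" "C_weighted \<mu> s (ereal (exit_time s0)) (velocity s0)"
    "continuous_lh s {0..exit_time s0} (orbit s0)" if "s \<notin> \<int>" for s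
    unfolding orb vel
    by (rule C_weighted_curve[OF trig_norm_modes summable_bnd that _ _ tb \<mu>]
        continuous_lh_curve[OF trig_norm_modes summable_bnd that]; (rule phase_bounds[OF s0(1)]; assumption))+
  show ?thesis
    unfolding asd_solution_def C1_weighted_def
  proof (intro conjI allI impI exI[of _ "velocity s0"])
    show "0 < ereal (exit_time s0)" using tb by simp
    show "C_weighted \<mu> \<alpha> (ereal (exit_time s0)) (orbit s0)" "C_weighted \<mu> \<alpha> (ereal (exit_time s0)) (velocity s0)"
      "C_weighted \<mu> (4 + \<alpha>) (ereal (exit_time s0)) (orbit s0)"
      by (rule C ints)+
    show "continuous_lh (4 * \<mu> + \<alpha>) {t. 0 \<le> t \<and> ereal t < ereal (exit_time s0)} (orbit s0)"
      by (rule continuous_lh_subset[OF C(3)[OF int]]) auto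
    show "0 < orbit s0 t x" if "0 \<le> t" "ereal t < ereal (exit_time s0)" for t x
      using velocity_eq_asd_rhs(2)[OF s0(1), of t x] that by simp
    fix t assume t: "0 < t" "ereal t < ereal (exit_time s0)"
    show "((\<lambda>\<tau>. lh_norm \<alpha> (\<lambda>x. (orbit s0 \<tau> x - orbit s0 t x) / (\<tau> - t) - velocity s0 t x)) \<longlongrightarrow> 0) (at t)"
      using orbit_derivative(1)[OF s0(1) t(1) _ ints(1)] t by simp
    show "((\<lambda>\<tau>. orbit s0 \<tau> x) has_real_derivative asd_rhs (orbit s0 t) x) (at t)" for x
      using orbit_derivative(2)[OF s0(1) t(1) _ ints(1), of x] velocity_eq_asd_rhs(1)[OF s0(1), of t x] t by simp
  qed simp
qed

lemma orbit_near_constant: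
  assumes s0: "0 < s0" "s0 < \<sigma>" and s: "s \<notin> \<int>"
  shows "orbit s0 0 \<in> lh s" "\<And>x. 0 < orbit s0 0 x"
    and "(\<lambda>x. orbit s0 0 x - c) \<in> lh s"
    and "lh_norm s (\<lambda>x. orbit s0 0 x - c) \<le> lh_const s * (s0 / \<sigma> * (\<Sum>n. bnd n * weight n))"
proof -
  have tb: "0 \<le> exit_time s0" unfolding exit_time_def using s0 \<nu> by (intro divide_nonneg_pos ln_ge_zero) auto
  show "\<And>x. 0 < orbit s0 0 x" using velocity_eq_asd_rhs(2)[OF s0(1)] tb by simp
  have ph: "phase s0 n 0 = s0 ^ n" for n by (simp add: phase_def)
  have "\<bar>s0\<bar> \<le> \<sigma>" "\<bar>0::real\<bar> \<le> \<sigma>" using s0 \<sigma> by auto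
  note sm = this[THEN summable_small]
  show "orbit s0 0 \<in> lh s" unfolding orbit_def ph by (rule superpose_lh(1)[OF trig_norm_modes sm(1) s])
  \<comment> \<open>Since \<open>0 ^ 0 = 1\<close>, amplitude 0 is the cylinder. Subtracting
    \<open>c\<close> thus subtracts coefficients: order 0 cancels, and every later order carries a
    factor \<open>s0 / \<sigma>\<close>.\<close>
  have "superpose modes (\<lambda>n. 0 ^ n) x = c" for x
  proof -
    have "superpose_deriv modes 0 (\<lambda>n. 0 ^ n) x = c + F 0 0 x" using modes_deriv_sum[of 0 0 x] \<sigma> by simp
    moreover have "F 0 0 x = 0" by (simp add: F_def eval_fps_at_0 mode_series_def L)
    ultimately show ?thesis by (simp add: superpose_def superpose_deriv_def)
  qed
  hence e: "(\<lambda>x. orbit s0 0 x - c) = superpose modes (\<lambda>n. 1 * s0 ^ n + -1 * 0 ^ n)"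
    unfolding superpose_lincomb[OF trig_norm_modes sm, symmetric] by (simp add: orbit_def ph)
  have "\<bar>1 * s0 ^ n + -1 * 0 ^ n\<bar> \<le> s0 / \<sigma> * bnd n" for n
  proof (cases n)
    case (Suc m)
    have "s0 ^ n = s0 * s0 ^ m" by (simp add: Suc)
    also have "\<dots> \<le> s0 * \<sigma> ^ m" using s0 by (intro mult_left_mono power_mono) auto
    also have "\<dots> = s0 / \<sigma> * \<sigma> ^ n" using \<sigma> by (simp add: Suc)
    also have "\<dots> \<le> s0 / \<sigma> * bnd n" using s0 \<sigma> by (intro mult_left_mono bnd_ge) auto
    finally show ?thesis using s0 Suc by simp
  qed (use s0 \<sigma> in \<open>simp add: bnd_def\<close>)
  from superpose_lh_le[OF trig_norm_modes this summable_bnd s]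
  show "(\<lambda>x. orbit s0 0 x - c) \<in> lh s"
    "lh_norm s (\<lambda>x. orbit s0 0 x - c) \<le> lh_const s * (s0 / \<sigma> * (\<Sum>n. bnd n * weight n))"
    unfolding e by auto
qed

text \<open>When the amplitude is \<open>\<sigma> / 2\<close>, the orbit equals a function
  independent of \<open>s0\<close>. Its deviation from \<open>c\<close> at \<open>x = 0\<close> is
  \<open>\<sigma> / 2\<close> up to a remainder of at most \<open>\<sigma> / 4\<close>, and the norm
  dominates this value.\<close>

lemma orbit_escapes:
  assumes s0: "0 < s0" "s0 \<le> \<sigma> / 2" and s: "s \<notin> \<int>"
  obtains t where "0 \<le> t" "t < exit_time s0" "lh_norm s (\<lambda>x. orbit s0 t x - c) \<ge> \<sigma> / 4"
proof -
  define t where "t = ln (\<sigma> / 2 / s0) / \<nu>"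
  have "1 \<le> \<sigma> / 2 / s0" using s0 by simp
  hence t0: "0 \<le> t" unfolding t_def using \<nu> by (intro divide_nonneg_pos ln_ge_zero) auto
  have lt: "t < exit_time s0" unfolding t_def exit_time_def
    using s0 \<sigma> \<nu> by (intro divide_strict_right_mono) (auto simp: field_simps)
  have "s0 * exp (\<nu> * t) = \<sigma> / 2" using \<nu> s0 \<sigma> by (simp add: t_def)
  hence at_t: "orbit s0 t = orbit (\<sigma> / 2) 0" unfolding orbit_def phase_def by (simp only: mult_zero_right exp_zero mult_1_right)
  have half: "\<bar>\<sigma> / 2\<bar> \<le> \<sigma>" "0 < \<sigma> / 2" "\<sigma> / 2 < \<sigma>" using \<sigma> by auto
  have "orbit (\<sigma> / 2) 0 0 - c = F 0 (\<sigma> / 2) 0"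
    using modes_deriv_sum[OF half(1), of 0 0] by (simp add: orbit_def phase_def superpose_def superpose_deriv_def)
  moreover have "2 * \<delta> * (\<bar>\<sigma> / 2\<bar> * R)\<^sup>2 \<le> \<sigma> / 4"
  proof -
    have "2 * \<delta> * (\<bar>\<sigma> / 2\<bar> * R)\<^sup>2 = (\<sigma> / 4) * (2 * \<delta> * R * (\<sigma> * R))" using \<sigma>
      by (simp add: power2_eq_square)
    also have "\<dots> \<le> (\<sigma> / 4) * (1 / 2)" using \<sigma> by (intro mult_left_mono) auto
    finally show ?thesis using \<sigma> by simp
  qed
  ultimately have "\<sigma> / 4 \<le> \<bar>orbit (\<sigma> / 2) 0 0 - c\<bar>"
    using F_small(2)[OF half(1)] by linarith
  also have "\<dots> \<le> lh_norm s (\<lambda>x. orbit (\<sigma> / 2) 0 x - c)"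
    using abs_deriv_le_holder_norm[OF lh_holder_space[OF orbit_near_constant(3)[OF half(2,3) s]], of 0 0]
    by (simp add: lh_norm_def)
  finally show ?thesis using that[OF t0 lt] by (simp add: at_t)
qed

end

theorem theorem5p1:
  fixes \<alpha> \<mu> rstar :: real
  assumes "0 < \<alpha>" "\<alpha> < 1"
    and "0 < rstar" "rstar < 1"
    and "1/2 \<le> \<mu>" "\<mu> \<le> 1"
    and "4 * \<mu> + \<alpha> \<notin> \<int>"
  shows "\<exists>\<epsilon>>0. \<exists>r :: nat \<Rightarrow> real \<Rightarrow> real.
           (\<forall>n. r n \<in> lh (4 * \<mu> + \<alpha>) \<and> (\<forall>x. 0 < r n x)) \<and>
           (\<lambda>n. lh_norm (4 * \<mu> + \<alpha>) (\<lambda>x. r n x - rstar)) \<longlonglongrightarrow> 0 \<and>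
           (\<forall>n. \<exists>tplus u. asd_maximal_solution \<mu> \<alpha> (r n) tplus u \<and>
              (\<exists>t\<ge>0. ereal t < tplus \<and>
                 lh_norm (4 * \<mu> + \<alpha>) (\<lambda>x. u t x - rstar) \<ge> \<epsilon>))"
proof -
  obtain k0 \<nu> where \<nu>: "\<nu> = of_int k0 ^ 2 / rstar\<^sup>2 - of_int k0 ^ 4" "\<nu> > 0"
    "\<And>k::int. of_int k ^ 2 / rstar\<^sup>2 - of_int k ^ 4 \<le> \<nu>"
    by (rule unstable_mode[OF assms(3,4)]) (rule that; blast)
  obtain L \<delta> R where L: "\<delta> > 0" "R > 0" "L 0 = []" "L 1 = [(1, k0, 0)]"
    "\<And>n. modes_bounded \<nu> (geom_maj \<delta> R) n (L n)"
    "\<And>n x. lin_op rstar \<nu> n (L n) x = fps_nth (asd_N rstar (\<lambda>i. mode_series \<nu> L i x)) n"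
    by (rule formal_solution[OF assms(3) \<nu>(2,1,3)]) (rule that; assumption)
  \<comment> \<open>The entries yield convergence, positivity and dominance of the linear term in
    turn; the 4 in the second leaves \<open>rstar / 2\<close> and so makes the positivity condition
    strict.\<close>
  define \<sigma> where "\<sigma> = min (1 / (2 * R)) (min (rstar / (4 * \<delta> * R)) (1 / (4 * \<delta> * R * R)))"
  interpret unstable_manifold rstar \<nu> \<delta> R \<sigma> L k0
  proof
    show "\<sigma> > 0" using L(1,2) assms(3) by (simp add: \<sigma>_def)
    have "\<sigma> * R \<le> 1 / (2 * R) * R" using L(2) by (intro mult_right_mono) (auto simp: \<sigma>_def)
    thus "\<sigma> * R \<le> 1 / 2" using L(2) by simp
    have "2 * \<delta> * (\<sigma> * R) \<le> 2 * \<delta> * (rstar / (4 * \<delta> * R) * R)"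
      using L(1,2) by (intro mult_left_mono mult_right_mono) (auto simp: \<sigma>_def)
    also have "\<dots> < rstar" using L(1,2) assms(3) by simp
    finally show "2 * \<delta> * (\<sigma> * R) < rstar" .
    have "2 * \<delta> * R * (\<sigma> * R) \<le> 2 * \<delta> * R * (1 / (4 * \<delta> * R * R) * R)"
      using L(1,2) by (intro mult_left_mono mult_right_mono) (auto simp: \<sigma>_def)
    also have "\<dots> = 1 / 2" using L(1,2) by simp
    finally show "2 * \<delta> * R * (\<sigma> * R) \<le> 1 / 2" .
  qed (use assms \<nu>(2) L in auto)
  let ?s = "4 * \<mu> + \<alpha>"
  \<comment> \<open>The amplitudes tend to 0 and never exceed \<open>\<sigma> / 2\<close>, so each
    orbit still reaches that amplitude.\<close>
  define s0 where "s0 n = \<sigma> / 2 / real (Suc n)" for n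
  have s0: "0 < s0 n" "s0 n \<le> \<sigma> / 2" "s0 n < \<sigma>" for n
  proof -
    show "0 < s0 n" using \<sigma>(1) by (simp add: s0_def)
    show "s0 n \<le> \<sigma> / 2" unfolding s0_def using \<sigma>(1) by (simp add: divide_le_eq mult_le_cancel_left1)
    thus "s0 n < \<sigma>" using \<sigma>(1) by linarith
  qed
  have lim: "(\<lambda>n. lh_norm ?s (\<lambda>x. orbit (s0 n) 0 x - rstar)) \<longlonglongrightarrow> 0"
  proof (rule Lim_null_comparison)
    let ?K = "lh_const ?s * (\<Sum>n. bnd n * weight n) / 2"
    have "lh_norm ?s (\<lambda>x. orbit (s0 n) 0 x - rstar) \<le> ?K * inverse (real (Suc n))" for n
    proof -
      have eq: "C * (1 / 2 * y * S) = C * S / 2 * y" for C y S :: real by simp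
      have e: "s0 n / \<sigma> = 1 / 2 * inverse (real (Suc n))" using \<sigma>(1) by (simp add: s0_def divide_simps del: of_nat_Suc)
      show ?thesis using orbit_near_constant(4)[OF s0(1,3) assms(7), of n] unfolding e eq .
    qed
    thus "\<forall>\<^sub>F n in sequentially. norm (lh_norm ?s (\<lambda>x. orbit (s0 n) 0 x - rstar)) \<le> ?K * inverse (real (Suc n))"
      using lh_norm_nonneg[OF orbit_near_constant(3)[OF s0(1,3) assms(7)]] by (intro always_eventually) simp
    show "(\<lambda>n. ?K * inverse (real (Suc n))) \<longlonglongrightarrow> 0"
      by (rule tendsto_mult_right_zero[OF LIMSEQ_inverse_real_of_nat])
  qed
  have escape: "\<exists>tplus u. asd_maximal_solution \<mu> \<alpha> (orbit (s0 n) 0) tplus u \<and>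
      (\<exists>t\<ge>0. ereal t < tplus \<and> lh_norm ?s (\<lambda>x. u t x - rstar) \<ge> \<sigma> / 4)" for n
  proof -
    have sol: "asd_solution \<mu> \<alpha> (orbit (s0 n) 0) (ereal (exit_time (s0 n))) (orbit (s0 n))"
      by (rule orbit_asd_solution[OF s0(1,3) assms(1,2,6,7)])
    obtain a u where max: "asd_maximal_solution \<mu> \<alpha> (orbit (s0 n) 0) a u"
      using asd_maximal_solution_exists[OF sol assms(1,2,5,6)] .
    obtain t where t: "0 \<le> t" "t < exit_time (s0 n)" "lh_norm ?s (\<lambda>x. orbit (s0 n) t x - rstar) \<ge> \<sigma> / 4"
      using orbit_escapes[OF s0(1,2) assms(7)] .
    \<comment> \<open>Maximality makes the orbit a restriction of \<open>u\<close>, so the escape of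
      the orbit is an escape of \<open>u\<close>.\<close>
    have "ereal (exit_time (s0 n)) \<le> a \<and> (\<forall>t\<ge>0. ereal t < ereal (exit_time (s0 n)) \<longrightarrow> orbit (s0 n) t = u t)"
      using max sol unfolding asd_maximal_solution_def by blast
    hence le: "ereal (exit_time (s0 n)) \<le> a" and eq: "orbit (s0 n) t = u t" using t(1,2) by simp_all
    have "ereal t < a" using t(2) le by (meson less_ereal.simps(1) less_le_trans)
    thus ?thesis using max t(1) t(3)[unfolded eq] by blast
  qed
  show ?thesis
  proof (intro exI[of _ "\<sigma> / 4"] exI[of _ "\<lambda>n. orbit (s0 n) 0"] conjI allI)
    show "\<sigma> / 4 > 0" using \<sigma>(1) by simp
    show "orbit (s0 n) 0 \<in> lh ?s" "0 < orbit (s0 n) 0 x" for n x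
      by (rule orbit_near_constant[OF s0(1,3) assms(7)])+
  qed (rule lim escape)+
qed

end
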